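(* Let $V$ be a finite-dimensional vector space over a field $\Bbbk$. Then the following data are equivalent: (i) symmetric algebra structures $(b,\{S_r\}_{r\ge 1})$ on $V$; (ii) $\mathcal{G}$-algebra structures on $V$, i.e. actions $Z=\{Z_{p,q}:\mathcal{G}(p,q)\to \mathrm{Hom}(V^{\otimes p},V^{\otimes q})\}_{p,q\ge 0}$ on $V$ of the PROP $\mathcal{G}$ of ordinary graphs. Here the equivalence means that associating to an action $Z$ the maps $$b:=Z(\text{coupling graph}),\qquad S_r:=Z(\text{$r$-valent star graph}),\quad r\ge 1,$$ is a bijection from the set of data (ii) to the set of data (i).
   Context: Symmetric algebra structure on $V$: a non-degenerate symmetric bilinear form $b:V\otimes V\to\Bbbk$ together with a sequence $\{S_r\}_{r\ge1}$ of linear maps $S_r:V^{\otimes r}\to\Bbbk$ invariant under the symmetric group: $S_r(X_1\otimes\cdots\otimes X_r)=S_r(X_{\sigma(1)}\otimes\cdots\otimes X_{\sigma(r)})$ for all permutations $\sigma$ of $\{1,\dots,r\}$. The tensors $S_r$ for different $r$ satisfy no further compatibility. Ordinary graphs: an (ordinary) graph of type $(p,q)$ is a finite purely 1-dimensional complex (possibly disconnected or empty, loops and multiple edges allowed, no isolated vertices) with vertices of any valence $\ge 1$ and with $p+q$ additional distinguished free ends called endpoints (not counted as vertices), divided into two totally ordered sets $\mathrm{In}(\Gamma)$ of cardinality $p$ and $\mathrm{Out}(\Gamma)$ of cardinality $q$; there is no further structure at the vertices. An edge may join two vertices (possibly equal), a vertex and an endpoint, or two endpoints; components that are circles without vertices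 are allowed (they arise when composing). Graphs are considered up to isomorphism (preserving endpoints with their orders). PROP $\mathcal{G}$: $\mathcal{G}(p,q)$ is the $\Bbbk$-linear span of (isomorphism classes of) graphs of type $(p,q)$. The composition $\mathcal{G}(q,r)\otimes\mathcal{G}(p,q)\to\mathcal{G}(p,r)$, $(\Gamma,\Phi)\mapsto\Gamma\circ\Phi$, is the bilinear extension of gluing the $i$-th Out endpoint of $\Phi$ to the $i$-th In endpoint of $\Gamma$ for all $i$ (the glued point becoming an interior point of an edge). The tensor product is the bilinear extension of juxtaposition (disjoint union, with the endpoints of the first graph preceding those of the second). The identity in $\mathcal{G}(p,p)$ is the graph consisting of $p$ edges joining the $i$-th In endpoint to the $i$-th Out endpoint. The crossing in $\mathcal{G}(2,2)$ consists of two edges joining In endpoint 1 to Out endpoint 2 and In endpoint 2 to Out endpoint 1. Action: an action of $\mathcal{G}$ on $V$ is a family of linear maps $Z_{p,q}:\mathcal{G}(p,q)\to\mathrm{Hom}(V^{\otimes p},V^{\otimes q})$ (with $V^{\otimes 0}=\Bbbk$) such that $Z(\Gamma\circ\Phi)=Z(\Gamma)\circ Z(\Phi)$, $Z(\Gamma\otimes\Phi)=Z(\Gamma)\otimes Z(\Phi)$, identities go to identities, and the crossing goes to the flip $x\otimes y\mapsto y\otimes x$. A vector space with such an action is a $\mathcal{G}$-algebra. Coupling graph: the element of $\mathcal{G}(2,0)$ consisting of a single edge whose two ends are the two In endpoints. $r$-valent star graph: the element of $\mathcal{G}(r,0)$ with a single vertex of valence $r$, joined by $r$ edges to the $r$ In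 endpoints. *)

theory Defs
  imports
    Complex_Main
    "HOL-Library.FuncSet"
    "HOL-Library.Function_Algebras"
    "HOL-Library.Poly_Mapping"
    "HOL-Combinatorics.Permutations"
begin

section \<open>Tensor powers of a vector space\<close>

definition multilinear ::
  "('k::field \<Rightarrow> 'v::ab_group_add \<Rightarrow> 'v) \<Rightarrow> ('k \<Rightarrow> 'w::ab_group_add \<Rightarrow> 'w) \<Rightarrow> nat \<Rightarrow> ('v list \<Rightarrow> 'w) \<Rightarrow> bool" where
  "multilinear s s' n F \<longleftrightarrow>
     (\<forall>xs. length xs = n \<longrightarrow> (\<forall>i<n. Vector_Spaces.linear s s' (\<lambda>x. F (xs[i := x]))))"

text \<open>
  Multilinear forms over a field separate the points of a tensor power, so the tensor
  \<open>x\<^sub>1 \<otimes> \<dots> \<otimes> x\<^sub>n\<close> is realised as the functional \<open>f \<mapsto> f [x\<^sub>1, \<dots>, x\<^sub>n]\<close> on the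
  \<open>n\<close>-linear forms, extended by \<open>0\<close> to functions that are not \<open>n\<close>-linear forms.
  The \<open>n\<close>-th tensor power is the span of these functionals; its universal property is
  lemma \<open>tensor_power_universal\<close> below.
\<close>

type_synonym ('v, 'k) tensor = "('v list \<Rightarrow> 'k) \<Rightarrow> 'k"

definition tscale :: "'k::field \<Rightarrow> ('v, 'k) tensor \<Rightarrow> ('v, 'k) tensor" where
  "tscale c t = (\<lambda>f. c * t f)"

definition pure_tensor ::
  "('k::field \<Rightarrow> 'v::ab_group_add \<Rightarrow> 'v) \<Rightarrow> 'v list \<Rightarrow> ('v, 'k) tensor" where
  "pure_tensor s xs = (\<lambda>f. if multilinear s (*) (length xs) f then f xs else 0)"

definition tensor_power ::
  "('k::field \<Rightarrow> 'v::ab_group_add \<Rightarrow> 'v) \<Rightarrow> nat \<Rightarrow> ('v, 'k) tensor set" where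
  "tensor_power s n = module.span tscale (pure_tensor s ` {xs. length xs = n})"

text \<open>The multiplication of the \<open>m\<close>-th and the \<open>n\<close>-th tensor power with values in the
  \<open>(m + n)\<close>-th one; it is bilinear and is concatenation on pure tensors
  (lemmas \<open>tensor_mult_pure\<close>, \<open>tensor_mult_linear_left\<close>, \<open>tensor_mult_linear_right\<close>).\<close>

definition tensor_mult ::
  "('k::field \<Rightarrow> 'v::ab_group_add \<Rightarrow> 'v) \<Rightarrow> nat \<Rightarrow> nat \<Rightarrow> ('v, 'k) tensor \<Rightarrow> ('v, 'k) tensor \<Rightarrow> ('v, 'k) tensor" where
  "tensor_mult s m n t u =
     (\<lambda>f. if multilinear s (*) (m + n) f then t (\<lambda>xs. u (\<lambda>ys. f (xs @ ys))) else 0)"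

text \<open>The identification of the zeroth tensor power with the ground field.\<close>

definition to_scalar :: "('k::field \<Rightarrow> 'v::ab_group_add \<Rightarrow> 'v) \<Rightarrow> ('v, 'k) tensor \<Rightarrow> 'k" where
  "to_scalar s t = (THE c. t = tscale c (pure_tensor s []))"

definition linear_on_set ::
  "('k \<Rightarrow> 'a::ab_group_add \<Rightarrow> 'a) \<Rightarrow> ('k \<Rightarrow> 'b::ab_group_add \<Rightarrow> 'b) \<Rightarrow> 'a set \<Rightarrow> ('a \<Rightarrow> 'b) \<Rightarrow> bool" where
  "linear_on_set s s' U f \<longleftrightarrow>
     (\<forall>x\<in>U. \<forall>y\<in>U. f (x + y) = f x + f y) \<and> (\<forall>c. \<forall>x\<in>U. f (s c x) = s' c (f x))"

text \<open>Maps on tensor powers are \<open>undefined\<close> outside their domain, so that two of them are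
  equal as soon as they agree on it.\<close>

definition tensor_hom ::
  "('k::field \<Rightarrow> 'v::ab_group_add \<Rightarrow> 'v) \<Rightarrow> nat \<Rightarrow> nat \<Rightarrow> (('v, 'k) tensor \<Rightarrow> ('v, 'k) tensor) set" where
  "tensor_hom s p q =
     {f \<in> tensor_power s p \<rightarrow>\<^sub>E tensor_power s q. linear_on_set tscale tscale (tensor_power s p) f}"

definition tensor_form ::
  "('k::field \<Rightarrow> 'v::ab_group_add \<Rightarrow> 'v) \<Rightarrow> nat \<Rightarrow> (('v, 'k) tensor \<Rightarrow> 'k) set" where
  "tensor_form s p =
     {f \<in> extensional (tensor_power s p). linear_on_set tscale (*) (tensor_power s p) f}"

lemma vector_space_tscale: "vector_space (tscale :: 'k::field \<Rightarrow> ('v, 'k) tensor \<Rightarrow> _)"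
  by unfold_locales (auto simp: tscale_def fun_eq_iff algebra_simps)

lemma pure_in_tensor_power:
  fixes s :: "'a::field \<Rightarrow> 'b::ab_group_add \<Rightarrow> 'b"
  shows "length xs = n \<Longrightarrow> pure_tensor s xs \<in> tensor_power s n"
proof -
  interpret T: vector_space "tscale :: 'a \<Rightarrow> ('b, 'a) tensor \<Rightarrow> _" by (rule vector_space_tscale)
  show "length xs = n \<Longrightarrow> pure_tensor s xs \<in> tensor_power s n"
    unfolding tensor_power_def by (auto intro: T.span_base)
qed

lemma pure_tensor_multilinear:
  fixes s :: "'a::field \<Rightarrow> 'b::ab_group_add \<Rightarrow> 'b"
  assumes "vector_space s"
  shows "multilinear s tscale n (pure_tensor s)"
proof -
  interpret V: vector_space s by fact
  interpret T: vector_space "tscale :: 'a \<Rightarrow> ('b, 'a) tensor \<Rightarrow> _" by (rule vector_space_tscale)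
  have *: "f (xs[i := x + y]) = f (xs[i := x]) + f (xs[i := y])"
    "f (xs[i := s c x]) = c * f (xs[i := x])"
    if "multilinear s (*) (length xs) f" "i < length xs" for f :: "'b list \<Rightarrow> 'a" and xs i x y c
    using that
    by (auto simp: multilinear_def Vector_Spaces.linear_iff dest: spec[where x = xs])
  show ?thesis
    unfolding multilinear_def Vector_Spaces.linear_iff
    by (auto simp: V.vector_space_axioms T.vector_space_axioms pure_tensor_def tscale_def fun_eq_iff *)
qed

lemma vector_space_separates:
  fixes s :: "'k::field \<Rightarrow> 'v::ab_group_add \<Rightarrow> 'v"
  assumes "vector_space s" and "\<And>\<phi>. Vector_Spaces.linear s (*) \<phi> \<Longrightarrow> \<phi> v = \<phi> w"
  shows "v = w"
proof (rule ccontr)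
  assume "v \<noteq> w"
  interpret V: vector_space s by fact
  interpret K: vector_space "(*) :: 'k \<Rightarrow> 'k \<Rightarrow> 'k" by unfold_locales (auto simp: algebra_simps)
  interpret VK: vector_space_pair s "(*)" ..
  have "V.independent {v - w}" using \<open>v \<noteq> w\<close> by simp
  then obtain \<phi> where \<phi>: "Vector_Spaces.linear s (*) \<phi>" "\<phi> (v - w) = 1"
    using VK.linear_independent_extend[of "{v - w}" "\<lambda>_. 1"] by auto
  have "\<phi> (v - w) = \<phi> v - \<phi> w" using module_hom.diff[of s "(*)" \<phi> v w] \<phi>(1) by (simp add: module_hom_iff_linear)
  then show False using assms(2)[OF \<phi>(1)] \<phi>(2) by simp
qed

lemma tensor_power_universal:
  fixes s :: "'k::field \<Rightarrow> 'v::ab_group_add \<Rightarrow> 'v" and s' :: "'k \<Rightarrow> 'w::ab_group_add \<Rightarrow> 'w"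
  assumes s: "vector_space s" and s': "vector_space s'" and F: "multilinear s s' n F"
  shows "\<exists>!L. L \<in> extensional (tensor_power s n) \<and> linear_on_set tscale s' (tensor_power s n) L \<and>
              (\<forall>xs. length xs = n \<longrightarrow> L (pure_tensor s xs) = F xs)"
proof -
  interpret V: vector_space s by fact
  interpret W: vector_space s' by fact
  interpret T: vector_space "tscale :: 'k \<Rightarrow> ('v, 'k) tensor \<Rightarrow> _" by (rule vector_space_tscale)
  let ?T = "tensor_power s n"
  let ?S = "pure_tensor s ` {xs. length xs = n}"
  let ?R = "\<lambda>t w. \<forall>\<phi>. Vector_Spaces.linear s' (*) \<phi> \<longrightarrow> t (\<lambda>xs. \<phi> (F xs)) = \<phi> w"
  have lin: "\<phi> (x + y) = \<phi> x + \<phi> y" "\<phi> (s' c x) = c * \<phi> x" "\<phi> 0 = 0"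
    if "Vector_Spaces.linear s' (*) \<phi>" for \<phi> x y c
  proof -
    interpret module_hom s' "(*)" \<phi> using that by (simp add: module_hom_iff_linear)
    show "\<phi> (x + y) = \<phi> x + \<phi> y" "\<phi> (s' c x) = c * \<phi> x" "\<phi> 0 = 0"
      by (simp_all add: add scale)
  qed
  have pure: "?R (pure_tensor s xs) (F xs)" if "length xs = n" for xs
  proof safe
    fix \<phi> assume \<phi>: "Vector_Spaces.linear s' (*) \<phi>"
    have "multilinear s (*) n (\<lambda>xs. \<phi> (F xs))"
      using F Vector_Spaces.linear_compose[OF _ \<phi>, unfolded o_def]
      unfolding multilinear_def by blast
    then show "pure_tensor s xs (\<lambda>xs. \<phi> (F xs)) = \<phi> (F xs)"
      using that by (simp add: pure_tensor_def)
  qed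
  have unique: "w = w'" if "?R t w" "?R t w'" for t w w'
    by (rule vector_space_separates[OF s']) (use that in metis)
  have ex: "\<exists>w. ?R t w" if "t \<in> ?T" for t
    using that unfolding tensor_power_def
  proof (induction rule: T.span_induct_alt)
    case base
    show ?case by (rule exI[of _ 0]) (simp add: lin)
  next
    case (step c x y)
    then obtain xs w where "length xs = n" "x = pure_tensor s xs" "?R y w" by auto
    then have "?R (tscale c x + y) (s' c (F xs) + w)"
      using pure[of xs] by (simp add: lin tscale_def)
    then show ?case by blast
  qed
  define L where "L = restrict (\<lambda>t. THE w. ?R t w) ?T"
  have L: "?R t (L t)" if "t \<in> ?T" for t
  proof -
    have "?R t (THE w. ?R t w)"
      by (rule theI', rule ex_ex1I, rule ex[OF that], rule unique)
    then show ?thesis using that by (simp add: L_def)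
  qed
  have sub: "x + y \<in> ?T" "tscale c x \<in> ?T" if "x \<in> ?T" "y \<in> ?T" for c x y
    using that unfolding tensor_power_def by (auto intro: T.span_add T.span_scale)
  show ?thesis
  proof (rule ex1I[of _ L], intro conjI allI impI)
    show "L \<in> extensional ?T" by (simp add: L_def)
    show "linear_on_set tscale s' ?T L"
      unfolding linear_on_set_def
    proof safe
      fix x y assume xy: "x \<in> ?T" "y \<in> ?T"
      show "L (x + y) = L x + L y"
        by (rule unique[of "x + y"]) (use L[OF xy(1)] L[OF xy(2)] L[OF sub(1)[OF xy]] in \<open>auto simp: lin\<close>)
    next
      fix c x assume x: "x \<in> ?T"
      show "L (tscale c x) = s' c (L x)"
        by (rule unique[of "tscale c x"]) (use L[OF x] L[OF sub(2)[OF x x]] in \<open>auto simp: lin tscale_def\<close>)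
    qed
    show "L (pure_tensor s xs) = F xs" if "length xs = n" for xs
      by (rule unique[OF L[OF pure_in_tensor_power[OF that]] pure[OF that]])
  next
    fix M
    assume M: "M \<in> extensional ?T \<and> linear_on_set tscale s' ?T M \<and>
               (\<forall>xs. length xs = n \<longrightarrow> M (pure_tensor s xs) = F xs)"
    have "?R t (M t)" if "t \<in> ?T" for t
    proof -
      have "t \<in> ?T \<and> ?R t (M t)"
        using that unfolding tensor_power_def
      proof (induction rule: T.span_induct_alt)
        case base
        have "M (tscale 0 0) = s' 0 (M 0)"
          using M T.span_zero[of ?S] unfolding linear_on_set_def tensor_power_def by blast
        then have "M 0 = 0" by simp
        then show ?case using T.span_zero[of ?S] by (simp add: lin flip: zero_fun_def)
      next
        case (step c x y)
        then obtain xs where xs: "length xs = n" "x = pure_tensor s xs" by auto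
        have x: "x \<in> ?T" using xs by (simp add: pure_in_tensor_power)
        have y: "y \<in> ?T" using step by (simp add: tensor_power_def)
        have "M (tscale c x + y) = s' c (F xs) + M y"
          using M xs x y sub(2)[OF x x, of c] unfolding linear_on_set_def by simp
        moreover have "(tscale c x + y) (\<lambda>xs. \<phi> (F xs)) = \<phi> (s' c (F xs) + M y)"
          if "Vector_Spaces.linear s' (*) \<phi>" for \<phi>
          using step.IH pure[OF xs(1)] xs(2) that by (simp add: lin tscale_def)
        ultimately show ?case
          using sub(1)[OF sub(2)[OF x x] y] unfolding tensor_power_def by metis
      qed
      then show ?thesis by simp
    qed
    then have "M t = L t" if "t \<in> ?T" for t using unique L that by blast
    then show "M = L" using M by (intro extensionalityI[of M ?T L]) (auto simp: L_def)
  qed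
qed

lemma tensor_mult_pure:
  fixes s :: "'a::field \<Rightarrow> 'b::ab_group_add \<Rightarrow> 'b"
  shows "tensor_mult s (length xs) (length ys) (pure_tensor s xs) (pure_tensor s ys) = pure_tensor s (xs @ ys)"
proof
  fix f :: "'b list \<Rightarrow> 'a"
  show "tensor_mult s (length xs) (length ys) (pure_tensor s xs) (pure_tensor s ys) f = pure_tensor s (xs @ ys) f"
  proof (cases "multilinear s (*) (length xs + length ys) f")
    case False
    then show ?thesis by (simp add: tensor_mult_def pure_tensor_def)
  next
    case f: True
    have r: "multilinear s (*) (length ys) (\<lambda>ys. f (us @ ys))" if "length us = length xs" for us
      unfolding multilinear_def
    proof (intro allI impI)
      fix vs :: "'b list" and i assume "length vs = length ys" "i < length ys"
      then show "Vector_Spaces.linear s (*) (\<lambda>x. f (us @ vs[i := x]))"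
        using f[unfolded multilinear_def, rule_format, of "us @ vs" "length us + i"] that
        by (simp add: list_update_append)
    qed
    have l: "multilinear s (*) (length xs)
        (\<lambda>us. if multilinear s (*) (length ys) (\<lambda>ys. f (us @ ys)) then f (us @ ys) else 0)"
    proof (subst multilinear_def, intro allI impI)
      fix us :: "'b list" and i assume "length us = length xs" "i < length xs"
      then show "Vector_Spaces.linear s (*) (\<lambda>x.
          if multilinear s (*) (length ys) (\<lambda>ys. f (us[i := x] @ ys)) then f (us[i := x] @ ys) else 0)"
        using f[unfolded multilinear_def, rule_format, of "us @ ys" i]
        by (simp add: list_update_append r)
    qed
    show ?thesis using f r l by (simp add: tensor_mult_def pure_tensor_def)
  qed
qed

lemma tensor_mult_linear_left:
  shows "tensor_mult s m n (t + t') u = tensor_mult s m n t u + tensor_mult s m n t' u"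
    and "tensor_mult s m n (tscale c t) u = tscale c (tensor_mult s m n t u)"
  by (auto simp: tensor_mult_def tscale_def fun_eq_iff)

lemma tensor_power_form_linear:
  fixes s :: "'a::field \<Rightarrow> 'b::ab_group_add \<Rightarrow> 'b"
  assumes s: "vector_space s" and t: "t \<in> tensor_power s n"
    and f: "\<And>xs. length xs = n \<Longrightarrow> h xs = c * f xs + d * g xs"
    and ml: "multilinear s (*) n f" "multilinear s (*) n g"
  shows "t h = c * t f + d * t g"
proof -
  interpret V: vector_space s by fact
  interpret T: vector_space "tscale :: 'a \<Rightarrow> ('b, 'a) tensor \<Rightarrow> _" by (rule vector_space_tscale)
  have h: "multilinear s (*) n h"
    using ml unfolding multilinear_def Vector_Spaces.linear_iff by (auto simp: f algebra_simps)
  show ?thesis using t unfolding tensor_power_def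
  proof (induction rule: T.span_induct_alt)
    case base
    show ?case by simp
  next
    case (step a x y)
    then show ?case using h ml by (auto simp: tscale_def pure_tensor_def f algebra_simps)
  qed
qed

lemma tensor_mult_linear_right:
  fixes s :: "'a::field \<Rightarrow> 'b::ab_group_add \<Rightarrow> 'b"
  assumes s: "vector_space s" and t: "t \<in> tensor_power s m"
    and u: "u \<in> tensor_power s n" and u': "u' \<in> tensor_power s n"
  shows "tensor_mult s m n t (u + u') = tensor_mult s m n t u + tensor_mult s m n t u'"
    and "tensor_mult s m n t (tscale c u) = tscale c (tensor_mult s m n t u)"
proof -
  interpret V: vector_space s by fact
  interpret T: vector_space "tscale :: 'a \<Rightarrow> ('b, 'a) tensor \<Rightarrow> _" by (rule vector_space_tscale)
  have K: "vector_space ((*) :: 'a \<Rightarrow> 'a \<Rightarrow> 'a)" by unfold_locales (auto simp: algebra_simps)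
  have ml: "multilinear s (*) m (\<lambda>xs. v (\<lambda>ys. f (xs @ ys)))"
    if f: "multilinear s (*) (m + n) f" and v: "v \<in> tensor_power s n" for v f
    unfolding multilinear_def Vector_Spaces.linear_iff
  proof (intro allI impI conjI)
    fix xs :: "'b list" and i x y c
    assume xs: "length xs = m" "i < m"
    have m: "multilinear s (*) n (\<lambda>ys. f (xs @ ys))" if "length xs = m" for xs
      unfolding multilinear_def
    proof (intro allI impI)
      fix vs :: "'b list" and j assume "length vs = n" "j < n"
      then show "Vector_Spaces.linear s (*) (\<lambda>x. f (xs @ vs[j := x]))"
        using f[unfolded multilinear_def, rule_format, of "xs @ vs" "m + j"] that
        by (simp add: list_update_append)
    qed
    have l: "Vector_Spaces.linear s (*) (\<lambda>x. f (xs[i := x] @ ys))" if "length ys = n" for ys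
      using f[unfolded multilinear_def, rule_format, of "xs @ ys" i] that xs
      by (simp add: list_update_append)
    show "v (\<lambda>ys. f (xs[i := x + y] @ ys)) = v (\<lambda>ys. f (xs[i := x] @ ys)) + v (\<lambda>ys. f (xs[i := y] @ ys))"
      using tensor_power_form_linear[OF s v, of "\<lambda>ys. f (xs[i := x + y] @ ys)" 1 "\<lambda>ys. f (xs[i := x] @ ys)"
          1 "\<lambda>ys. f (xs[i := y] @ ys)"] l m xs by (simp add: Vector_Spaces.linear_iff)
    show "v (\<lambda>ys. f (xs[i := s c x] @ ys)) = c * v (\<lambda>ys. f (xs[i := x] @ ys))"
      using tensor_power_form_linear[OF s v, of "\<lambda>ys. f (xs[i := s c x] @ ys)" c "\<lambda>ys. f (xs[i := x] @ ys)"
          0 "\<lambda>ys. f (xs[i := x] @ ys)"] l m xs by (simp add: Vector_Spaces.linear_iff)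
  qed (use s K in auto)
  show "tensor_mult s m n t (u + u') = tensor_mult s m n t u + tensor_mult s m n t u'"
  proof
    fix f
    show "tensor_mult s m n t (u + u') f = (tensor_mult s m n t u + tensor_mult s m n t u') f"
      using tensor_power_form_linear[OF s t, of "\<lambda>xs. (u + u') (\<lambda>ys. f (xs @ ys))" 1
          "\<lambda>xs. u (\<lambda>ys. f (xs @ ys))" 1 "\<lambda>xs. u' (\<lambda>ys. f (xs @ ys))"] ml[OF _ u] ml[OF _ u']
      by (simp add: tensor_mult_def)
  qed
  show "tensor_mult s m n t (tscale c u) = tscale c (tensor_mult s m n t u)"
  proof
    fix f
    show "tensor_mult s m n t (tscale c u) f = tscale c (tensor_mult s m n t u) f"
      using tensor_power_form_linear[OF s t, of "\<lambda>xs. (tscale c u) (\<lambda>ys. f (xs @ ys))" c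
          "\<lambda>xs. u (\<lambda>ys. f (xs @ ys))" 0 "\<lambda>xs. u (\<lambda>ys. f (xs @ ys))"] ml[OF _ u]
      by (simp add: tensor_mult_def tscale_def)
  qed
qed


section \<open>Symmetric algebra structures\<close>

text \<open>The sequence of the \<open>S\<^sub>r\<close> starts at \<open>r = 1\<close>; the value at \<open>0\<close> is \<open>undefined\<close>.\<close>

definition symmetric_algebra_structures ::
  "('k::field \<Rightarrow> 'v::ab_group_add \<Rightarrow> 'v) \<Rightarrow>
   ((('v, 'k) tensor \<Rightarrow> 'k) \<times> (nat \<Rightarrow> ('v, 'k) tensor \<Rightarrow> 'k)) set" where
  "symmetric_algebra_structures s =
     {(b, S).
        b \<in> tensor_form s 2 \<and>
        (\<forall>x y. b (pure_tensor s [x, y]) = b (pure_tensor s [y, x])) \<and>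
        (\<forall>x. (\<forall>y. b (pure_tensor s [x, y]) = 0) \<longrightarrow> x = 0) \<and>
        S \<in> extensional {1..} \<and>
        (\<forall>r\<ge>1. S r \<in> tensor_form s r \<and>
           (\<forall>xs \<sigma>. length xs = r \<and> \<sigma> permutes {..<r} \<longrightarrow>
              S r (pure_tensor s xs) = S r (pure_tensor s (permute_list \<sigma> xs))))}"


section \<open>Graphs\<close>

text \<open>
  The ends of the edges of a graph: an end either is a half-edge lying at a vertex or is
  one of the endpoints. The endpoints are numbered from \<open>0\<close>.
\<close>

datatype 'h edge_end = Half 'h | In nat | Out nat

text \<open>
  \<open>vtx h\<close> is the vertex at which the half-edge \<open>h\<close> lies, and \<open>edge_of x\<close> is the edge of which
  \<open>x\<close> is an end. An edge with two ends is an interval, an edge with no end is a circle without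
  vertices. Surjectivity of \<open>vtx\<close> says that all vertices have valence at least \<open>1\<close>.
\<close>

record ('v, 'h, 'e) pregraph =
  verts :: "'v set"
  halves :: "'h set"
  edges :: "'e set"
  n_in :: nat
  n_out :: nat
  vtx :: "'h \<Rightarrow> 'v"
  edge_of :: "'h edge_end \<Rightarrow> 'e"

definition ends :: "('v, 'h, 'e) pregraph \<Rightarrow> 'h edge_end set" where
  "ends G = Half ` halves G \<union> In ` {..<n_in G} \<union> Out ` {..<n_out G}"

definition is_graph :: "('v, 'h, 'e) pregraph \<Rightarrow> bool" where
  "is_graph G \<longleftrightarrow>
     finite (verts G) \<and> finite (halves G) \<and> finite (edges G) \<and>
     vtx G ` halves G = verts G \<and>
     edge_of G ` ends G \<subseteq> edges G \<and>
     (\<forall>e\<in>edges G. card {x \<in> ends G. edge_of G x = e} \<in> {0, 2})"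

definition graph_iso :: "('v, 'h, 'e) pregraph \<Rightarrow> ('v', 'h', 'e') pregraph \<Rightarrow> bool" where
  "graph_iso G H \<longleftrightarrow>
     n_in G = n_in H \<and> n_out G = n_out H \<and>
     (\<exists>\<alpha> \<beta> \<gamma>. bij_betw \<alpha> (verts G) (verts H) \<and> bij_betw \<beta> (halves G) (halves H) \<and>
        bij_betw \<gamma> (edges G) (edges H) \<and>
        (\<forall>h\<in>halves G. vtx H (\<beta> h) = \<alpha> (vtx G h)) \<and>
        (\<forall>x\<in>ends G. edge_of H (map_edge_end \<beta> x) = \<gamma> (edge_of G x)))"

text \<open>
  As graphs are finite, each of them is isomorphic to one whose vertices, half-edges and edges
  are natural numbers; an isomorphism class is represented by the set of its members of this form.
\<close>

type_synonym nat_graph = "(nat, nat, nat) pregraph"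
type_synonym graph_class = "nat_graph set"

definition iso_class :: "('v, 'h, 'e) pregraph \<Rightarrow> graph_class" where
  "iso_class G = {N. is_graph N \<and> graph_iso N G}"

definition graph_classes :: "nat \<Rightarrow> nat \<Rightarrow> graph_class set" where
  "graph_classes p q = {iso_class G | G :: nat_graph. is_graph G \<and> n_in G = p \<and> n_out G = q}"

text \<open>
  In the composition of \<open>G\<close> after \<open>F\<close>, the edges are the classes of edges of \<open>G\<close> and \<open>F\<close> under
  the equivalence relation generated by identifying the edge at \<open>In i\<close> of \<open>G\<close> with the edge at
  \<open>Out i\<close> of \<open>F\<close>. A class that contains no end of the composite graph is a circle.
\<close>

definition glue_rel ::
  "('v, 'h, 'e) pregraph \<Rightarrow> ('v', 'h', 'e') pregraph \<Rightarrow> (('e + 'e') \<times> ('e + 'e')) set" where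
  "glue_rel G F =
     (let R = {(Inl (edge_of G (In i)), Inr (edge_of F (Out i))) | i. i < n_in G} in (R \<union> R\<inverse>)\<^sup>*)"

definition graph_comp ::
  "('v, 'h, 'e) pregraph \<Rightarrow> ('v', 'h', 'e') pregraph \<Rightarrow> ('v + 'v', 'h + 'h', ('e + 'e') set) pregraph" where
  "graph_comp G F =
     \<lparr> verts = verts G <+> verts F,
       halves = halves G <+> halves F,
       edges = (edges G <+> edges F) // glue_rel G F,
       n_in = n_in F,
       n_out = n_out G,
       vtx = map_sum (vtx G) (vtx F),
       edge_of = (\<lambda>x. glue_rel G F `` {case x of
           Half (Inl h) \<Rightarrow> Inl (edge_of G (Half h))
         | Half (Inr h) \<Rightarrow> Inr (edge_of F (Half h))
         | In i \<Rightarrow> Inr (edge_of F (In i))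
         | Out j \<Rightarrow> Inl (edge_of G (Out j))}) \<rparr>"

definition graph_juxt ::
  "('v, 'h, 'e) pregraph \<Rightarrow> ('v', 'h', 'e') pregraph \<Rightarrow> ('v + 'v', 'h + 'h', 'e + 'e') pregraph" where
  "graph_juxt G F =
     \<lparr> verts = verts G <+> verts F,
       halves = halves G <+> halves F,
       edges = edges G <+> edges F,
       n_in = n_in G + n_in F,
       n_out = n_out G + n_out F,
       vtx = map_sum (vtx G) (vtx F),
       edge_of = (\<lambda>x. case x of
           Half (Inl h) \<Rightarrow> Inl (edge_of G (Half h))
         | Half (Inr h) \<Rightarrow> Inr (edge_of F (Half h))
         | In i \<Rightarrow> if i < n_in G then Inl (edge_of G (In i)) else Inr (edge_of F (In (i - n_in G)))
         | Out j \<Rightarrow> if j < n_out G then Inl (edge_of G (Out j)) else Inr (edge_of F (Out (j - n_out G)))) \<rparr>"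

definition class_comp :: "graph_class \<Rightarrow> graph_class \<Rightarrow> graph_class" where
  "class_comp A B = (\<Union>G\<in>A. \<Union>F\<in>B. iso_class (graph_comp G F))"

definition class_juxt :: "graph_class \<Rightarrow> graph_class \<Rightarrow> graph_class" where
  "class_juxt A B = (\<Union>G\<in>A. \<Union>F\<in>B. iso_class (graph_juxt G F))"

definition identity_graph :: "nat \<Rightarrow> nat_graph" where
  "identity_graph p =
     \<lparr> verts = {}, halves = {}, edges = {..<p}, n_in = p, n_out = p, vtx = (\<lambda>_. 0),
       edge_of = (\<lambda>x. case x of Half h \<Rightarrow> 0 | In i \<Rightarrow> i | Out j \<Rightarrow> j) \<rparr>"

definition crossing_graph :: nat_graph where
  "crossing_graph =
     \<lparr> verts = {}, halves = {}, edges = {0, 1}, n_in = 2, n_out = 2, vtx = (\<lambda>_. 0),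
       edge_of = (\<lambda>x. case x of Half h \<Rightarrow> 0 | In i \<Rightarrow> i | Out j \<Rightarrow> 1 - j) \<rparr>"

definition coupling_graph :: nat_graph where
  "coupling_graph =
     \<lparr> verts = {}, halves = {}, edges = {0}, n_in = 2, n_out = 0, vtx = (\<lambda>_. 0),
       edge_of = (\<lambda>_. 0) \<rparr>"

definition star_graph :: "nat \<Rightarrow> nat_graph" where
  "star_graph r =
     \<lparr> verts = {0}, halves = {..<r}, edges = {..<r}, n_in = r, n_out = 0, vtx = (\<lambda>_. 0),
       edge_of = (\<lambda>x. case x of Half h \<Rightarrow> h | In i \<Rightarrow> i | Out j \<Rightarrow> 0) \<rparr>"


section \<open>The PROP of graphs and its actions\<close>

type_synonym 'k graph_comb = "graph_class \<Rightarrow>\<^sub>0 'k"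

definition gscale :: "'k::field \<Rightarrow> 'k graph_comb \<Rightarrow> 'k graph_comb" where
  "gscale c X = Poly_Mapping.map ((*) c) X"

definition graph_elem :: "('v, 'h, 'e) pregraph \<Rightarrow> 'k::field graph_comb" where
  "graph_elem G = Poly_Mapping.single (iso_class G) 1"

definition graph_prop :: "nat \<Rightarrow> nat \<Rightarrow> 'k::field graph_comb set" where
  "graph_prop p q = {X. Poly_Mapping.keys X \<subseteq> graph_classes p q}"

definition bilinear_ext ::
  "(graph_class \<Rightarrow> graph_class \<Rightarrow> graph_class) \<Rightarrow> 'k::field graph_comb \<Rightarrow> 'k graph_comb \<Rightarrow> 'k graph_comb" where
  "bilinear_ext op X Y =
     (\<Sum>A\<in>Poly_Mapping.keys X. \<Sum>B\<in>Poly_Mapping.keys Y.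
        Poly_Mapping.single (op A B) (Poly_Mapping.lookup X A * Poly_Mapping.lookup Y B))"

definition prop_comp :: "'k::field graph_comb \<Rightarrow> 'k graph_comb \<Rightarrow> 'k graph_comb" where
  "prop_comp = bilinear_ext class_comp"

definition prop_tensor :: "'k::field graph_comb \<Rightarrow> 'k graph_comb \<Rightarrow> 'k graph_comb" where
  "prop_tensor = bilinear_ext class_juxt"

text \<open>
  The condition on \<open>prop_tensor\<close> says that \<open>Z (X \<otimes> Y)\<close> is the linear map \<open>Z X \<otimes> Z Y\<close>, which is
  determined by \<open>(Z X \<otimes> Z Y) (t \<otimes> u) = Z X t \<otimes> Z Y u\<close>.
\<close>

definition graph_actions ::
  "('k::field \<Rightarrow> 'v::ab_group_add \<Rightarrow> 'v) \<Rightarrow>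
   (nat \<Rightarrow> nat \<Rightarrow> 'k graph_comb \<Rightarrow> ('v, 'k) tensor \<Rightarrow> ('v, 'k) tensor) set" where
  "graph_actions s =
     {Z.
        (\<forall>p q. Z p q \<in> graph_prop p q \<rightarrow>\<^sub>E tensor_hom s p q) \<and>
        (\<forall>p q. \<forall>t\<in>tensor_power s p. linear_on_set gscale tscale (graph_prop p q) (\<lambda>X. Z p q X t)) \<and>
        (\<forall>p q r. \<forall>X\<in>graph_prop q r. \<forall>Y\<in>graph_prop p q. \<forall>t\<in>tensor_power s p.
           Z p r (prop_comp X Y) t = Z q r X (Z p q Y t)) \<and>
        (\<forall>p q p' q'. \<forall>X\<in>graph_prop p q. \<forall>Y\<in>graph_prop p' q'.
           \<forall>t\<in>tensor_power s p. \<forall>u\<in>tensor_power s p'.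
           Z (p + p') (q + q') (prop_tensor X Y) (tensor_mult s p p' t u) =
             tensor_mult s q q' (Z p q X t) (Z p' q' Y u)) \<and>
        (\<forall>p. \<forall>t\<in>tensor_power s p. Z p p (graph_elem (identity_graph p)) t = t) \<and>
        (\<forall>x y. Z 2 2 (graph_elem crossing_graph) (pure_tensor s [x, y]) = pure_tensor s [y, x])}"

definition action_coupling ::
  "('k::field \<Rightarrow> 'v::ab_group_add \<Rightarrow> 'v) \<Rightarrow>
   (nat \<Rightarrow> nat \<Rightarrow> 'k graph_comb \<Rightarrow> ('v, 'k) tensor \<Rightarrow> ('v, 'k) tensor) \<Rightarrow> ('v, 'k) tensor \<Rightarrow> 'k" where
  "action_coupling s Z = (\<lambda>t\<in>tensor_power s 2. to_scalar s (Z 2 0 (graph_elem coupling_graph) t))"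

definition action_stars ::
  "('k::field \<Rightarrow> 'v::ab_group_add \<Rightarrow> 'v) \<Rightarrow>
   (nat \<Rightarrow> nat \<Rightarrow> 'k graph_comb \<Rightarrow> ('v, 'k) tensor \<Rightarrow> ('v, 'k) tensor) \<Rightarrow> nat \<Rightarrow> ('v, 'k) tensor \<Rightarrow> 'k" where
  "action_stars s Z =
     (\<lambda>r\<in>{1..}. \<lambda>t\<in>tensor_power s r. to_scalar s (Z r 0 (graph_elem (star_graph r)) t))"

end

theory Submission
  imports Defs
begin

text \<open>
  A graph is made of vertices and edges, and an action of the PROP of graphs is determined by what
  it does to a single vertex and to a single edge. The vertex of valence \<open>r\<close> is the
  star, and no relation links stars of different valence or restricts a star beyond its symmetry.
  The edge with two inputs is the coupling, and the edge with two outputs is forced to be the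
  inverse of the coupling by the snake identity. This is why an action amounts to a non-degenerate
  symmetric form together with arbitrary symmetric tensors.

  From an action to the structure. A crossing below the coupling, or below a star, gives an
  isomorphic graph, so the form and the tensors are symmetric. The snake identity
  (\<open>snake_iso\<close>) yields non-degeneracy: \<open>copairing_contract_left\<close>
  recovers each vector from its pairings with all others.

  Uniqueness. Two actions with the same coupling and stars coincide on copairings, since these are
  inverse to the coupling (\<open>same_copairing\<close>). Every graph is then reduced to
  generators (\<open>agree_all\<close>): inputs are bent to outputs by couplings
  (\<open>bend_iso\<close>), vertices are cut off as stars (\<open>cut_vertex_iso\<close>), and
  what remains is a matching of the outputs with some circles, which is built from copairings,
  couplings and crossings.

  Existence. Given the structure, choose a basis and its dual basis. A graph acts by a state sum:
  every edge is directed and labelled by a basis vector \<open>k\<close>, its ends carry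
  \<open>k\<close> and the dual vector, the vertices contribute values of the tensors, and one
  sums over the labels. Directing the edges makes the sum behave as if the basis were orthonormal,
  for any form and in any characteristic; the result is independent of the directions because the
  copairing is symmetric (\<open>state_sum_orientation\<close>). The crux is functoriality
  (\<open>graph_eval_comp\<close>). Gluing turns the edges of two graphs into chains. These can be
  directed consistently (\<open>graph_comp_orientation\<close>), which makes each glued point a
  Kronecker delta, so the labels of a chain agree and the chain behaves as one edge. A chain that
  closes up to a circle contributes the dimension of the space.
\<close>

section \<open>Isomorphism of graphs\<close>

lemma ends_iff [simp]:
  "Half h \<in> ends G \<longleftrightarrow> h \<in> halves G"
  "In i \<in> ends G \<longleftrightarrow> i < n_in G"
  "Out j \<in> ends G \<longleftrightarrow> j < n_out G"
  by (auto simp: ends_def)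

lemma finite_ends: "is_graph G \<Longrightarrow> finite (ends G)"
  by (simp add: is_graph_def ends_def)

lemma is_graph_edge_of: "is_graph G \<Longrightarrow> x \<in> ends G \<Longrightarrow> edge_of G x \<in> edges G"
  by (auto simp: is_graph_def)

lemma is_graph_vtx: "is_graph G \<Longrightarrow> h \<in> halves G \<Longrightarrow> vtx G h \<in> verts G"
  by (auto simp: is_graph_def)

definition iso_by where
  "iso_by G H \<alpha> \<beta> \<gamma> \<longleftrightarrow> n_in G = n_in H \<and> n_out G = n_out H \<and>
     bij_betw \<alpha> (verts G) (verts H) \<and> bij_betw \<beta> (halves G) (halves H) \<and> bij_betw \<gamma> (edges G) (edges H) \<and>
     (\<forall>h\<in>halves G. vtx H (\<beta> h) = \<alpha> (vtx G h)) \<and>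
     (\<forall>x\<in>ends G. edge_of H (map_edge_end \<beta> x) = \<gamma> (edge_of G x))"

lemma graph_iso_iff: "graph_iso G H \<longleftrightarrow> (\<exists>\<alpha> \<beta> \<gamma>. iso_by G H \<alpha> \<beta> \<gamma>)"
  unfolding graph_iso_def iso_by_def by blast

lemma iso_byD:
  assumes "iso_by G H \<alpha> \<beta> \<gamma>"
  shows "n_in G = n_in H" "n_out G = n_out H"
    and "bij_betw \<alpha> (verts G) (verts H)" "bij_betw \<beta> (halves G) (halves H)"
      "bij_betw \<gamma> (edges G) (edges H)"
    and "\<And>h. h \<in> halves G \<Longrightarrow> vtx H (\<beta> h) = \<alpha> (vtx G h)"
    and "\<And>h. h \<in> halves G \<Longrightarrow> edge_of H (Half (\<beta> h)) = \<gamma> (edge_of G (Half h))"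
    and "\<And>i. i < n_in G \<Longrightarrow> edge_of H (In i) = \<gamma> (edge_of G (In i))"
    and "\<And>j. j < n_out G \<Longrightarrow> edge_of H (Out j) = \<gamma> (edge_of G (Out j))"
proof -
  have e: "edge_of H (map_edge_end \<beta> x) = \<gamma> (edge_of G x)" if "x \<in> ends G" for x
    using assms that by (simp add: iso_by_def)
  show "h \<in> halves G \<Longrightarrow> edge_of H (Half (\<beta> h)) = \<gamma> (edge_of G (Half h))"
    "i < n_in G \<Longrightarrow> edge_of H (In i) = \<gamma> (edge_of G (In i))"
    "j < n_out G \<Longrightarrow> edge_of H (Out j) = \<gamma> (edge_of G (Out j))" for h i j
    using e[of "Half h"] e[of "In i"] e[of "Out j"] by simp_all
qed (use assms in \<open>simp_all add: iso_by_def\<close>)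

lemma graph_isoI:
  assumes "n_in G = n_in H" "n_out G = n_out H"
    and "bij_betw \<alpha> (verts G) (verts H)" "bij_betw \<beta> (halves G) (halves H)"
      "bij_betw \<gamma> (edges G) (edges H)"
    and "\<And>h. h \<in> halves G \<Longrightarrow> vtx H (\<beta> h) = \<alpha> (vtx G h)"
    and "\<And>h. h \<in> halves G \<Longrightarrow> edge_of H (Half (\<beta> h)) = \<gamma> (edge_of G (Half h))"
    and "\<And>i. i < n_in G \<Longrightarrow> edge_of H (In i) = \<gamma> (edge_of G (In i))"
    and "\<And>j. j < n_out G \<Longrightarrow> edge_of H (Out j) = \<gamma> (edge_of G (Out j))"
  shows "graph_iso G H"
proof -
  have "edge_of H (map_edge_end \<beta> x) = \<gamma> (edge_of G x)" if "x \<in> ends G" for x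
    using that assms(7-9) by (cases x) auto
  then have "iso_by G H \<alpha> \<beta> \<gamma>" using assms(1-6) by (simp add: iso_by_def)
  then show ?thesis unfolding graph_iso_iff by blast
qed

lemma graph_iso_trans:
  assumes "graph_iso G H" "graph_iso H K"
  shows "graph_iso G K"
proof -
  obtain \<alpha> \<beta> \<gamma> where 1: "iso_by G H \<alpha> \<beta> \<gamma>"
    using assms(1) unfolding graph_iso_iff by blast
  note 1 = iso_byD[OF 1]
  obtain \<alpha>' \<beta>' \<gamma>' where 2: "iso_by H K \<alpha>' \<beta>' \<gamma>'"
    using assms(2) unfolding graph_iso_iff by blast
  note 2 = iso_byD[OF 2]
  have \<beta>: "h \<in> halves G \<Longrightarrow> \<beta> h \<in> halves H" for h using 1(4) by (auto dest: bij_betwE)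
  show ?thesis
    by (rule graph_isoI[of _ _ "\<alpha>' \<circ> \<alpha>" "\<beta>' \<circ> \<beta>" "\<gamma>' \<circ> \<gamma>"])
      (use 1 2 \<beta> in \<open>auto intro: bij_betw_trans\<close>)
qed

text \<open>The inverse bijections are used. They invert \<open>\<alpha>\<close> and
  \<open>\<gamma>\<close> only on vertices and edges of \<open>G\<close>, which is why
  \<open>vtx\<close> and \<open>edge_of\<close> must take their values there.\<close>

lemma graph_iso_sym:
  assumes "graph_iso G H" "is_graph G"
  shows "graph_iso H G"
proof -
  obtain \<alpha> \<beta> \<gamma> where 1: "iso_by G H \<alpha> \<beta> \<gamma>"
    using assms(1) unfolding graph_iso_iff by blast
  note 1 = iso_byD[OF 1]
  let ?\<alpha> = "inv_into (verts G) \<alpha>" and ?\<beta> = "inv_into (halves G) \<beta>" and ?\<gamma> = "inv_into (edges G) \<gamma>"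
  have inv: "?\<beta> h \<in> halves G" "\<beta> (?\<beta> h) = h" if "h \<in> halves H" for h
    using 1(4) that by (metis bij_betw_def f_inv_into_f inv_into_into)+
  have \<alpha>: "?\<alpha> (\<alpha> v) = v" if "v \<in> verts G" for v
    using 1(3) that by (simp add: bij_betw_def)
  have \<gamma>: "?\<gamma> (\<gamma> e) = e" if "e \<in> edges G" for e
    using 1(5) that by (simp add: bij_betw_def)
  show ?thesis
  proof (rule graph_isoI[of _ _ ?\<alpha> ?\<beta> ?\<gamma>])
    fix h assume h: "h \<in> halves H"
    show "vtx G (?\<beta> h) = ?\<alpha> (vtx H h)"
      using 1(6)[OF inv(1)[OF h]] inv[OF h] \<alpha>[OF is_graph_vtx[OF assms(2)]] by metis
    show "edge_of G (Half (?\<beta> h)) = ?\<gamma> (edge_of H (Half h))"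
      using 1(7)[OF inv(1)[OF h]] inv[OF h] \<gamma>[OF is_graph_edge_of[OF assms(2)]]
      by (metis ends_iff(1))
  next
    show "edge_of G (In i) = ?\<gamma> (edge_of H (In i))" if "i < n_in H" for i
      using that 1(1) 1(8)[of i] \<gamma>[OF is_graph_edge_of[OF assms(2)], of "In i"] by simp
    show "edge_of G (Out i) = ?\<gamma> (edge_of H (Out i))" if "i < n_out H" for i
      using that 1(2) 1(9)[of i] \<gamma>[OF is_graph_edge_of[OF assms(2)], of "Out i"] by simp
  qed (use 1 in \<open>auto intro: bij_betw_inv_into\<close>)
qed

text \<open>The ends enter the definition of a graph only through the sizes of the fibres of
  \<open>edge_of\<close>. So they may be renamed freely (a half-edge may become an endpoint and
  vice versa), and edges may be dropped together with their ends.\<close>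

lemma is_graph_rename_ends:
  assumes G: "is_graph G"
    and "finite (verts H)" "finite (halves H)" "vtx H ` halves H = verts H"
    and E: "bij_betw \<gamma> E (edges H)" "E \<subseteq> edges G"
    and \<phi>: "bij_betw \<phi> (ends H) {x \<in> ends G. edge_of G x \<in> E}"
    and eq: "\<And>x. x \<in> ends H \<Longrightarrow> edge_of H x = \<gamma> (edge_of G (\<phi> x))"
  shows "is_graph H"
proof -
  have mem: "\<phi> x \<in> ends G" "edge_of G (\<phi> x) \<in> E" if "x \<in> ends H" for x
    using \<phi> that by (auto dest: bij_betwE)
  have "card {x \<in> ends H. edge_of H x = e} \<in> {0, 2}" if e: "e \<in> edges H" for e
  proof -
    obtain e' where e': "e' \<in> E" "e = \<gamma> e'" using E e by (auto simp: bij_betw_def)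
    have "edge_of H x = e \<longleftrightarrow> edge_of G (\<phi> x) = e'" if "x \<in> ends H" for x
      using E(1) mem(2)[OF that] e' by (auto simp: bij_betw_def inj_on_def eq[OF that])
    then have "\<phi> ` {x \<in> ends H. edge_of H x = e} = {x \<in> \<phi> ` ends H. edge_of G x = e'}"
      by blast
    also have "\<dots> = {x \<in> ends G. edge_of G x = e'}"
      using \<phi> e'(1) by (auto simp: bij_betw_def)
    finally have "bij_betw \<phi> {x \<in> ends H. edge_of H x = e} {x \<in> ends G. edge_of G x = e'}"
      using \<phi> unfolding bij_betw_def by (auto intro: inj_on_subset)
    then have "card {x \<in> ends H. edge_of H x = e} = card {x \<in> ends G. edge_of G x = e'}"
      by (rule bij_betw_same_card)
    moreover have "e' \<in> edges G" using e' E by blast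
    ultimately show ?thesis using G unfolding is_graph_def by metis
  qed
  moreover have "edge_of H ` ends H \<subseteq> edges H"
    using E(1) mem by (auto simp: eq dest: bij_betwE)
  moreover have "finite (edges H)"
    using G E by (metis bij_betw_finite finite_subset is_graph_def)
  ultimately show ?thesis using assms(2-4) by (auto simp: is_graph_def)
qed

text \<open>Number the vertices, half-edges and edges. This makes isomorphism classes, which
  consist of graphs on natural numbers, available for composites, whose vertices and edges live in
  sum and set types.\<close>

lemma ex_nat_graph:
  fixes G :: "('v, 'h, 'e) pregraph"
  assumes G: "is_graph G"
  shows "\<exists>N :: nat_graph. is_graph N \<and> graph_iso N G"
proof -
  obtain \<alpha> \<beta> \<gamma> where b: "bij_betw \<alpha> (verts G) {..<card (verts G)}"
    "bij_betw \<beta> (halves G) {..<card (halves G)}" "bij_betw \<gamma> (edges G) {..<card (edges G)}"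
    using G ex_bij_betw_finite_nat unfolding is_graph_def atLeast0LessThan by metis
  define N :: nat_graph where "N = \<lparr> verts = {..<card (verts G)}, halves = {..<card (halves G)},
    edges = {..<card (edges G)}, n_in = n_in G, n_out = n_out G,
    vtx = \<alpha> \<circ> vtx G \<circ> inv_into (halves G) \<beta>,
    edge_of = \<gamma> \<circ> edge_of G \<circ> map_edge_end (inv_into (halves G) \<beta>)\<rparr>"
  have iso: "graph_iso G N"
    by (rule graph_isoI[of _ _ \<alpha> \<beta> \<gamma>]) (use b in \<open>auto simp: N_def bij_betw_def\<close>)
  have bi: "bij_betw (inv_into (halves G) \<beta>) {..<card (halves G)} (halves G)"
    using b(2) by (rule bij_betw_inv_into)
  have "is_graph N"
  proof (rule is_graph_rename_ends[OF G])
    show "bij_betw \<gamma> (edges G) (edges N)" "edges G \<subseteq> edges G" using b by (simp_all add: N_def)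
    have "bij_betw (map_edge_end (inv_into (halves G) \<beta>)) (ends N) (ends G)"
    proof (rule bij_betwI[of _ _ _ "map_edge_end \<beta>"])
      show "map_edge_end (inv_into (halves G) \<beta>) \<in> ends N \<rightarrow> ends G"
        using bi by (auto simp: ends_def N_def dest: bij_betwE)
      show "map_edge_end \<beta> \<in> ends G \<rightarrow> ends N"
        using b by (auto simp: ends_def N_def dest: bij_betwE)
    qed (use b in \<open>auto simp: ends_def N_def bij_betw_def f_inv_into_f\<close>)
    moreover have "{x \<in> ends G. edge_of G x \<in> edges G} = ends G"
      using is_graph_edge_of[OF G] by blast
    ultimately show "bij_betw (map_edge_end (inv_into (halves G) \<beta>)) (ends N) {x \<in> ends G. edge_of G x \<in> edges G}"
      by simp
    have "vtx N ` halves N = \<alpha> ` vtx G ` inv_into (halves G) \<beta> ` {..<card (halves G)}"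
      by (simp add: N_def image_comp comp_assoc)
    also have "\<dots> = \<alpha> ` verts G" using bi G by (simp add: bij_betw_def is_graph_def)
    finally show "vtx N ` halves N = verts N" using b by (simp add: N_def bij_betw_def)
  qed (auto simp: N_def)
  with iso show ?thesis using graph_iso_sym[OF iso G] by blast
qed

lemma iso_class_cong:
  assumes "graph_iso G H" "graph_iso H G"
  shows "iso_class G = iso_class H"
  unfolding iso_class_def
  by (auto intro: graph_iso_trans[OF _ assms(1)] graph_iso_trans[OF _ assms(2)])

lemma iso_class_eq:
  assumes "graph_iso G H" "is_graph G"
  shows "iso_class G = iso_class H"
  by (rule iso_class_cong[OF assms(1) graph_iso_sym[OF assms]])

lemma iso_class_in_graph_classes:
  assumes "is_graph G"
  shows "iso_class G \<in> graph_classes (n_in G) (n_out G)"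
proof -
  obtain N :: nat_graph where N: "is_graph N" "graph_iso N G" using ex_nat_graph[OF assms] by blast
  then have "iso_class N = iso_class G" "n_in N = n_in G" "n_out N = n_out G"
    by (auto simp: iso_class_eq graph_iso_def)
  with N show ?thesis unfolding graph_classes_def by (metis (mono_tags, lifting) mem_Collect_eq)
qed

section \<open>Gluing\<close>

lemma graph_comp_simps [simp]:
  "verts (graph_comp G F) = verts G <+> verts F"
  "halves (graph_comp G F) = halves G <+> halves F"
  "edges (graph_comp G F) = (edges G <+> edges F) // glue_rel G F"
  "n_in (graph_comp G F) = n_in F" "n_out (graph_comp G F) = n_out G"
  "vtx (graph_comp G F) = map_sum (vtx G) (vtx F)"
  "edge_of (graph_comp G F) (Half (Inl h)) = glue_rel G F `` {Inl (edge_of G (Half h))}"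
  "edge_of (graph_comp G F) (Half (Inr h')) = glue_rel G F `` {Inr (edge_of F (Half h'))}"
  "edge_of (graph_comp G F) (In i) = glue_rel G F `` {Inr (edge_of F (In i))}"
  "edge_of (graph_comp G F) (Out j) = glue_rel G F `` {Inl (edge_of G (Out j))}"
  by (simp_all add: graph_comp_def)

lemma graph_juxt_simps [simp]:
  "verts (graph_juxt G F) = verts G <+> verts F"
  "halves (graph_juxt G F) = halves G <+> halves F"
  "edges (graph_juxt G F) = edges G <+> edges F"
  "n_in (graph_juxt G F) = n_in G + n_in F" "n_out (graph_juxt G F) = n_out G + n_out F"
  "vtx (graph_juxt G F) = map_sum (vtx G) (vtx F)"
  "edge_of (graph_juxt G F) (Half (Inl h)) = Inl (edge_of G (Half h))"
  "edge_of (graph_juxt G F) (Half (Inr h')) = Inr (edge_of F (Half h'))"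
  "edge_of (graph_juxt G F) (In i) =
     (if i < n_in G then Inl (edge_of G (In i)) else Inr (edge_of F (In (i - n_in G))))"
  "edge_of (graph_juxt G F) (Out j) =
     (if j < n_out G then Inl (edge_of G (Out j)) else Inr (edge_of F (Out (j - n_out G))))"
  by (simp_all add: graph_juxt_def)

lemma equiv_glue_rel: "equiv UNIV (glue_rel G F)"
  unfolding glue_rel_def Let_def
  by (intro equivI refl_rtrancl trans_rtrancl sym_rtrancl sym_Un_converse)
    (auto simp: refl_on_def)

lemma glue_rel_glue: "i < n_in G \<Longrightarrow> (Inl (edge_of G (In i)), Inr (edge_of F (Out i))) \<in> glue_rel G F"
  unfolding glue_rel_def Let_def by (rule r_into_rtrancl) auto

lemma glue_rel_refl: "(e, e) \<in> glue_rel G F"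
  unfolding glue_rel_def Let_def by auto

lemma glue_rel_sym: "(e, e') \<in> glue_rel G F \<Longrightarrow> (e', e) \<in> glue_rel G F"
  using equiv_glue_rel[of G F] by (auto simp: equiv_def sym_def)

lemma glue_rel_trans: "(e, e') \<in> glue_rel G F \<Longrightarrow> (e', e'') \<in> glue_rel G F \<Longrightarrow> (e, e'') \<in> glue_rel G F"
  using equiv_glue_rel[of G F] by (auto simp: equiv_def trans_def)

lemma glue_class_eq_iff: "glue_rel G F `` {e} = glue_rel G F `` {e'} \<longleftrightarrow> (e, e') \<in> glue_rel G F"
  using equiv_class_eq_iff[OF equiv_glue_rel, of e e' G F] by simp

lemma glue_class_some: "(e, SOME e'. e' \<in> glue_rel G F `` {e}) \<in> glue_rel G F"
  using someI[of "\<lambda>e'. e' \<in> glue_rel G F `` {e}" e] by (simp add: glue_rel_refl)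

text \<open>The means by which functions on the edges of the factors descend to the edges of a
  composite graph.\<close>

lemma glue_rel_invariant:
  assumes "(e, e') \<in> glue_rel G F"
    and "\<And>i. i < n_in G \<Longrightarrow> \<kappa> (Inl (edge_of G (In i))) = \<kappa> (Inr (edge_of F (Out i)))"
  shows "\<kappa> e = \<kappa> e'"
  using assms(1) unfolding glue_rel_def Let_def
  by (induction rule: rtrancl_induct) (use assms(2) in auto)

text \<open>To identify a composite graph with a known graph \<open>H\<close> one gives the map
  \<open>\<kappa>\<close> sending an edge to the edge of \<open>H\<close> of which it becomes a
  part. That \<open>\<kappa>\<close> identifies no more edges than the gluing does is witnessed by
  a choice \<open>\<rho>\<close> of one part in each edge of \<open>H\<close>, to which all other
  parts are connected.\<close>

lemma graph_comp_isoI: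
  assumes n: "n_in F = n_in H" "n_out G = n_out H"
    and \<alpha>: "bij_betw \<alpha> (verts G <+> verts F) (verts H)"
    and \<beta>: "bij_betw \<beta> (halves G <+> halves F) (halves H)"
    and v: "\<And>h. h \<in> halves G \<Longrightarrow> vtx H (\<beta> (Inl h)) = \<alpha> (Inl (vtx G h))"
      "\<And>h. h \<in> halves F \<Longrightarrow> vtx H (\<beta> (Inr h)) = \<alpha> (Inr (vtx F h))"
    and \<kappa>: "\<kappa> ` (edges G <+> edges F) = edges H"
      "\<And>i. i < n_in G \<Longrightarrow> \<kappa> (Inl (edge_of G (In i))) = \<kappa> (Inr (edge_of F (Out i)))"
    and \<rho>: "\<And>e. e \<in> edges G <+> edges F \<Longrightarrow> (e, \<rho> (\<kappa> e)) \<in> glue_rel G F"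
    and e: "\<And>h. h \<in> halves G \<Longrightarrow> edge_of H (Half (\<beta> (Inl h))) = \<kappa> (Inl (edge_of G (Half h)))"
      "\<And>h. h \<in> halves F \<Longrightarrow> edge_of H (Half (\<beta> (Inr h))) = \<kappa> (Inr (edge_of F (Half h)))"
      "\<And>i. i < n_in F \<Longrightarrow> edge_of H (In i) = \<kappa> (Inr (edge_of F (In i)))"
      "\<And>j. j < n_out G \<Longrightarrow> edge_of H (Out j) = \<kappa> (Inl (edge_of G (Out j)))"
  shows "graph_iso (graph_comp G F) H"
proof -
  define \<gamma> where "\<gamma> C = \<kappa> (SOME e. e \<in> C)" for C
  have \<gamma>: "\<gamma> (glue_rel G F `` {e}) = \<kappa> e" for e
    unfolding \<gamma>_def using glue_rel_invariant[where \<kappa> = \<kappa>, OF glue_class_some \<kappa>(2)] by simp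
  have "bij_betw \<gamma> ((edges G <+> edges F) // glue_rel G F) (edges H)"
    unfolding bij_betw_def
  proof
    show "inj_on \<gamma> ((edges G <+> edges F) // glue_rel G F)"
    proof (rule inj_onI)
      fix C D assume "C \<in> (edges G <+> edges F) // glue_rel G F" "D \<in> (edges G <+> edges F) // glue_rel G F"
        and eq: "\<gamma> C = \<gamma> D"
      then obtain c d where c: "c \<in> edges G <+> edges F" "C = glue_rel G F `` {c}"
        and d: "d \<in> edges G <+> edges F" "D = glue_rel G F `` {d}"
        by (metis quotientE)
      have "\<kappa> c = \<kappa> d" using eq c d \<gamma> by simp
      then have "(c, d) \<in> glue_rel G F"
        using \<rho>[OF c(1)] \<rho>[OF d(1)] by (metis glue_rel_sym glue_rel_trans)
      then show "C = D" using c d by (simp add: glue_class_eq_iff)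
    qed
    show "\<gamma> ` ((edges G <+> edges F) // glue_rel G F) = edges H"
      unfolding \<kappa>(1)[symmetric] quotient_def using \<gamma> by (simp add: image_UN) blast
  qed
  then show ?thesis
    using n \<alpha> \<beta> v e by (intro graph_isoI[of _ _ \<alpha> \<beta> \<gamma>]) (auto simp: \<gamma>)
qed

text \<open>Isomorphisms of the two factors respect the gluing, because they preserve the edges at
  the endpoints. Applied to the isomorphisms and to their inverses, this gives the section that
  \<open>graph_comp_isoI\<close> asks for.\<close>

lemma glue_rel_map:
  assumes "(e, e') \<in> glue_rel G F" "n_in G = n_in G'"
    and "\<And>i. i < n_in G \<Longrightarrow> edge_of G' (In i) = \<gamma> (edge_of G (In i))"
    and "\<And>i. i < n_in G \<Longrightarrow> edge_of F' (Out i) = \<delta> (edge_of F (Out i))"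
  shows "(map_sum \<gamma> \<delta> e, map_sum \<gamma> \<delta> e') \<in> glue_rel G' F'"
  using assms(1) unfolding glue_rel_def[of G F] Let_def
proof (induction rule: rtrancl_induct)
  case base
  show ?case by (rule glue_rel_refl)
next
  case (step y z)
  have "(map_sum \<gamma> \<delta> y, map_sum \<gamma> \<delta> z) \<in> glue_rel G' F'"
    using step(2) glue_rel_glue[of _ G' F'] assms(2-4) glue_rel_sym[of _ _ G' F']
    by (auto; metis)
  with step.IH show ?case by (rule glue_rel_trans)
qed

lemma map_sum_image_Plus: "map_sum f g ` (A <+> B) = f ` A <+> g ` B"
  by (simp add: Plus_def image_Un image_image)

lemma inj_on_map_sum_Plus: "inj_on f A \<Longrightarrow> inj_on g B \<Longrightarrow> inj_on (map_sum f g) (A <+> B)"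
  by (rule inj_onI) (auto dest: inj_onD)

lemma bij_betw_map_sum:
  "bij_betw f A A' \<Longrightarrow> bij_betw g B B' \<Longrightarrow> bij_betw (map_sum f g) (A <+> B) (A' <+> B')"
  unfolding bij_betw_def by (simp add: map_sum_image_Plus inj_on_map_sum_Plus)

lemma graph_comp_iso_cong:
  assumes isos: "graph_iso G G'" "graph_iso F F'"
    and gr: "is_graph G" "is_graph F" and n: "n_in G = n_out F"
  shows "graph_iso (graph_comp G F) (graph_comp G' F')"
proof -
  obtain \<alpha> \<beta> \<gamma> where 1: "iso_by G G' \<alpha> \<beta> \<gamma>"
    using isos(1) unfolding graph_iso_iff by blast
  note 1 = iso_byD[OF 1]
  obtain \<alpha>' \<beta>' \<delta> where 2: "iso_by F F' \<alpha>' \<beta>' \<delta>"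
    using isos(2) unfolding graph_iso_iff by blast
  note 2 = iso_byD[OF 2]
  let ?\<gamma>' = "inv_into (edges G) \<gamma>" and ?\<delta>' = "inv_into (edges F) \<delta>"
  have inv: "?\<gamma>' (\<gamma> e) = e" if "e \<in> edges G" for e
    using 1(5) that by (simp add: bij_betw_def)
  have inv': "?\<delta>' (\<delta> e) = e" if "e \<in> edges F" for e
    using 2(5) that by (simp add: bij_betw_def)
  have emb: "bij_betw (map_sum \<gamma> \<delta>) (edges G <+> edges F) (edges G' <+> edges F')"
    by (rule bij_betw_map_sum) (use 1 2 in auto)
  let ?\<kappa> = "\<lambda>e. glue_rel G' F' `` {map_sum \<gamma> \<delta> e}"
  \<comment> \<open>a member of the chain in the composite of \<open>G'\<close> and \<open>F'\<close>, pulled back to \<open>G\<close> and \<open>F\<close>\<close>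
  let ?\<rho> = "\<lambda>C. map_sum ?\<gamma>' ?\<delta>' (SOME e. e \<in> C)"
  show ?thesis
  proof (rule graph_comp_isoI[where \<alpha> = "map_sum \<alpha> \<alpha>'" and \<beta> = "map_sum \<beta> \<beta>'" and \<kappa> = ?\<kappa> and \<rho> = ?\<rho>])
    show "?\<kappa> ` (edges G <+> edges F) = edges (graph_comp G' F')"
    proof -
      have "?\<kappa> ` (edges G <+> edges F) =
          (\<lambda>e. glue_rel G' F' `` {e}) ` map_sum \<gamma> \<delta> ` (edges G <+> edges F)"
        by (simp only: image_image)
      also have "\<dots> = (\<lambda>e. glue_rel G' F' `` {e}) ` (edges G' <+> edges F')"
        using emb by (simp only: bij_betw_def)
      finally show ?thesis by (simp add: quotient_def UNION_singleton_eq_range)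
    qed
    show "?\<kappa> (Inl (edge_of G (In i))) = ?\<kappa> (Inr (edge_of F (Out i)))" if "i < n_in G" for i
      using that 1 2 n glue_rel_glue[of i G' F'] by (simp add: glue_class_eq_iff)
    show "(e, ?\<rho> (?\<kappa> e)) \<in> glue_rel G F" if e: "e \<in> edges G <+> edges F" for e
    proof -
      let ?e = "SOME e'. e' \<in> glue_rel G' F' `` {map_sum \<gamma> \<delta> e}"
      have "(map_sum \<gamma> \<delta> e, ?e) \<in> glue_rel G' F'" by (rule glue_class_some)
      then have "(map_sum ?\<gamma>' ?\<delta>' (map_sum \<gamma> \<delta> e), map_sum ?\<gamma>' ?\<delta>' ?e) \<in> glue_rel G F"
        by (rule glue_rel_map)
          (use 1 2 n gr in \<open>auto simp: inv inv' is_graph_edge_of\<close>)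
      moreover have "map_sum ?\<gamma>' ?\<delta>' (map_sum \<gamma> \<delta> e) = e"
        using e by (auto simp: inv inv')
      ultimately show ?thesis by simp
    qed
  qed (use 1 2 in \<open>auto intro: bij_betw_map_sum\<close>)
qed

lemma graph_juxt_iso_cong:
  assumes isos: "graph_iso G G'" "graph_iso F F'"
  shows "graph_iso (graph_juxt G F) (graph_juxt G' F')"
proof -
  obtain \<alpha> \<beta> \<gamma> where 1: "iso_by G G' \<alpha> \<beta> \<gamma>"
    using isos(1) unfolding graph_iso_iff by blast
  note 1 = iso_byD[OF 1]
  obtain \<alpha>' \<beta>' \<delta> where 2: "iso_by F F' \<alpha>' \<beta>' \<delta>"
    using isos(2) unfolding graph_iso_iff by blast
  note 2 = iso_byD[OF 2]
  show ?thesis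
    by (rule graph_isoI[of _ _ "map_sum \<alpha> \<alpha>'" "map_sum \<beta> \<beta>'" "map_sum \<gamma> \<delta>"])
      (use 1 2 in \<open>auto intro: bij_betw_map_sum\<close>)
qed

text \<open>Composition respects isomorphism, so all members of the union that defines
  \<open>class_comp\<close> coincide.\<close>

lemma class_comp_iso_class:
  assumes "is_graph G" "is_graph F" "n_in G = n_out F"
  shows "class_comp (iso_class G) (iso_class F) = iso_class (graph_comp G F)"
proof -
  have "iso_class (graph_comp M N) = iso_class (graph_comp G F)"
    if "M \<in> iso_class G" "N \<in> iso_class F" for M N
  proof -
    have *: "is_graph M" "graph_iso M G" "is_graph N" "graph_iso N F"
      using that by (auto simp: iso_class_def)
    then have n: "n_in M = n_out N" using assms(3) by (simp add: graph_iso_def)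
    show ?thesis
      by (rule iso_class_cong[OF graph_comp_iso_cong[OF *(2,4,1,3) n]
            graph_comp_iso_cong[OF graph_iso_sym[OF *(2,1)] graph_iso_sym[OF *(4,3)] assms]])
  qed
  moreover have "iso_class G \<noteq> {}" "iso_class F \<noteq> {}"
    using ex_nat_graph[OF assms(1)] ex_nat_graph[OF assms(2)] by (auto simp: iso_class_def)
  ultimately show ?thesis by (simp add: class_comp_def cong: SUP_cong_simp)
qed

lemma class_juxt_iso_class:
  assumes "is_graph G" "is_graph F"
  shows "class_juxt (iso_class G) (iso_class F) = iso_class (graph_juxt G F)"
proof -
  have "iso_class (graph_juxt M N) = iso_class (graph_juxt G F)"
    if "M \<in> iso_class G" "N \<in> iso_class F" for M N
  proof -
    have *: "is_graph M" "graph_iso M G" "is_graph N" "graph_iso N F"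
      using that by (auto simp: iso_class_def)
    show ?thesis
      by (rule iso_class_cong[OF graph_juxt_iso_cong[OF *(2,4)]
            graph_juxt_iso_cong[OF graph_iso_sym[OF *(2,1)] graph_iso_sym[OF *(4,3)]]])
  qed
  moreover have "iso_class G \<noteq> {}" "iso_class F \<noteq> {}"
    using ex_nat_graph[OF assms(1)] ex_nat_graph[OF assms(2)] by (auto simp: iso_class_def)
  ultimately show ?thesis by (simp add: class_juxt_def cong: SUP_cong_simp)
qed

section \<open>Orientations\<close>

text \<open>A direction is given to each edge by marking one of its two ends with
  \<open>True\<close> and the other one with \<open>False\<close>.\<close>

definition oriented :: "('v, 'h, 'e) pregraph \<Rightarrow> ('h edge_end \<Rightarrow> bool) \<Rightarrow> bool" where
  "oriented G d \<longleftrightarrow>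
     (\<forall>x\<in>ends G. \<forall>y\<in>ends G. x \<noteq> y \<and> edge_of G x = edge_of G y \<longrightarrow> d x \<noteq> d y)"

text \<open>After some gluings the edges form chains, the classes of \<open>R\<close>. A chain is
  a circle or has two free ends, so the set \<open>F\<close> of free ends falls into pairs, and if
  all edges of a chain are directed the same way along the chain then the two members of a pair
  are marked differently.\<close>

definition paired :: "('x \<Rightarrow> 'e) \<Rightarrow> ('e \<times> 'e) set \<Rightarrow> 'x set \<Rightarrow> ('x \<Rightarrow> bool) \<Rightarrow> bool" where
  "paired \<epsilon> R F d \<longleftrightarrow>
     (\<forall>x\<in>F. \<exists>y\<in>F. d y \<noteq> d x \<and> (\<epsilon> x, \<epsilon> y) \<in> R \<and> (\<forall>z\<in>F. (\<epsilon> x, \<epsilon> z) \<in> R \<longrightarrow> z = x \<or> z = y))"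

lemma is_graph_partner:
  assumes "is_graph G" "x \<in> ends G"
  obtains y where "y \<in> ends G" "y \<noteq> x" "edge_of G y = edge_of G x"
    "\<And>z. z \<in> ends G \<Longrightarrow> edge_of G z = edge_of G x \<Longrightarrow> z = x \<or> z = y"
proof -
  let ?S = "{z \<in> ends G. edge_of G z = edge_of G x}"
  have "card ?S \<in> {0, 2}"
    using assms is_graph_edge_of[OF assms] by (auto simp: is_graph_def)
  moreover have "x \<in> ?S" "finite ?S" using assms finite_ends[of G] by auto
  ultimately have "card ?S = 2" by (metis (no_types, lifting) card_0_eq empty_iff insertE singletonD)
  then obtain u v where uv: "?S = {u, v}" "u \<noteq> v" by (auto simp: card_2_iff)
  show thesis
  proof (cases "x = u")
    case True
    with uv show thesis by (intro that[of v]) auto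
  next
    case False
    then have "x = v" using uv \<open>x \<in> ?S\<close> by blast
    with uv show thesis by (intro that[of u]) auto
  qed
qed

lemma is_graphI_partner:
  assumes "finite (verts G)" "finite (halves G)" "finite (edges G)" "vtx G ` halves G = verts G"
    and "edge_of G ` ends G \<subseteq> edges G"
    and partner: "\<And>x. x \<in> ends G \<Longrightarrow> \<exists>y\<in>ends G. y \<noteq> x \<and> edge_of G y = edge_of G x \<and>
      (\<forall>z\<in>ends G. edge_of G z = edge_of G x \<longrightarrow> z = x \<or> z = y)"
  shows "is_graph G"
proof -
  have "card {x \<in> ends G. edge_of G x = e} \<in> {0, 2}" for e
  proof (cases "\<exists>x\<in>ends G. edge_of G x = e")
    case True
    then obtain x where x: "x \<in> ends G" "edge_of G x = e" by blast
    with partner[OF x(1)] obtain y where "y \<in> ends G" "y \<noteq> x" "edge_of G y = e"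
      "\<forall>z\<in>ends G. edge_of G z = e \<longrightarrow> z = x \<or> z = y" by auto
    with x have "{x \<in> ends G. edge_of G x = e} = {x, y}" by auto
    with \<open>y \<noteq> x\<close> show ?thesis by simp
  next
    case False
    then have "{x \<in> ends G. edge_of G x = e} = {}" by auto
    then show ?thesis by (simp only: card.empty) simp
  qed
  with assms(1-5) show ?thesis by (simp add: is_graph_def)
qed

text \<open>The marked end of an edge is the one that the choice operator picks from its ends; the
  same end is picked from the point of view of either end.\<close>

lemma ex_fibre_orientation:
  assumes "\<And>x. x \<in> X \<Longrightarrow> \<exists>y\<in>X. y \<noteq> x \<and> \<epsilon> y = \<epsilon> x \<and> (\<forall>z\<in>X. \<epsilon> z = \<epsilon> x \<longrightarrow> z = x \<or> z = y)"
  shows "\<exists>d. paired \<epsilon> Id X d"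
proof -
  define d where "d x \<longleftrightarrow> x = (SOME z. z \<in> X \<and> \<epsilon> z = \<epsilon> x)" for x
  have "paired \<epsilon> Id X d"
    unfolding paired_def
  proof
    fix x assume x: "x \<in> X"
    obtain y where y: "y \<in> X" "y \<noteq> x" "\<epsilon> y = \<epsilon> x" "\<forall>z\<in>X. \<epsilon> z = \<epsilon> x \<longrightarrow> z = x \<or> z = y"
      using assms[OF x] by blast
    let ?s = "SOME z. z \<in> X \<and> \<epsilon> z = \<epsilon> x"
    have "?s \<in> X \<and> \<epsilon> ?s = \<epsilon> x" by (rule someI[of _ x]) (simp add: x)
    then have "?s = x \<or> ?s = y" using y by blast
    moreover have "d y \<longleftrightarrow> y = ?s" "d x \<longleftrightarrow> x = ?s" by (simp_all add: d_def y(3))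
    ultimately have "d y \<noteq> d x" using y(2) by auto
    then show "\<exists>y\<in>X. d y \<noteq> d x \<and> (\<epsilon> x, \<epsilon> y) \<in> Id \<and> (\<forall>z\<in>X. (\<epsilon> x, \<epsilon> z) \<in> Id \<longrightarrow> z = x \<or> z = y)"
      using y by (intro bexI[of _ y]) auto
  qed
  then show ?thesis by blast
qed

lemma ex_orientation:
  assumes "is_graph G"
  shows "\<exists>d. oriented G d"
proof -
  have "\<exists>d. paired (edge_of G) Id (ends G) d"
  proof (rule ex_fibre_orientation)
    fix x assume "x \<in> ends G"
    from is_graph_partner[OF assms this]
    show "\<exists>y\<in>ends G. y \<noteq> x \<and> edge_of G y = edge_of G x \<and>
        (\<forall>z\<in>ends G. edge_of G z = edge_of G x \<longrightarrow> z = x \<or> z = y)" by metis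
  qed
  then obtain d where d: "paired (edge_of G) Id (ends G) d" ..
  have "oriented G d"
    unfolding oriented_def
  proof (intro ballI impI, elim conjE)
    fix x y assume xy: "x \<in> ends G" "y \<in> ends G" "x \<noteq> y" "edge_of G x = edge_of G y"
    with d obtain z where "d z \<noteq> d x" "\<forall>z'\<in>ends G. edge_of G x = edge_of G z' \<longrightarrow> z' = x \<or> z' = z"
      unfolding paired_def by fastforce
    with xy show "d x \<noteq> d y" by metis
  qed
  then show ?thesis by blast
qed

lemma paired_unique: "paired \<epsilon> R F d \<Longrightarrow> x \<in> F \<Longrightarrow> y \<in> F \<Longrightarrow> x \<noteq> y \<Longrightarrow> (\<epsilon> x, \<epsilon> y) \<in> R \<Longrightarrow> d x \<noteq> d y"
  unfolding paired_def by metis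

text \<open>A path that uses the new pair more than once can be shortened.\<close>

lemma equiv_closure_insert:
  fixes S :: "('e \<times> 'e) set"
  defines "R \<equiv> (S \<union> S\<inverse>)\<^sup>*"
  shows "(u, v) \<in> (insert (p, q) S \<union> (insert (p, q) S)\<inverse>)\<^sup>* \<longleftrightarrow>
    (u, v) \<in> R \<or> (u, p) \<in> R \<and> (q, v) \<in> R \<or> (u, q) \<in> R \<and> (p, v) \<in> R"
    (is "_ \<in> ?R' \<longleftrightarrow> ?rhs v")
proof
  assume "(u, v) \<in> ?R'"
  then show "?rhs v"
  proof (induction rule: rtrancl_induct)
    case base
    show ?case by (simp add: R_def)
  next
    case (step y z)
    have sub: "(w, z) \<in> R" if "(w, y) \<in> R" "(y, z) \<in> S \<union> S\<inverse>" for w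
      using that unfolding R_def by (rule rtrancl_into_rtrancl)
    have R: "(w, w) \<in> R" for w by (simp add: R_def)
    have symR: "(b, a) \<in> R" if "(a, b) \<in> R" for a b
      using that sym_rtrancl[OF sym_Un_converse[of S]] unfolding R_def sym_def by blast
    have transR: "(a, c) \<in> R" if "(a, b) \<in> R" "(b, c) \<in> R" for a b c
      using that unfolding R_def by (rule rtrancl_trans)
    consider "(y, z) \<in> S \<union> S\<inverse>" | "y = p" "z = q" | "y = q" "z = p" using step(2) by auto
    then show ?case
    proof cases
      case 1
      with step.IH sub show ?thesis by blast
    next
      case 2
      with step.IH R symR transR show ?thesis by metis
    next
      case 3
      with step.IH R symR transR show ?thesis by metis
    qed
  qed
next
  have R: "R \<subseteq> ?R'" unfolding R_def by (rule rtrancl_mono) auto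
  have "(p, q) \<in> ?R'" "(q, p) \<in> ?R'" by auto
  moreover assume "?rhs v"
  ultimately show "(u, v) \<in> ?R'" using R by (meson rtrancl_trans subsetD)
qed

text \<open>Gluing two free ends. If they are the two ends of one chain then a circle arises, and
  they already have opposite directions. Otherwise two chains become one, and the chain of
  \<open>y\<close> is reversed if necessary.\<close>

lemma paired_glue:
  assumes p: "paired \<epsilon> R F d" and R: "equiv UNIV R" and xy: "x \<in> F" "y \<in> F" "x \<noteq> y"
    and R': "\<And>u v. (u, v) \<in> R' \<longleftrightarrow> (u, v) \<in> R \<or> (u, \<epsilon> x) \<in> R \<and> (\<epsilon> y, v) \<in> R \<or> (u, \<epsilon> y) \<in> R \<and> (\<epsilon> x, v) \<in> R"
  shows "\<exists>d'. paired \<epsilon> R' (F - {x, y}) d' \<and> d' x \<noteq> d' y \<and>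
    (\<forall>u v. (\<epsilon> u, \<epsilon> v) \<in> R \<longrightarrow> (d' u = d' v \<longleftrightarrow> d u = d v))"
proof -
  have refl: "(u, u) \<in> R" for u using R by (simp add: equiv_def refl_on_def)
  have sym: "(v, u) \<in> R" if "(u, v) \<in> R" for u v using R that by (auto simp: equiv_def sym_def)
  have trans: "(u, w) \<in> R" if "(u, v) \<in> R" "(v, w) \<in> R" for u v w
    using R that by (auto simp: equiv_def trans_def)
  obtain x' where x': "x' \<in> F" "d x' \<noteq> d x" "(\<epsilon> x, \<epsilon> x') \<in> R"
    and x'u: "\<And>z. z \<in> F \<Longrightarrow> (\<epsilon> x, \<epsilon> z) \<in> R \<Longrightarrow> z = x \<or> z = x'"
    using p xy(1) unfolding paired_def by blast
  obtain y' where y': "y' \<in> F" "d y' \<noteq> d y" "(\<epsilon> y, \<epsilon> y') \<in> R"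
    and y'u: "\<And>z. z \<in> F \<Longrightarrow> (\<epsilon> y, \<epsilon> z) \<in> R \<Longrightarrow> z = y \<or> z = y'"
    using p xy(2) unfolding paired_def by blast
  show ?thesis
  proof (cases "(\<epsilon> x, \<epsilon> y) \<in> R")
    case True
    have R'R: "(u, v) \<in> R' \<longleftrightarrow> (u, v) \<in> R" for u v
      unfolding R' using True sym trans by blast
    have "y = x'" using x'u[OF xy(2) True] xy(3) by blast
    have "paired \<epsilon> R' (F - {x, y}) d"
      unfolding paired_def R'R
    proof
      fix z assume z: "z \<in> F - {x, y}"
      then obtain w where w: "w \<in> F" "d w \<noteq> d z" "(\<epsilon> z, \<epsilon> w) \<in> R"
        "\<forall>z'\<in>F. (\<epsilon> z, \<epsilon> z') \<in> R \<longrightarrow> z' = z \<or> z' = w"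
        using p unfolding paired_def by blast
      have "w \<noteq> x" "w \<noteq> y"
        using w(3) z x'u[of z] \<open>y = x'\<close> sym trans True by blast+
      with w show "\<exists>w\<in>F - {x, y}. d w \<noteq> d z \<and> (\<epsilon> z, \<epsilon> w) \<in> R \<and>
          (\<forall>z'\<in>F - {x, y}. (\<epsilon> z, \<epsilon> z') \<in> R \<longrightarrow> z' = z \<or> z' = w)" by blast
    qed
    then show ?thesis using x'(2) \<open>y = x'\<close> by blast
  next
    case False
    \<comment> \<open>the chain of \<open>y\<close> is turned around if \<open>x\<close> and \<open>y\<close> carry the same mark\<close>
    define d' where "d' z = (if (\<epsilon> z, \<epsilon> y) \<in> R \<and> d x = d y then \<not> d z else d z)" for z
    have flip: "d' u = d' v \<longleftrightarrow> d u = d v" if "(\<epsilon> u, \<epsilon> v) \<in> R" for u v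
      using that sym trans unfolding d'_def by (smt (verit))
    have dxy: "d' x \<noteq> d' y" using False by (auto simp: d'_def refl)
    have dx': "d' x' \<noteq> d' x" using x' flip sym by blast
    have dy': "d' y' \<noteq> d' y" using y' flip sym by blast
    have dxy': "d' x' \<noteq> d' y'" using dxy dx' dy' by blast
    have ne: "x' \<noteq> x" "x' \<noteq> y" "y' \<noteq> x" "y' \<noteq> y"
      using x' y' False sym by auto
    have sep: "(\<epsilon> z, \<epsilon> y) \<notin> R" if "(\<epsilon> x, \<epsilon> z) \<in> R" for z using that False trans by blast
    have "paired \<epsilon> R' (F - {x, y}) d'"
      unfolding paired_def
    proof
      fix z assume z: "z \<in> F - {x, y}"
      consider "(\<epsilon> x, \<epsilon> z) \<in> R" | "(\<epsilon> y, \<epsilon> z) \<in> R" | "(\<epsilon> x, \<epsilon> z) \<notin> R" "(\<epsilon> y, \<epsilon> z) \<notin> R" by blast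
      then show "\<exists>w\<in>F - {x, y}. d' w \<noteq> d' z \<and> (\<epsilon> z, \<epsilon> w) \<in> R' \<and>
          (\<forall>z'\<in>F - {x, y}. (\<epsilon> z, \<epsilon> z') \<in> R' \<longrightarrow> z' = z \<or> z' = w)"
      proof cases
        \<comment> \<open>the free end left over from the chain of \<open>x\<close> gets the one from the chain of \<open>y\<close> as partner\<close>
        case 1
        then have zx: "z = x'" using x'u z by blast
        have "z' = x' \<or> z' = y'" if "z' \<in> F - {x, y}" "(\<epsilon> x', \<epsilon> z') \<in> R'" for z'
          using that x'u[of z'] y'u[of z'] x'(3) sep[of x'] trans sym unfolding R' by blast
        moreover have "(\<epsilon> x', \<epsilon> y') \<in> R'" unfolding R' using x' y' sym by blast
        ultimately show ?thesis
          unfolding zx using y' ne dxy' by (intro bexI[of _ y']) auto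
      next
        case 2
        then have zy: "z = y'" using y'u z by blast
        have "z' = y' \<or> z' = x'" if "z' \<in> F - {x, y}" "(\<epsilon> y', \<epsilon> z') \<in> R'" for z'
          using that x'u[of z'] y'u[of z'] y'(3) sep[of y'] trans sym unfolding R' by blast
        moreover have "(\<epsilon> y', \<epsilon> x') \<in> R'" unfolding R' using x' y' sym by blast
        ultimately show ?thesis
          unfolding zy using x' ne dxy' by (intro bexI[of _ x']) auto
      next
        case 3
        then obtain w where w: "w \<in> F" "d w \<noteq> d z" "(\<epsilon> z, \<epsilon> w) \<in> R"
          "\<forall>z'\<in>F. (\<epsilon> z, \<epsilon> z') \<in> R \<longrightarrow> z' = z \<or> z' = w"
          using p z unfolding paired_def by blast
        have "w \<noteq> x" "w \<noteq> y" using w(3) 3 sym by blast+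
        moreover have "(\<epsilon> z, v) \<in> R' \<longleftrightarrow> (\<epsilon> z, v) \<in> R" for v unfolding R' using 3 sym by blast
        moreover have "d' w \<noteq> d' z" using w flip sym by blast
        ultimately show ?thesis using w by (intro bexI[of _ w]) auto
      qed
    qed
    with dxy flip show ?thesis by (intro exI[of _ d'] conjI allI impI)
  qed
qed

text \<open>Glue \<open>a i\<close> to \<open>b i\<close> for \<open>i < n\<close>. By induction
  on \<open>n\<close>, with \<open>paired_glue\<close> as the step, all edges can be directed
  consistently along the chains that arise.\<close>

lemma ex_glue_orientation:
  fixes \<epsilon> :: "'x \<Rightarrow> 'e" and a b :: "nat \<Rightarrow> 'x"
  assumes fibres: "\<And>x. x \<in> X \<Longrightarrow> \<exists>y\<in>X. y \<noteq> x \<and> \<epsilon> y = \<epsilon> x \<and> (\<forall>z\<in>X. \<epsilon> z = \<epsilon> x \<longrightarrow> z = x \<or> z = y)"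
    and inj: "inj a" "inj b" and ab: "\<And>i j. a i \<noteq> b j"
    and X: "\<And>i. i < n \<Longrightarrow> a i \<in> X" "\<And>i. i < n \<Longrightarrow> b i \<in> X"
  defines "S \<equiv> \<lambda>n. {(\<epsilon> (a i), \<epsilon> (b i)) | i. i < n}"
  shows "\<exists>d. (\<forall>x\<in>X. \<forall>y\<in>X. x \<noteq> y \<and> \<epsilon> x = \<epsilon> y \<longrightarrow> d x \<noteq> d y) \<and> (\<forall>i<n. d (a i) \<noteq> d (b i)) \<and>
    paired \<epsilon> ((S n \<union> (S n)\<inverse>)\<^sup>*) (X - a ` {..<n} - b ` {..<n}) d"
  using X
proof (induction n)
  case 0
  obtain d where d: "paired \<epsilon> Id X d" using ex_fibre_orientation[of X \<epsilon>] fibres by blast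
  then have "\<forall>x\<in>X. \<forall>y\<in>X. x \<noteq> y \<and> \<epsilon> x = \<epsilon> y \<longrightarrow> d x \<noteq> d y"
    using paired_unique[OF d] by simp
  with d show ?case by (auto simp: S_def)
next
  case (Suc n)
  let ?R = "(S n \<union> (S n)\<inverse>)\<^sup>*" and ?F = "X - a ` {..<n} - b ` {..<n}"
  obtain d where d: "\<forall>x\<in>X. \<forall>y\<in>X. x \<noteq> y \<and> \<epsilon> x = \<epsilon> y \<longrightarrow> d x \<noteq> d y" "\<forall>i<n. d (a i) \<noteq> d (b i)"
    "paired \<epsilon> ?R ?F d"
    using Suc.IH[OF Suc.prems(1)[OF less_SucI] Suc.prems(2)[OF less_SucI]] by blast
  have R: "equiv UNIV ?R"
    by (intro equivI refl_rtrancl trans_rtrancl sym_rtrancl sym_Un_converse) auto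
  have "S (Suc n) = insert (\<epsilon> (a n), \<epsilon> (b n)) (S n)"
    by (auto simp: S_def less_Suc_eq)
  then have R': "(u, v) \<in> (S (Suc n) \<union> (S (Suc n))\<inverse>)\<^sup>* \<longleftrightarrow> (u, v) \<in> ?R \<or>
      (u, \<epsilon> (a n)) \<in> ?R \<and> (\<epsilon> (b n), v) \<in> ?R \<or> (u, \<epsilon> (b n)) \<in> ?R \<and> (\<epsilon> (a n), v) \<in> ?R" for u v
    using equiv_closure_insert[of u v "\<epsilon> (a n)" "\<epsilon> (b n)" "S n"] by simp
  have F: "a n \<in> ?F" "b n \<in> ?F"
    using Suc.prems[of n] inj ab ab[symmetric] by (auto simp: inj_eq)
  obtain d' where d': "paired \<epsilon> ((S (Suc n) \<union> (S (Suc n))\<inverse>)\<^sup>*) (?F - {a n, b n}) d'"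
    "d' (a n) \<noteq> d' (b n)" "\<forall>u v. (\<epsilon> u, \<epsilon> v) \<in> ?R \<longrightarrow> (d' u = d' v \<longleftrightarrow> d u = d v)"
    using paired_glue[OF d(3) R F ab R'] by blast
  have "?F - {a n, b n} = X - a ` {..<Suc n} - b ` {..<Suc n}"
    by (auto simp: lessThan_Suc)
  moreover have "(\<epsilon> (a i), \<epsilon> (b i)) \<in> ?R" if "i < n" for i
    using that by (intro r_into_rtrancl) (auto simp: S_def)
  then have "\<forall>i<Suc n. d' (a i) \<noteq> d' (b i)"
    using d(2) d'(2,3) by (auto simp: less_Suc_eq)
  moreover have "\<forall>x\<in>X. \<forall>y\<in>X. x \<noteq> y \<and> \<epsilon> x = \<epsilon> y \<longrightarrow> d' x \<noteq> d' y"
    using d(1) d'(3) by (metis rtrancl.rtrancl_refl)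
  ultimately show ?case using d'(1) by auto
qed

text \<open>The place of an end of a composite graph in the two graphs that are glued.\<close>

fun comp_end :: "('h + 'h') edge_end \<Rightarrow> 'h edge_end + 'h' edge_end" where
  "comp_end (Half (Inl h)) = Inl (Half h)"
| "comp_end (Half (Inr h)) = Inr (Half h)"
| "comp_end (In i) = Inr (In i)"
| "comp_end (Out j) = Inl (Out j)"

lemma edge_of_graph_comp:
  "edge_of (graph_comp G F) x = glue_rel G F `` {map_sum (edge_of G) (edge_of F) (comp_end x)}"
  by (cases x rule: comp_end.cases) auto

lemma comp_end_inj: "comp_end x = comp_end y \<Longrightarrow> x = y"
  by (cases x rule: comp_end.cases; cases y rule: comp_end.cases) auto

lemma comp_end_image:
  assumes "n_in G = n_out F"
  shows "comp_end ` ends (graph_comp G F) =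
    (ends G <+> ends F) - (\<lambda>i. Inl (In i)) ` {..<n_in G} - (\<lambda>i. Inr (Out i)) ` {..<n_in G}"
    (is "?L = ?R")
proof
  show "?L \<subseteq> ?R"
  proof safe
    fix x assume "x \<in> ends (graph_comp G F)"
    then show "comp_end x \<in> ends G <+> ends F" by (cases x rule: comp_end.cases) auto
  qed (auto elim: comp_end.elims)
  show "?R \<subseteq> ?L"
  proof
    fix z assume z: "z \<in> ?R"
    show "z \<in> ?L"
    proof (cases z)
      case (Inl x)
      then show ?thesis
        using z by (cases x) (auto intro: rev_image_eqI[of "Half (Inl _)"] rev_image_eqI[of "Out _"])
    next
      case (Inr x)
      then show ?thesis
        using z assms by (cases x) (auto intro: rev_image_eqI[of "Half (Inr _)"] rev_image_eqI[of "In _"])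
    qed
  qed
qed

lemma ends_Plus_partner:
  fixes G :: "('v, 'h, 'e) pregraph" and F :: "('v2, 'h2, 'e2) pregraph"
  assumes G: "is_graph G" and F: "is_graph F" and x: "x \<in> ends G <+> ends F"
  shows "\<exists>y\<in>ends G <+> ends F. y \<noteq> x \<and> map_sum (edge_of G) (edge_of F) y = map_sum (edge_of G) (edge_of F) x \<and>
    (\<forall>z\<in>ends G <+> ends F. map_sum (edge_of G) (edge_of F) z = map_sum (edge_of G) (edge_of F) x \<longrightarrow> z = x \<or> z = y)"
proof (cases x)
  case (Inl u)
  then have "u \<in> ends G" using x by auto
  from is_graph_partner[OF G this] obtain y where "y \<in> ends G" "y \<noteq> u" "edge_of G y = edge_of G u"
    "\<And>z. z \<in> ends G \<Longrightarrow> edge_of G z = edge_of G u \<Longrightarrow> z = u \<or> z = y" by metis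
  then show ?thesis using Inl by (intro bexI[of _ "Inl y"]) (auto, metis)
next
  case (Inr u)
  then have "u \<in> ends F" using x by auto
  from is_graph_partner[OF F this] obtain y where "y \<in> ends F" "y \<noteq> u" "edge_of F y = edge_of F u"
    "\<And>z. z \<in> ends F \<Longrightarrow> edge_of F z = edge_of F u \<Longrightarrow> z = u \<or> z = y" by metis
  then show ?thesis using Inr by (intro bexI[of _ "Inr y"]) (auto, metis)
qed

text \<open>The edges of a composite graph are chains of edges of the factors. Hence the composite
  is a graph again, each chain having no free end or two, and it can be directed together with its
  factors.\<close>

lemma graph_comp_orientation:
  assumes G: "is_graph G" and F: "is_graph F" and n: "n_in G = n_out F"
  obtains d where "oriented G (\<lambda>x. d (Inl x))" "oriented F (\<lambda>x. d (Inr x))"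
    "\<And>i. i < n_in G \<Longrightarrow> d (Inl (In i)) \<noteq> d (Inr (Out i))"
    "oriented (graph_comp G F) (\<lambda>x. d (comp_end x))"
    "is_graph (graph_comp G F)"
proof -
  let ?X = "ends G <+> ends F" and ?\<epsilon> = "map_sum (edge_of G) (edge_of F)"
  let ?a = "\<lambda>i. Inl (In i)" and ?b = "\<lambda>i. Inr (Out i)"
  let ?S = "{(?\<epsilon> (?a i), ?\<epsilon> (?b i)) | i. i < n_in G}" and ?C = "graph_comp G F"
  have glue: "glue_rel G F = (?S \<union> ?S\<inverse>)\<^sup>*" by (simp add: glue_rel_def Let_def)
  have "\<exists>d. (\<forall>x\<in>?X. \<forall>y\<in>?X. x \<noteq> y \<and> ?\<epsilon> x = ?\<epsilon> y \<longrightarrow> d x \<noteq> d y) \<and> (\<forall>i<n_in G. d (?a i) \<noteq> d (?b i)) \<and>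
    paired ?\<epsilon> ((?S \<union> ?S\<inverse>)\<^sup>*) (?X - ?a ` {..<n_in G} - ?b ` {..<n_in G}) d"
  proof (rule ex_glue_orientation)
    show "\<exists>y\<in>?X. y \<noteq> x \<and> ?\<epsilon> y = ?\<epsilon> x \<and> (\<forall>z\<in>?X. ?\<epsilon> z = ?\<epsilon> x \<longrightarrow> z = x \<or> z = y)"
      if "x \<in> ?X" for x using ends_Plus_partner[OF G F that] .
  qed (use n in \<open>auto simp: inj_def\<close>)
  then obtain d where d: "\<forall>x\<in>?X. \<forall>y\<in>?X. x \<noteq> y \<and> ?\<epsilon> x = ?\<epsilon> y \<longrightarrow> d x \<noteq> d y"
    "\<forall>i<n_in G. d (?a i) \<noteq> d (?b i)" "paired ?\<epsilon> (glue_rel G F) (comp_end ` ends ?C) d"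
    unfolding glue comp_end_image[OF n] by blast
  have edge: "edge_of ?C x = edge_of ?C y \<longleftrightarrow> (?\<epsilon> (comp_end x), ?\<epsilon> (comp_end y)) \<in> glue_rel G F" for x y
    by (simp add: edge_of_graph_comp glue_class_eq_iff)
  show thesis
  proof
    show "oriented G (\<lambda>x. d (Inl x))" "oriented F (\<lambda>x. d (Inr x))"
      unfolding oriented_def by (intro ballI impI; rule d(1)[rule_format]; auto)+
    show "d (Inl (In i)) \<noteq> d (Inr (Out i))" if "i < n_in G" for i using d(2) that by simp
    show "oriented ?C (\<lambda>x. d (comp_end x))"
      unfolding oriented_def edge
      using paired_unique[OF d(3)] by (auto dest: comp_end_inj)
    show "is_graph ?C"
    proof (rule is_graphI_partner)
      show "finite (verts ?C)" "finite (halves ?C)" "finite (edges ?C)"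
        using G F by (auto simp: is_graph_def quotient_def)
      show "vtx ?C ` halves ?C = verts ?C"
        using G F by (simp add: map_sum_image_Plus is_graph_def)
      show "edge_of ?C ` ends ?C \<subseteq> edges ?C"
      proof safe
        fix x assume "x \<in> ends ?C"
        then have "comp_end x \<in> ?X" using comp_end_image[OF n] by blast
        then have "?\<epsilon> (comp_end x) \<in> edges G <+> edges F"
          using G F by (auto simp: is_graph_edge_of)
        then show "edge_of ?C x \<in> edges ?C"
          by (simp add: edge_of_graph_comp quotientI)
      qed
      fix x assume x: "x \<in> ends ?C"
      then obtain y where y: "y \<in> ends ?C" "d (comp_end y) \<noteq> d (comp_end x)"
        "(?\<epsilon> (comp_end x), ?\<epsilon> (comp_end y)) \<in> glue_rel G F"
        "\<forall>z\<in>ends ?C. (?\<epsilon> (comp_end x), ?\<epsilon> (comp_end z)) \<in> glue_rel G F \<longrightarrow>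
           comp_end z = comp_end x \<or> comp_end z = comp_end y"
        using d(3) unfolding paired_def by fastforce
      show "\<exists>y\<in>ends ?C. y \<noteq> x \<and> edge_of ?C y = edge_of ?C x \<and>
          (\<forall>z\<in>ends ?C. edge_of ?C z = edge_of ?C x \<longrightarrow> z = x \<or> z = y)"
        unfolding edge
      proof (intro bexI[of _ y] conjI ballI impI)
        show "y \<noteq> x" using y(2) by auto
        show "(?\<epsilon> (comp_end y), ?\<epsilon> (comp_end x)) \<in> glue_rel G F" using y(3) by (rule glue_rel_sym)
        fix z assume "z \<in> ends ?C" "(?\<epsilon> (comp_end z), ?\<epsilon> (comp_end x)) \<in> glue_rel G F"
        then have "comp_end z = comp_end x \<or> comp_end z = comp_end y"
          using y(4) glue_rel_sym by blast
        then show "z = x \<or> z = y" by (auto dest: comp_end_inj)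
      qed (rule y(1))
    qed
  qed
qed

section \<open>Multilinear maps\<close>

lemma vector_space_field: "vector_space ((*) :: 'k::field \<Rightarrow> 'k \<Rightarrow> 'k)"
  by unfold_locales (auto simp: algebra_simps)

lemma linear_form_iff:
  fixes s :: "'k::field \<Rightarrow> 'v::ab_group_add \<Rightarrow> 'v"
  assumes "vector_space s"
  shows "Vector_Spaces.linear s (*) g \<longleftrightarrow> (\<forall>x y. g (x + y) = g x + g y) \<and> (\<forall>c x. g (s c x) = c * g x)"
  using assms vector_space_field[where ?'k = 'k] by (simp add: Vector_Spaces.linear_iff)

lemma multilinearD:
  assumes "multilinear s s' n F" "length xs = n" "i < n"
  shows "Vector_Spaces.linear s s' (\<lambda>u. F (xs[i := u]))"
  using assms by (simp add: multilinear_def)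

lemma multilinear_cong:
  assumes "\<And>xs. length xs = n \<Longrightarrow> F xs = F' xs"
  shows "multilinear s s' n F \<longleftrightarrow> multilinear s s' n F'"
  unfolding multilinear_def by (simp add: assms)

lemma multilinear_append_left:
  fixes F :: "'v::ab_group_add list \<Rightarrow> 'w::ab_group_add"
  assumes "multilinear s s' (m + n) F" "length ys = n"
  shows "multilinear s s' m (\<lambda>xs. F (xs @ ys))"
  unfolding multilinear_def
proof (intro allI impI)
  fix xs :: "'v list" and i assume "length xs = m" "i < m"
  then show "Vector_Spaces.linear s s' (\<lambda>u. F (xs[i := u] @ ys))"
    using multilinearD[OF assms(1), of "xs @ ys" i] assms(2) by (simp add: list_update_append)
qed

lemma multilinear_append_right:
  fixes F :: "'v::ab_group_add list \<Rightarrow> 'w::ab_group_add"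
  assumes "multilinear s s' (m + n) F" "length xs = m"
  shows "multilinear s s' n (\<lambda>ys. F (xs @ ys))"
  unfolding multilinear_def
proof (intro allI impI)
  fix ys :: "'v list" and i assume "length ys = n" "i < n"
  then show "Vector_Spaces.linear s s' (\<lambda>u. F (xs @ ys[i := u]))"
    using multilinearD[OF assms(1), of "xs @ ys" "m + i"] assms(2) by (simp add: list_update_append)
qed

lemma multilinear_linear_on_pure:
  fixes s :: "'k::field \<Rightarrow> 'v::ab_group_add \<Rightarrow> 'v"
  assumes s: "vector_space s" and s': "vector_space s'" and L: "linear_on_set tscale s' (tensor_power s n) L"
  shows "multilinear s s' n (\<lambda>xs. L (pure_tensor s xs))"
  unfolding multilinear_def
proof (intro allI impI)
  fix xs :: "'v list" and i assume xs: "length xs = n" "i < n"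
  have "Vector_Spaces.linear s tscale (\<lambda>u. pure_tensor s (xs[i := u]))"
    using pure_tensor_multilinear[OF s] xs by (rule multilinearD)
  moreover have "pure_tensor s (xs[i := u]) \<in> tensor_power s n" for u
    using xs by (simp add: pure_in_tensor_power)
  ultimately show "Vector_Spaces.linear s s' (\<lambda>u. L (pure_tensor s (xs[i := u])))"
    using L s s' unfolding Vector_Spaces.linear_iff linear_on_set_def by simp
qed

lemma linear_sum:
  fixes s :: "'k::field \<Rightarrow> 'v::ab_group_add \<Rightarrow> 'v"
  assumes "vector_space s" "\<And>a. a \<in> A \<Longrightarrow> Vector_Spaces.linear s (*) (g a)"
  shows "Vector_Spaces.linear s (*) (\<lambda>u. \<Sum>a\<in>A. g a u)"
  using assms(2) by (auto simp: linear_form_iff[OF assms(1)] sum.distrib sum_distrib_left)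

lemma linear_mult_const:
  fixes s :: "'k::field \<Rightarrow> 'v::ab_group_add \<Rightarrow> 'v"
  assumes "vector_space s" "Vector_Spaces.linear s (*) g"
  shows "Vector_Spaces.linear s (*) (\<lambda>u. c * g u)" "Vector_Spaces.linear s (*) (\<lambda>u. g u * c)"
  using assms(2) by (auto simp: linear_form_iff[OF assms(1)] algebra_simps)

lemma linear_prod_single:
  fixes s :: "'k::field \<Rightarrow> 'v::ab_group_add \<Rightarrow> 'v"
  assumes s: "vector_space s" and A: "finite A" "a \<in> A"
    and const: "\<And>x u. x \<in> A \<Longrightarrow> x \<noteq> a \<Longrightarrow> g x u = c x" and lin: "Vector_Spaces.linear s (*) (g a)"
  shows "Vector_Spaces.linear s (*) (\<lambda>u. \<Prod>x\<in>A. g x u)"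
proof -
  have "(\<Prod>x\<in>A. g x u) = g a u * (\<Prod>x\<in>A - {a}. c x)" for u
    using A by (subst prod.remove[of A a]) (auto intro!: prod.cong simp: const)
  then show ?thesis using linear_mult_const(2)[OF s lin] by simp
qed

lemma tensor_power_cong:
  assumes "vector_space s" "t \<in> tensor_power s n" "multilinear s (*) n f"
    "\<And>xs. length xs = n \<Longrightarrow> h xs = f xs"
  shows "t h = t f"
  using tensor_power_form_linear[OF assms(1,2), of h 1 f 0 f] assms(3,4) by simp

lemma pure_tensor_apply: "multilinear s (*) (length xs) f \<Longrightarrow> pure_tensor s xs f = f xs"
  by (simp add: pure_tensor_def)

lemma tensor_power_induct [consumes 1, case_names zero step]:
  fixes s :: "'k::field \<Rightarrow> 'v::ab_group_add \<Rightarrow> 'v"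
  assumes "t \<in> tensor_power s n"
    and "P 0"
    and "\<And>c xs t. length xs = n \<Longrightarrow> t \<in> tensor_power s n \<Longrightarrow> P t \<Longrightarrow> P (tscale c (pure_tensor s xs) + t)"
  shows "P t"
proof -
  interpret T: vector_space "tscale :: 'k \<Rightarrow> ('v, 'k) tensor \<Rightarrow> _" by (rule vector_space_tscale)
  have "t \<in> tensor_power s n \<and> P t"
    using assms(1) unfolding tensor_power_def
  proof (induction rule: T.span_induct_alt)
    case base
    show ?case using assms(2) T.span_zero by (simp flip: zero_fun_def)
  next
    case (step c x y)
    then obtain xs where "length xs = n" "x = pure_tensor s xs" by auto
    then have "x \<in> T.span (pure_tensor s ` {xs. length xs = n})"
      and "P (tscale c (pure_tensor s xs) + y)"
      using step assms(3)[of xs y c] by (auto simp only: tensor_power_def intro: T.span_base)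
    then show ?case
      unfolding \<open>x = pure_tensor s xs\<close> using step T.span_add T.span_scale by blast
  qed
  then show ?thesis ..
qed

lemma tensor_power_add: "t \<in> tensor_power s n \<Longrightarrow> u \<in> tensor_power s n \<Longrightarrow> t + u \<in> tensor_power s n"
  and tensor_power_scale: "t \<in> tensor_power s n \<Longrightarrow> tscale c t \<in> tensor_power s n"
  and tensor_power_zero: "0 \<in> tensor_power s n"
  for s :: "'k::field \<Rightarrow> 'v::ab_group_add \<Rightarrow> 'v" and t :: "('v, 'k) tensor"
proof -
  interpret T: vector_space "tscale :: 'k \<Rightarrow> ('v, 'k) tensor \<Rightarrow> _" by (rule vector_space_tscale)
  show "t \<in> tensor_power s n \<Longrightarrow> u \<in> tensor_power s n \<Longrightarrow> t + u \<in> tensor_power s n"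
    "t \<in> tensor_power s n \<Longrightarrow> tscale c t \<in> tensor_power s n" "0 \<in> tensor_power s n"
    by (auto simp: tensor_power_def intro: T.span_add T.span_scale T.span_zero)
qed

lemma tensor_power_sum:
  "(\<And>a. a \<in> A \<Longrightarrow> g a \<in> tensor_power s n) \<Longrightarrow> (\<Sum>a\<in>A. g a) \<in> tensor_power s n"
  by (induction A rule: infinite_finite_induct) (auto intro: tensor_power_add tensor_power_zero)

lemma linear_on_set_zero:
  fixes L :: "('v::ab_group_add, 'k::field) tensor \<Rightarrow> 'w::ab_group_add"
  assumes "vector_space s'" "linear_on_set tscale s' (tensor_power s n) L"
  shows "L 0 = 0"
proof -
  interpret W: vector_space s' by fact
  have "tscale 0 (0 :: ('v, 'k) tensor) = 0" by (simp add: tscale_def fun_eq_iff)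
  then have "L 0 = s' 0 (L 0)" using assms(2) tensor_power_zero unfolding linear_on_set_def by metis
  then show ?thesis by simp
qed

lemma linear_on_tensor_power_eqI:
  assumes s': "vector_space s'"
    and L: "linear_on_set tscale s' (tensor_power s n) L" and M: "linear_on_set tscale s' (tensor_power s n) M"
    and eq: "\<And>xs. length xs = n \<Longrightarrow> L (pure_tensor s xs) = M (pure_tensor s xs)"
    and t: "t \<in> tensor_power s n"
  shows "L t = M t"
  using t
proof (induction rule: tensor_power_induct)
  case zero
  show ?case using linear_on_set_zero[OF s' L] linear_on_set_zero[OF s' M] by (simp only:)
next
  case (step c xs t)
  have "L (tscale c (pure_tensor s xs) + t) = s' c (L (pure_tensor s xs)) + L t"
    "M (tscale c (pure_tensor s xs) + t) = s' c (M (pure_tensor s xs)) + M t"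
    using L M step pure_in_tensor_power[of xs n s] tensor_power_scale[of _ s n]
    unfolding linear_on_set_def by metis+
  then show ?case using step eq by metis
qed

section \<open>Scalars\<close>

lemma multilinear_0: "multilinear s s' 0 f"
  by (simp add: multilinear_def)

lemma pure_tensor_Nil: "pure_tensor s [] f = f []"
  by (simp add: pure_tensor_def multilinear_0)

lemma to_scalar_eqI: "t = tscale c (pure_tensor s []) \<Longrightarrow> to_scalar s t = c"
  unfolding to_scalar_def
  by (rule the_equality) (auto simp: tscale_def pure_tensor_Nil dest: fun_cong[of _ _ "\<lambda>_. 1"])

lemma tensor_power_0:
  assumes "t \<in> tensor_power s 0"
  shows "t = tscale (to_scalar s t) (pure_tensor s [])"
proof -
  have "\<exists>c. t = tscale c (pure_tensor s [])"
    using assms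
  proof (induction rule: tensor_power_induct)
    case zero
    show ?case by (intro exI[of _ 0]) (simp add: tscale_def fun_eq_iff)
  next
    case (step c xs t)
    then obtain c' where "t = tscale c' (pure_tensor s [])" by blast
    then have "tscale c (pure_tensor s xs) + t = tscale (c + c') (pure_tensor s [])"
      using step(1) by (simp add: tscale_def fun_eq_iff algebra_simps)
    then show ?case by blast
  qed
  then show ?thesis using to_scalar_eqI by metis
qed

lemma to_scalar_apply: "t \<in> tensor_power s 0 \<Longrightarrow> to_scalar s t = t (\<lambda>_. 1)"
  using tensor_power_0[of t s] by (metis (no_types, lifting) mult.right_neutral pure_tensor_Nil tscale_def)

section \<open>Dual bases\<close>

lemma sum_PiE_insert:
  assumes "x \<notin> A"
  shows "(\<Sum>l\<in>insert x A \<rightarrow>\<^sub>E B. g l) = (\<Sum>l\<in>A \<rightarrow>\<^sub>E B. \<Sum>k\<in>B. g (l(x := k)))"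
proof -
  have "(\<Sum>l\<in>insert x A \<rightarrow>\<^sub>E B. g l) = (\<Sum>(k, l)\<in>B \<times> (A \<rightarrow>\<^sub>E B). g (l(x := k)))"
    unfolding PiE_insert_eq
    by (subst sum.reindex) (use inj_combinator[OF assms, of "\<lambda>_. B"] in \<open>auto simp: case_prod_unfold\<close>)
  also have "\<dots> = (\<Sum>k\<in>B. \<Sum>l\<in>A \<rightarrow>\<^sub>E B. g (l(x := k)))" by (rule sum.cartesian_product[symmetric])
  also have "\<dots> = (\<Sum>l\<in>A \<rightarrow>\<^sub>E B. \<Sum>k\<in>B. g (l(x := k)))" by (rule sum.swap)
  finally show ?thesis .
qed

locale symmetric_algebra =
  finite_dimensional_vector_space scale Basis
  for scale :: "'k::field \<Rightarrow> 'v::ab_group_add \<Rightarrow> 'v" and Basis :: "'v set" +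
  fixes b :: "('v, 'k) tensor \<Rightarrow> 'k" and S :: "nat \<Rightarrow> ('v, 'k) tensor \<Rightarrow> 'k"
  assumes sym_alg: "(b, S) \<in> symmetric_algebra_structures scale"
begin

abbreviation lin :: "('v \<Rightarrow> 'k) \<Rightarrow> bool" where "lin \<equiv> Vector_Spaces.linear scale (*)"
abbreviation mlin :: "nat \<Rightarrow> ('v list \<Rightarrow> 'k) \<Rightarrow> bool" where "mlin \<equiv> multilinear scale (*)"
abbreviation pure :: "'v list \<Rightarrow> ('v, 'k) tensor" where "pure \<equiv> pure_tensor scale"
abbreviation tpow :: "nat \<Rightarrow> ('v, 'k) tensor set" where "tpow \<equiv> tensor_power scale"

lemmas lin_iff = linear_form_iff[OF vector_space_axioms]
lemmas lin_mult = linear_mult_const[OF vector_space_axioms]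

definition pairing :: "'v \<Rightarrow> 'v \<Rightarrow> 'k" where "pairing x y = b (pure [x, y])"

lemma b_form: "b \<in> tensor_form scale 2"
  and S_extensional: "S \<in> extensional {1..}"
  using sym_alg unfolding symmetric_algebra_structures_def by simp_all

lemma S_form: "r \<ge> 1 \<Longrightarrow> S r \<in> tensor_form scale r"
  using sym_alg unfolding symmetric_algebra_structures_def by simp

lemma pairing_sym: "pairing x y = pairing y x"
  using sym_alg unfolding symmetric_algebra_structures_def pairing_def by fast

lemma pairing_nondegenerate: "(\<And>y. pairing x y = 0) \<Longrightarrow> x = 0"
  using sym_alg unfolding symmetric_algebra_structures_def pairing_def by fast

lemma S_permute:
  assumes "r \<ge> 1" "length xs = r" "\<sigma> permutes {..<r}"
  shows "S r (pure (permute_list \<sigma> xs)) = S r (pure xs)"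
proof -
  have "\<forall>xs \<sigma>. length xs = r \<and> \<sigma> permutes {..<r} \<longrightarrow>
      S r (pure xs) = S r (pure (permute_list \<sigma> xs))"
    using sym_alg assms(1) unfolding symmetric_algebra_structures_def by simp
  then show ?thesis using assms by metis
qed

lemma S_multilinear: "r \<ge> 1 \<Longrightarrow> mlin r (\<lambda>xs. S r (pure xs))"
  using S_form[of r] unfolding tensor_form_def
  by (intro multilinear_linear_on_pure vector_space_axioms vector_space_field) simp

lemma lin_pairing: "lin (pairing x)" "lin (\<lambda>x. pairing x y)"
proof -
  have ml: "mlin 2 (\<lambda>xs. b (pure xs))"
    using b_form unfolding tensor_form_def
    by (intro multilinear_linear_on_pure vector_space_axioms vector_space_field) simp
  show "lin (pairing x)" "lin (\<lambda>x. pairing x y)"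
    using multilinearD[OF ml, of "[x, x]" 1] multilinearD[OF ml, of "[y, y]" 0]
    unfolding pairing_def by simp_all
qed

lemma lin_sum_scale: "lin g \<Longrightarrow> g (\<Sum>a\<in>A. scale (c a) (h a)) = (\<Sum>a\<in>A. c a * g (h a))"
proof -
  assume "lin g"
  then interpret module_hom scale "(*)" g by (simp add: module_hom_iff_linear)
  show ?thesis by (simp add: sum scale)
qed

lemma Basis_expansion: "\<exists>c. v = (\<Sum>k\<in>Basis. scale (c k) k)"
proof -
  have "v \<in> span Basis" by (simp add: span_Basis)
  then show ?thesis unfolding span_finite[OF finite_Basis] by auto
qed

text \<open>The linear map \<open>v \<mapsto> \<Sum> pairing k v \<cdot> k\<close> is injective
  because the pairing is non-degenerate, hence surjective because the dimension is finite. The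
  dual basis consists of preimages of the basis vectors.\<close>

lemma ex_dual: "\<exists>d. \<forall>k\<in>Basis. \<forall>j\<in>Basis. pairing k (d j) = (if k = j then 1 else 0)"
proof -
  define \<phi> where "\<phi> v = (\<Sum>k\<in>Basis. scale (pairing k v) k)" for v
  have ind: "(\<Sum>k\<in>Basis. scale (c k) k) = (\<Sum>k\<in>Basis. scale (c' k) k) \<Longrightarrow> k \<in> Basis \<Longrightarrow> c k = c' k" for c c' k
    using independentD[OF independent_Basis finite_Basis subset_refl, of "\<lambda>k. c k - c' k" k]
    by (simp add: scale_left_diff_distrib sum_subtractf)
  have "Vector_Spaces.linear scale scale \<phi>"
    unfolding Vector_Spaces.linear_iff \<phi>_def
    using vector_space_axioms lin_pairing(1)
    by (auto simp: lin_iff sum.distrib scale_left_distrib scale_sum_right)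
  moreover have "inj \<phi>"
  proof (rule injI)
    fix x y assume "\<phi> x = \<phi> y"
    then have "\<forall>k\<in>Basis. pairing k x = pairing k y" using ind[of "\<lambda>k. pairing k x" "\<lambda>k. pairing k y"] unfolding \<phi>_def by blast
    then have *: "pairing k (x - y) = 0" if "k \<in> Basis" for k
      using lin_pairing(1)[of k] that unfolding lin_iff by (metis add_diff_cancel_right' diff_add_cancel eq_iff_diff_eq_0)
    have "pairing (x - y) z = 0" for z
    proof -
      obtain c where z: "z = (\<Sum>k\<in>Basis. scale (c k) k)" using Basis_expansion by blast
      show ?thesis unfolding z lin_sum_scale[OF lin_pairing(1)] using * pairing_sym by simp
    qed
    then show "x = y" using pairing_nondegenerate[of "x - y"] by simp
  qed
  ultimately have "surj \<phi>" by (rule linear_inj_imp_surj)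
  then have "\<exists>v. \<phi> v = j" for j by (metis surjD)
  then obtain d where d: "\<And>j. \<phi> (d j) = j" by metis
  have "pairing k (d j) = (if k = j then 1 else 0)" if "k \<in> Basis" "j \<in> Basis" for k j
  proof (rule ind[OF _ that(1)])
    have "(\<Sum>k\<in>Basis. scale (pairing k (d j)) k) = j" using d[of j] by (simp add: \<phi>_def)
    also have "j = (\<Sum>k\<in>Basis. if k = j then k else 0)"
      using that(2) finite_Basis by (simp add: sum.delta')
    also have "\<dots> = (\<Sum>k\<in>Basis. scale (if k = j then 1 else 0) k)"
      by (intro sum.cong) auto
    finally show "(\<Sum>k\<in>Basis. scale (pairing k (d j)) k) = (\<Sum>k\<in>Basis. scale (if k = j then 1 else 0) k)" .
  qed
  then show ?thesis by blast
qed

definition dual :: "'v \<Rightarrow> 'v" where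
  "dual = (SOME d. \<forall>k\<in>Basis. \<forall>j\<in>Basis. pairing k (d j) = (if k = j then 1 else 0))"

lemma pairing_dual: "k \<in> Basis \<Longrightarrow> j \<in> Basis \<Longrightarrow> pairing k (dual j) = (if k = j then 1 else 0)"
  using someI_ex[OF ex_dual] unfolding dual_def by blast

lemma dual_expansion: "v = (\<Sum>k\<in>Basis. scale (pairing v (dual k)) k)"
proof -
  obtain c where v: "v = (\<Sum>k\<in>Basis. scale (c k) k)" using Basis_expansion by blast
  have "pairing v (dual j) = c j" if "j \<in> Basis" for j
  proof -
    have "pairing v (dual j) = (\<Sum>k\<in>Basis. c k * pairing k (dual j))"
      unfolding v by (rule lin_sum_scale[OF lin_pairing(2)])
    also have "\<dots> = (\<Sum>k\<in>Basis. if k = j then c k else 0)"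
      by (intro sum.cong) (auto simp: pairing_dual that)
    finally show ?thesis using that finite_Basis by simp
  qed
  then show ?thesis using v by simp
qed

lemma lin_expansion: "lin g \<Longrightarrow> g v = (\<Sum>k\<in>Basis. pairing v (dual k) * g k)"
  by (subst dual_expansion) (rule lin_sum_scale)

text \<open>The copairing \<open>\<Sum> k \<otimes> dual k\<close> is symmetric because its
  coefficients in the basis are \<open>pairing (dual k) (dual j)\<close>. Hence an edge may be
  directed either way.\<close>

lemma copairing_symmetric:
  assumes "\<And>v. lin (\<lambda>u. \<Phi> u v)" "\<And>u. lin (\<Phi> u)"
  shows "(\<Sum>k\<in>Basis. \<Phi> k (dual k)) = (\<Sum>k\<in>Basis. \<Phi> (dual k) k)"
proof -
  have "(\<Sum>k\<in>Basis. \<Phi> k (dual k)) = (\<Sum>k\<in>Basis. \<Sum>j\<in>Basis. pairing (dual k) (dual j) * \<Phi> k j)"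
    by (intro sum.cong refl lin_expansion assms)
  also have "\<dots> = (\<Sum>k\<in>Basis. \<Sum>j\<in>Basis. pairing (dual k) (dual j) * \<Phi> j k)"
    by (subst sum.swap) (simp add: pairing_sym)
  also have "\<dots> = (\<Sum>k\<in>Basis. \<Phi> (dual k) k)"
    by (intro sum.cong refl lin_expansion[where g = "\<lambda>u. \<Phi> u _", symmetric] assms)
  finally show ?thesis .
qed

text \<open>Each argument is expanded in the basis; the coefficient of \<open>k\<close> in
  \<open>x\<close> is \<open>pairing x (dual k)\<close>.\<close>

lemma multilinear_expansion:
  "mlin r F \<Longrightarrow> length xs = r \<Longrightarrow>
    (\<Sum>l\<in>{..<r} \<rightarrow>\<^sub>E Basis. (\<Prod>i<r. pairing (xs ! i) (dual (l i))) * F (map l [0..<r])) = F xs"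
proof (induction r arbitrary: F xs)
  case 0
  then show ?case by (simp add: PiE_empty_domain)
next
  case (Suc r)
  obtain ys y where xs: "xs = ys @ [y]" "length ys = r"
    using Suc.prems(2) by (metis length_Suc_conv_rev)
  have ml: "mlin (r + 1) F" using Suc.prems by simp
  have "(\<Sum>l\<in>{..<Suc r} \<rightarrow>\<^sub>E Basis. (\<Prod>i<Suc r. pairing (xs ! i) (dual (l i))) * F (map l [0..<Suc r])) =
      (\<Sum>l\<in>{..<r} \<rightarrow>\<^sub>E Basis. \<Sum>k\<in>Basis. (\<Prod>i<Suc r. pairing (xs ! i) (dual ((l(r := k)) i))) *
         F (map (l(r := k)) [0..<Suc r]))"
    unfolding lessThan_Suc by (rule sum_PiE_insert) simp
  also have "\<dots> = (\<Sum>l\<in>{..<r} \<rightarrow>\<^sub>E Basis. \<Sum>k\<in>Basis. pairing y (dual k) *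
      ((\<Prod>i<r. pairing (ys ! i) (dual (l i))) * F (map l [0..<r] @ [k])))"
  proof (intro sum.cong refl)
    fix l k
    have "(\<Prod>i<r. pairing (xs ! i) (dual ((l(r := k)) i))) = (\<Prod>i<r. pairing (ys ! i) (dual (l i)))"
      by (intro prod.cong refl) (simp add: xs nth_append)
    moreover have "map (l(r := k)) [0..<Suc r] = map l [0..<r] @ [k]" by simp
    moreover have "xs ! r = y" using xs by (simp add: nth_append)
    ultimately show "(\<Prod>i<Suc r. pairing (xs ! i) (dual ((l(r := k)) i))) * F (map (l(r := k)) [0..<Suc r]) =
        pairing y (dual k) * ((\<Prod>i<r. pairing (ys ! i) (dual (l i))) * F (map l [0..<r] @ [k]))"
      by (simp add: mult_ac)
  qed
  also have "\<dots> = (\<Sum>k\<in>Basis. pairing y (dual k) * (\<Sum>l\<in>{..<r} \<rightarrow>\<^sub>E Basis.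
      (\<Prod>i<r. pairing (ys ! i) (dual (l i))) * F (map l [0..<r] @ [k])))"
    by (subst sum.swap) (simp add: sum_distrib_left)
  also have "\<dots> = (\<Sum>k\<in>Basis. pairing y (dual k) * F (ys @ [k]))"
    using Suc.IH[OF multilinear_append_left[OF ml]] xs(2) by simp
  also have "\<dots> = F (ys @ [y])"
  proof (rule lin_expansion[symmetric])
    show "lin (\<lambda>k. F (ys @ [k]))"
      using multilinearD[OF multilinear_append_right[OF ml xs(2)], of "[y]" 0] by simp
  qed
  finally show ?case by (simp only: xs)
qed

end

section \<open>The state sum of a graph\<close>

definition halves_at :: "('v, 'h, 'e) pregraph \<Rightarrow> 'v \<Rightarrow> 'h set" where
  "halves_at G v = {h \<in> halves G. vtx G h = v}"

lemma halves_at_finite: "is_graph G \<Longrightarrow> finite (halves_at G v)"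
  by (simp add: halves_at_def is_graph_def)

lemma halves_at_nonempty: "is_graph G \<Longrightarrow> v \<in> verts G \<Longrightarrow> halves_at G v \<noteq> {}"
proof -
  assume "is_graph G" "v \<in> verts G"
  then have "v \<in> vtx G ` halves G" by (simp add: is_graph_def)
  then show "halves_at G v \<noteq> {}" by (auto simp: halves_at_def)
qed

context symmetric_algebra
begin

text \<open>The value of \<open>S\<close> on the vectors attached to the half-edges in
  \<open>H\<close>. As \<open>S\<close> is symmetric, the half-edges may be listed in any
  order.\<close>

definition vertex_weight :: "'h set \<Rightarrow> ('h \<Rightarrow> 'v) \<Rightarrow> 'k" where
  "vertex_weight H \<epsilon> =
     S (card H) (pure (map \<epsilon> (SOME hs. distinct hs \<and> set hs = H)))"

lemma vertex_weight_eq: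
  assumes "distinct hs" "hs \<noteq> []"
  shows "vertex_weight (set hs) \<epsilon> = S (length hs) (pure (map \<epsilon> hs))"
proof -
  let ?hs = "SOME hs'. distinct hs' \<and> set hs' = set hs"
  have hs': "distinct ?hs \<and> set ?hs = set hs" by (rule someI[of _ hs]) (simp add: assms)
  then have "mset ?hs = mset hs" using assms(1) set_eq_iff_mset_eq_distinct by blast
  then obtain \<sigma> where \<sigma>: "\<sigma> permutes {..<length hs}" "permute_list \<sigma> hs = ?hs"
    by (rule mset_eq_permutation)
  have "map \<epsilon> ?hs = permute_list \<sigma> (map \<epsilon> hs)" using permute_list_map[OF \<sigma>(1)] \<sigma>(2) by metis
  moreover have "length hs \<ge> 1" using assms(2) by (cases hs) auto
  ultimately show ?thesis
    using S_permute[of "length hs" "map \<epsilon> hs" \<sigma>] \<sigma>(1) assms(1)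
    by (simp add: vertex_weight_def distinct_card)
qed

lemma finite_set_list:
  assumes "finite H" "H \<noteq> {}"
  obtains hs where "distinct hs" "set hs = H" "hs \<noteq> []"
  using finite_distinct_list[OF assms(1)] assms(2) by auto

lemma vertex_weight_lin:
  assumes "finite H" "h \<in> H"
  shows "lin (\<lambda>u. vertex_weight H (\<epsilon>(h := u)))"
proof -
  obtain hs where hs: "distinct hs" "set hs = H" "hs \<noteq> []"
    using finite_set_list assms by (metis empty_iff)
  then obtain i where i: "i < length hs" "hs ! i = h" using assms(2) by (metis in_set_conv_nth)
  have "map (\<epsilon>(h := u)) hs = (map \<epsilon> hs)[i := u]" for u
    using i hs(1) by (intro nth_equalityI) (auto simp: nth_list_update nth_eq_iff_index_eq)
  moreover have "lin (\<lambda>u. S (length hs) (pure ((map \<epsilon> hs)[i := u])))"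
    using S_multilinear[of "length hs"] hs(3) i(1)
    by (intro multilinearD[where n = "length hs" and F = "\<lambda>xs. S (length hs) (pure xs)"])
      (auto simp: Suc_le_eq)
  ultimately show ?thesis using vertex_weight_eq[OF hs(1,3)] hs(2) by simp
qed

lemma vertex_weight_image:
  assumes "inj_on \<beta> H" "finite H" "H \<noteq> {}"
  shows "vertex_weight (\<beta> ` H) \<epsilon> = vertex_weight H (\<lambda>h. \<epsilon> (\<beta> h))"
proof -
  obtain hs where hs: "distinct hs" "set hs = H" "hs \<noteq> []" using finite_set_list assms by metis
  then have "distinct (map \<beta> hs)" "map \<beta> hs \<noteq> []" using assms(1) by (auto simp: distinct_map)
  from vertex_weight_eq[OF this] vertex_weight_eq[OF hs(1,3)] hs(2) show ?thesis
    by (simp add: comp_def)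
qed

lemma vertex_weight_cong:
  assumes "finite H" "H \<noteq> {}" "\<And>h. h \<in> H \<Longrightarrow> \<epsilon> h = \<epsilon>' h"
  shows "vertex_weight H \<epsilon> = vertex_weight H \<epsilon>'"
proof -
  obtain hs where hs: "distinct hs" "set hs = H" "hs \<noteq> []" using finite_set_list assms by metis
  then have "map \<epsilon> hs = map \<epsilon>' hs" using assms(3) by simp
  with vertex_weight_eq[OF hs(1,3)] hs(2) show ?thesis by metis
qed

text \<open>The contribution of one assignment \<open>\<epsilon>\<close> of vectors to all ends:
  the vectors at a vertex are fed into \<open>S\<close>, the vector at an input is paired with the
  argument, and the vectors at the outputs are the arguments of the test function
  \<open>f\<close>. It is linear in each of the vectors.\<close>

definition graph_form ::
  "('a, 'h, 'e) pregraph \<Rightarrow> ('v list \<Rightarrow> 'k) \<Rightarrow> 'v list \<Rightarrow> ('h edge_end \<Rightarrow> 'v) \<Rightarrow> 'k" where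
  "graph_form G f xs \<epsilon> =
     (\<Prod>v\<in>verts G. vertex_weight (halves_at G v) (\<lambda>h. \<epsilon> (Half h))) *
     (\<Prod>i<n_in G. pairing (xs ! i) (\<epsilon> (In i))) *
     f (map (\<lambda>j. \<epsilon> (Out j)) [0..<n_out G])"

lemma graph_form_cong:
  assumes G: "is_graph G" and "\<And>x. x \<in> ends G \<Longrightarrow> \<epsilon> x = \<epsilon>' x"
    and "\<And>ys. length ys = n_out G \<Longrightarrow> f ys = f' ys"
  shows "graph_form G f xs \<epsilon> = graph_form G f' xs \<epsilon>'"
proof -
  have "vertex_weight (halves_at G v) (\<lambda>h. \<epsilon> (Half h)) = vertex_weight (halves_at G v) (\<lambda>h. \<epsilon>' (Half h))"
    if "v \<in> verts G" for v
    using halves_at_finite[OF G] halves_at_nonempty[OF G that] assms(2)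
    by (intro vertex_weight_cong) (auto simp: halves_at_def)
  moreover have "map (\<lambda>j. \<epsilon> (Out j)) [0..<n_out G] = map (\<lambda>j. \<epsilon>' (Out j)) [0..<n_out G]"
    using assms(2) by simp
  then have "f (map (\<lambda>j. \<epsilon> (Out j)) [0..<n_out G]) = f' (map (\<lambda>j. \<epsilon>' (Out j)) [0..<n_out G])"
    by (simp only:) (rule assms(3), simp)
  ultimately show ?thesis
    unfolding graph_form_def using assms(2)
    by (intro arg_cong2[where f = "(*)"] prod.cong refl) auto
qed

lemma graph_form_lin:
  assumes G: "is_graph G" and f: "mlin (n_out G) f" and x: "x \<in> ends G"
  shows "lin (\<lambda>u. graph_form G f xs (\<epsilon>(x := u)))"
proof (cases x)
  case (Half h)
  have "lin (\<lambda>u. \<Prod>v\<in>verts G. vertex_weight (halves_at G v) (\<lambda>h'. (\<epsilon>(x := u)) (Half h')))"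
  proof (rule linear_prod_single[OF vector_space_axioms, of _ "vtx G h"
        _ "\<lambda>v. vertex_weight (halves_at G v) (\<lambda>h'. \<epsilon> (Half h'))"])
    show "finite (verts G)" using G by (simp add: is_graph_def)
    show "vtx G h \<in> verts G" using G x Half by (simp add: is_graph_vtx)
    show "vertex_weight (halves_at G v) (\<lambda>h'. (\<epsilon>(x := u)) (Half h')) =
        vertex_weight (halves_at G v) (\<lambda>h'. \<epsilon> (Half h'))" if "v \<in> verts G" "v \<noteq> vtx G h" for v u
      using that halves_at_finite[OF G] halves_at_nonempty[OF G that(1)]
      by (intro vertex_weight_cong) (auto simp: halves_at_def Half)
    have "(\<lambda>h'. (\<epsilon>(x := u)) (Half h')) = (\<lambda>h'. \<epsilon> (Half h'))(h := u)" for u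
      by (auto simp: Half)
    moreover have "h \<in> halves_at G (vtx G h)" using x Half by (simp add: halves_at_def)
    ultimately show "lin (\<lambda>u. vertex_weight (halves_at G (vtx G h)) (\<lambda>h'. (\<epsilon>(x := u)) (Half h')))"
      using vertex_weight_lin[OF halves_at_finite[OF G]] by simp
  qed
  then show ?thesis unfolding graph_form_def Half by (simp add: lin_mult)
next
  case (In i)
  have "lin (\<lambda>u. \<Prod>i<n_in G. pairing (xs ! i) ((\<epsilon>(x := u)) (In i)))"
    by (rule linear_prod_single[OF vector_space_axioms, of _ i _ "\<lambda>i. pairing (xs ! i) (\<epsilon> (In i))"])
      (use x In lin_pairing(1) in auto)
  then show ?thesis unfolding graph_form_def In by (simp add: lin_mult)
next
  case (Out j)
  then have j: "j < n_out G" using x by simp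
  have "map (\<lambda>j. (\<epsilon>(x := u)) (Out j)) [0..<n_out G] = (map (\<lambda>j. \<epsilon> (Out j)) [0..<n_out G])[j := u]" for u
    using j by (intro nth_equalityI) (auto simp: nth_list_update Out)
  moreover have "lin (\<lambda>u. f ((map (\<lambda>j. \<epsilon> (Out j)) [0..<n_out G])[j := u]))"
    using f j by (intro multilinearD[of _ _ "n_out G"]) auto
  ultimately show ?thesis unfolding graph_form_def by (simp add: Out lin_mult)
qed

lemma graph_form_lin_arg:
  assumes "length xs = n_in G" "i < n_in G"
  shows "lin (\<lambda>u. graph_form G f (xs[i := u]) \<epsilon>)"
proof -
  have "lin (\<lambda>u. \<Prod>i'<n_in G. pairing (xs[i := u] ! i') (\<epsilon> (In i')))"
    by (rule linear_prod_single[OF vector_space_axioms, of _ i _ "\<lambda>i. pairing (xs ! i) (\<epsilon> (In i))"])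
      (use assms lin_pairing(2) in auto)
  then show ?thesis unfolding graph_form_def by (simp add: lin_mult)
qed

lemma graph_form_sum:
  "graph_form G (\<lambda>ys. \<Sum>a\<in>A. f a ys) xs \<epsilon> = (\<Sum>a\<in>A. graph_form G (f a) xs \<epsilon>)"
  unfolding graph_form_def by (simp add: sum_distrib_left)

text \<open>An edge labelled with a basis vector \<open>k\<close> carries \<open>k\<close> at its
  marked end and \<open>dual k\<close> at the other one. Summing over the labels of all edges
  inserts a copairing for every edge.\<close>

definition end_vec :: "bool \<Rightarrow> 'v \<Rightarrow> 'v" where
  "end_vec d k = (if d then k else dual k)"

lemma pairing_end_vec:
  "d \<noteq> d' \<Longrightarrow> k \<in> Basis \<Longrightarrow> k' \<in> Basis \<Longrightarrow>
    pairing (end_vec d k) (end_vec d' k') = (if k = k' then 1 else 0)"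
  using pairing_dual[of k k'] pairing_dual[of k' k] pairing_sym[of "dual k" k']
  by (auto simp: end_vec_def)

definition state_sum ::
  "('a, 'h, 'e) pregraph \<Rightarrow> ('h edge_end \<Rightarrow> bool) \<Rightarrow> ('v list \<Rightarrow> 'k) \<Rightarrow> 'v list \<Rightarrow> 'k" where
  "state_sum G d f xs =
     (\<Sum>l\<in>edges G \<rightarrow>\<^sub>E Basis. graph_form G f xs (\<lambda>x. end_vec (d x) (l (edge_of G x))))"

lemma state_sum_cong:
  assumes "is_graph G" "\<And>x. x \<in> ends G \<Longrightarrow> d x = d' x" "\<And>ys. length ys = n_out G \<Longrightarrow> f ys = f' ys"
  shows "state_sum G d f xs = state_sum G d' f' xs"
  unfolding state_sum_def by (intro sum.cong refl graph_form_cong assms) (simp add: assms(2))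

text \<open>Both ends of the edge enter \<open>graph_form\<close> linearly, so this is the
  symmetry of the copairing. On a circle there is nothing to change.\<close>

lemma state_sum_flip:
  assumes G: "is_graph G" and d: "oriented G d" and f: "mlin (n_out G) f"
    and e: "e \<in> edges G"
  shows "state_sum G (\<lambda>x. if edge_of G x = e then \<not> d x else d x) f xs = state_sum G d f xs"
    (is "state_sum G ?d' f xs = _")
proof -
  have split: "(\<Sum>l\<in>edges G \<rightarrow>\<^sub>E Basis. g l) =
      (\<Sum>l\<in>(edges G - {e}) \<rightarrow>\<^sub>E Basis. \<Sum>k\<in>Basis. g (l(e := k)))" for g :: "_ \<Rightarrow> 'k"
    using sum_PiE_insert[of e "edges G - {e}" g Basis] e by (simp add: insert_absorb)
  have inner: "(\<Sum>k\<in>Basis. graph_form G f xs (\<lambda>x. end_vec (?d' x) ((l(e := k)) (edge_of G x)))) =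
      (\<Sum>k\<in>Basis. graph_form G f xs (\<lambda>x. end_vec (d x) ((l(e := k)) (edge_of G x))))" for l
  proof (cases "\<exists>x\<in>ends G. edge_of G x = e")
    case False
    then show ?thesis by (intro sum.cong refl graph_form_cong G) auto
  next
    case True
    then obtain x' where x': "x' \<in> ends G" "edge_of G x' = e" by blast
    obtain y' where y': "y' \<in> ends G" "y' \<noteq> x'" "edge_of G y' = edge_of G x'"
      "\<And>z. z \<in> ends G \<Longrightarrow> edge_of G z = edge_of G x' \<Longrightarrow> z = x' \<or> z = y'"
      using is_graph_partner[OF G x'(1)] by metis
    have "d x' \<noteq> d y'" using d x' y' unfolding oriented_def by metis
    then obtain x y where xy: "x \<in> ends G" "y \<in> ends G" "x \<noteq> y" "edge_of G x = e" "edge_of G y = e"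
      "d x" "\<not> d y" and only: "\<And>z. z \<in> ends G \<Longrightarrow> edge_of G z = e \<Longrightarrow> z = x \<or> z = y"
      using x' y' by metis
    define \<epsilon> where "\<epsilon> z = end_vec (d z) (l (edge_of G z))" for z
    \<comment> \<open>only the vectors at the two ends of \<open>e\<close> vary\<close>
    define \<Phi> where "\<Phi> u v = graph_form G f xs (\<epsilon>(x := u, y := v))" for u v
    have "graph_form G f xs (\<lambda>z. end_vec (d z) ((l(e := k)) (edge_of G z))) = \<Phi> k (dual k)" for k
      unfolding \<Phi>_def using xy only by (intro graph_form_cong G) (auto simp: \<epsilon>_def end_vec_def)
    moreover have "graph_form G f xs (\<lambda>z. end_vec (?d' z) ((l(e := k)) (edge_of G z))) = \<Phi> (dual k) k" for k
      unfolding \<Phi>_def using xy only by (intro graph_form_cong G) (auto simp: \<epsilon>_def end_vec_def)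
    moreover have "lin (\<Phi> u)" for u
      unfolding \<Phi>_def using graph_form_lin[OF G f xy(2)] .
    moreover have "lin (\<lambda>u. \<Phi> u v)" for v
      unfolding \<Phi>_def fun_upd_twist[OF xy(3)] using graph_form_lin[OF G f xy(1)] .
    ultimately show ?thesis using copairing_symmetric[of \<Phi>] by simp
  qed
  show ?thesis unfolding state_sum_def split by (rule sum.cong[OF refl inner])
qed

text \<open>Two choices of directions differ by reversing some of the edges, which may be done for
  one edge after the other.\<close>

lemma state_sum_orientation:
  assumes G: "is_graph G" and f: "mlin (n_out G) f"
    and d: "oriented G d" and d': "oriented G d'"
  shows "state_sum G d' f xs = state_sum G d f xs"
proof -
  define fl where "fl D x = (if edge_of G x \<in> D then \<not> d x else d x)" for D x
  have or: "oriented G (fl D)" for D using d unfolding oriented_def fl_def by metis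
  have flip: "state_sum G (fl D) f xs = state_sum G d f xs" if "finite D" "D \<subseteq> edges G" for D
    using that
  proof (induction D)
    case empty
    have "fl {} = d" by (simp add: fl_def fun_eq_iff)
    then show ?case by simp
  next
    case (insert e D)
    have "fl (insert e D) = (\<lambda>x. if edge_of G x = e then \<not> fl D x else fl D x)"
      using insert.hyps(2) by (auto simp: fl_def fun_eq_iff)
    then show ?case using insert state_sum_flip[OF G or f, of e D xs] by simp
  qed
  let ?D = "{e \<in> edges G. \<exists>x\<in>ends G. edge_of G x = e \<and> d x \<noteq> d' x}"
  have "fl ?D x = d' x" if x: "x \<in> ends G" for x
  proof (cases "edge_of G x \<in> ?D")
    case True
    then obtain z where "z \<in> ends G" "edge_of G z = edge_of G x" "d z \<noteq> d' z" by auto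
    then have "d x \<noteq> d' x" using d d' x unfolding oriented_def by metis
    then show ?thesis using True unfolding fl_def by simp
  next
    case False
    then have "d x = d' x" using x is_graph_edge_of[OF G x] by auto
    then show ?thesis using False unfolding fl_def by simp
  qed
  then have "state_sum G d' f xs = state_sum G (fl ?D) f xs" by (intro state_sum_cong G) auto
  also have "\<dots> = state_sum G d f xs"
    using G by (intro flip) (auto simp: is_graph_def)
  finally show ?thesis .
qed

text \<open>Evaluated against all multilinear functions \<open>f\<close> of the outputs, the state
  sum describes a tensor depending multilinearly on the arguments \<open>xs\<close>.\<close>

definition graph_eval :: "('a, 'h, 'e) pregraph \<Rightarrow> ('v list \<Rightarrow> 'k) \<Rightarrow> 'v list \<Rightarrow> 'k" where
  "graph_eval G f xs = state_sum G (SOME d. oriented G d) f xs"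

lemma graph_eval_eq:
  assumes "is_graph G" "mlin (n_out G) f" "oriented G d"
  shows "graph_eval G f xs = state_sum G d f xs"
  unfolding graph_eval_def
  by (rule state_sum_orientation[OF assms]) (rule someI_ex[OF ex_orientation[OF assms(1)]])

lemma graph_eval_multilinear: "mlin (n_in G) (graph_eval G f)"
  unfolding multilinear_def graph_eval_def state_sum_def
  by (intro allI impI linear_sum vector_space_axioms graph_form_lin_arg)

subsection \<open>Invariance under isomorphism\<close>

text \<open>Directions and labels of edges are transported along the isomorphism; reordering the
  half-edges at a vertex does no harm since \<open>S\<close> is symmetric.\<close>

lemma graph_eval_iso:
  assumes iso: "graph_iso G H" and G: "is_graph G" and H: "is_graph H"
    and f: "mlin (n_out H) f"
  shows "graph_eval G f xs = graph_eval H f xs"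
proof -
  obtain \<alpha> \<beta> \<gamma> where 1: "n_in G = n_in H" "n_out G = n_out H"
    "bij_betw \<alpha> (verts G) (verts H)" "bij_betw \<beta> (halves G) (halves H)"
    "bij_betw \<gamma> (edges G) (edges H)"
    "\<And>h. h \<in> halves G \<Longrightarrow> vtx H (\<beta> h) = \<alpha> (vtx G h)"
    and e: "\<And>x. x \<in> ends G \<Longrightarrow> edge_of H (map_edge_end \<beta> x) = \<gamma> (edge_of G x)"
    using iso unfolding graph_iso_def by blast
  obtain d where d: "oriented H d" using ex_orientation[OF H] ..
  have inj: "map_edge_end \<beta> x \<noteq> map_edge_end \<beta> y" if "x \<in> ends G" "y \<in> ends G" "x \<noteq> y" for x y
    using that 1(4) by (cases x; cases y) (auto simp: bij_betw_def dest: inj_onD)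
  have mem: "map_edge_end \<beta> x \<in> ends H" if "x \<in> ends G" for x
    using that 1(1,2,4) by (cases x) (auto dest: bij_betwE)
  have "oriented G (\<lambda>x. d (map_edge_end \<beta> x))"
    using d inj mem e unfolding oriented_def by metis
  then have "graph_eval G f xs = state_sum G (\<lambda>x. d (map_edge_end \<beta> x)) f xs"
    using G f 1(2) by (intro graph_eval_eq) auto
  also have "\<dots> = state_sum H d f xs"
    unfolding state_sum_def
  proof (rule sum.reindex_bij_witness[where j = "\<lambda>l. \<lambda>e\<in>edges H. l (inv_into (edges G) \<gamma> e)"
        and i = "\<lambda>l. \<lambda>e\<in>edges G. l (\<gamma> e)"])
    have \<gamma>: "\<gamma> e \<in> edges H" "inv_into (edges G) \<gamma> (\<gamma> e) = e" if "e \<in> edges G" for e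
      using 1(5) that by (auto simp: bij_betw_def)
    have \<gamma>': "inv_into (edges G) \<gamma> e \<in> edges G" "\<gamma> (inv_into (edges G) \<gamma> e) = e" if "e \<in> edges H" for e
      using 1(5) that by (metis bij_betw_def f_inv_into_f inv_into_into)+
    fix l l'
    show "(\<lambda>e\<in>edges G. (\<lambda>e\<in>edges H. l (inv_into (edges G) \<gamma> e)) (\<gamma> e)) = l" if "l \<in> edges G \<rightarrow>\<^sub>E Basis"
      using that \<gamma> by (auto simp: fun_eq_iff restrict_def PiE_def extensional_def)
    show "(\<lambda>e\<in>edges H. l (inv_into (edges G) \<gamma> e)) \<in> edges H \<rightarrow>\<^sub>E Basis" if "l \<in> edges G \<rightarrow>\<^sub>E Basis"
      using that \<gamma>' by auto
    show "(\<lambda>e\<in>edges H. (\<lambda>e\<in>edges G. l' (\<gamma> e)) (inv_into (edges G) \<gamma> e)) = l'" if "l' \<in> edges H \<rightarrow>\<^sub>E Basis"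
      using that \<gamma>' by (auto simp: fun_eq_iff restrict_def PiE_def extensional_def)
    show "(\<lambda>e\<in>edges G. l' (\<gamma> e)) \<in> edges G \<rightarrow>\<^sub>E Basis" if "l' \<in> edges H \<rightarrow>\<^sub>E Basis"
      using that \<gamma> by auto
    define \<epsilon> where "\<epsilon> x = end_vec (d x) ((\<lambda>e\<in>edges H. l (inv_into (edges G) \<gamma> e)) (edge_of H x))" for x
    have at: "halves_at H (\<alpha> v) = \<beta> ` halves_at G v" if "v \<in> verts G" for v
    proof -
      have "vtx H (\<beta> h) = \<alpha> v \<longleftrightarrow> vtx G h = v" if "h \<in> halves G" for h
        using 1(3,6) that \<open>v \<in> verts G\<close> is_graph_vtx[OF G that] by (metis bij_betw_def inj_onD)
      moreover have "halves H = \<beta> ` halves G" using 1(4) by (simp add: bij_betw_def)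
      ultimately show ?thesis unfolding halves_at_def by auto
    qed
    have "(\<Prod>v\<in>verts H. vertex_weight (halves_at H v) (\<lambda>h. \<epsilon> (Half h))) =
        (\<Prod>v\<in>verts G. vertex_weight (halves_at H (\<alpha> v)) (\<lambda>h. \<epsilon> (Half h)))"
      by (rule prod.reindex_bij_betw[OF 1(3), symmetric])
    also have "\<dots> = (\<Prod>v\<in>verts G. vertex_weight (halves_at G v) (\<lambda>h. \<epsilon> (Half (\<beta> h))))"
    proof (intro prod.cong refl)
      fix v assume v: "v \<in> verts G"
      have "inj_on \<beta> (halves_at G v)" using 1(4) by (auto simp: bij_betw_def halves_at_def intro: inj_on_subset)
      then show "vertex_weight (halves_at H (\<alpha> v)) (\<lambda>h. \<epsilon> (Half h)) =
          vertex_weight (halves_at G v) (\<lambda>h. \<epsilon> (Half (\<beta> h)))"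
        unfolding at[OF v] using halves_at_finite[OF G] halves_at_nonempty[OF G v]
        by (rule vertex_weight_image)
    qed
    finally have "graph_form H f xs \<epsilon> = graph_form G f xs (\<lambda>x. \<epsilon> (map_edge_end \<beta> x))"
      using 1(1,2) by (simp add: graph_form_def)
    also have "\<dots> = graph_form G f xs (\<lambda>x. end_vec (d (map_edge_end \<beta> x)) (l (edge_of G x)))"
    proof (intro graph_form_cong G refl)
      fix x assume x: "x \<in> ends G"
      then show "\<epsilon> (map_edge_end \<beta> x) = end_vec (d (map_edge_end \<beta> x)) (l (edge_of G x))"
        using \<gamma>[OF is_graph_edge_of[OF G x]] by (simp add: \<epsilon>_def e)
    qed
    finally show "graph_form H f xs (\<lambda>x. end_vec (d x) ((\<lambda>e\<in>edges H. l (inv_into (edges G) \<gamma> e)) (edge_of H x))) =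
        graph_form G f xs (\<lambda>x. end_vec (d (map_edge_end \<beta> x)) (l (edge_of G x)))"
      unfolding \<epsilon>_def .
  qed
  also have "\<dots> = graph_eval H f xs" by (rule graph_eval_eq[OF H f d, symmetric])
  finally show ?thesis .
qed

end

subsection \<open>Juxtaposition and composition\<close>

definition juxt_end ::
  "('a, 'h, 'e) pregraph \<Rightarrow> ('h + 'h2) edge_end \<Rightarrow> 'h edge_end + 'h2 edge_end" where
  "juxt_end G x = (case x of
      Half h \<Rightarrow> map_sum Half Half h
    | In i \<Rightarrow> if i < n_in G then Inl (In i) else Inr (In (i - n_in G))
    | Out j \<Rightarrow> if j < n_out G then Inl (Out j) else Inr (Out (j - n_out G)))"

lemma juxt_end_simps [simp]:
  "juxt_end G (Half (Inl h)) = Inl (Half h)"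
  "juxt_end G (Half (Inr h')) = Inr (Half h')"
  "juxt_end G (In i) = (if i < n_in G then Inl (In i) else Inr (In (i - n_in G)))"
  "juxt_end G (Out j) = (if j < n_out G then Inl (Out j) else Inr (Out (j - n_out G)))"
  by (simp_all add: juxt_end_def)

lemma edge_of_graph_juxt:
  "edge_of (graph_juxt G F) x = map_sum (edge_of G) (edge_of F) (juxt_end G x)"
  by (cases x rule: comp_end.cases) auto

lemma bij_betw_juxt_end:
  "bij_betw (juxt_end G) (ends (graph_juxt G F)) (ends G <+> ends F)"
proof (rule bij_betwI)
  show "juxt_end G \<in> ends (graph_juxt G F) \<rightarrow> ends G <+> ends F"
  proof
    fix x assume "x \<in> ends (graph_juxt G F)"
    then show "juxt_end G x \<in> ends G <+> ends F" by (cases x rule: comp_end.cases) auto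
  qed
  let ?inv = "case_sum (\<lambda>x. case x of Half h \<Rightarrow> Half (Inl h) | In i \<Rightarrow> In i | Out j \<Rightarrow> Out j)
    (\<lambda>x. case x of Half h \<Rightarrow> Half (Inr h) | In i \<Rightarrow> In (n_in G + i) | Out j \<Rightarrow> Out (n_out G + j))"
  show "?inv \<in> ends G <+> ends F \<rightarrow> ends (graph_juxt G F)"
    by (auto split: edge_end.splits)
  show "?inv (juxt_end G x) = x" for x by (cases x rule: comp_end.cases) auto
  show "juxt_end G (?inv y) = y" if "y \<in> ends G <+> ends F" for y
    using that by (auto split: edge_end.splits)
qed

lemma is_graph_juxt:
  assumes G: "is_graph G" and F: "is_graph F"
  shows "is_graph (graph_juxt G F)"
proof (rule is_graphI_partner)
  let ?J = "graph_juxt G F" and ?\<epsilon> = "map_sum (edge_of G) (edge_of F)"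
  have bij: "juxt_end G ` ends ?J = ends G <+> ends F" "inj_on (juxt_end G) (ends ?J)"
    using bij_betw_juxt_end[of G F] by (auto simp: bij_betw_def)
  show "finite (verts ?J)" "finite (halves ?J)" "finite (edges ?J)"
    using G F by (auto simp: is_graph_def)
  show "vtx ?J ` halves ?J = verts ?J"
    using G F by (simp add: map_sum_image_Plus is_graph_def)
  show "edge_of ?J ` ends ?J \<subseteq> edges ?J"
  proof safe
    fix x assume "x \<in> ends ?J"
    then have "juxt_end G x \<in> ends G <+> ends F" using bij by blast
    then show "edge_of ?J x \<in> edges ?J"
      unfolding edge_of_graph_juxt using G F by (auto simp: is_graph_edge_of)
  qed
  fix x assume x: "x \<in> ends ?J"
  then have "juxt_end G x \<in> ends G <+> ends F" using bij by blast
  from ends_Plus_partner[OF G F this] obtain y where y: "y \<in> ends ?J" "juxt_end G y \<noteq> juxt_end G x"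
    "?\<epsilon> (juxt_end G y) = ?\<epsilon> (juxt_end G x)"
    "\<forall>z\<in>ends ?J. ?\<epsilon> (juxt_end G z) = ?\<epsilon> (juxt_end G x) \<longrightarrow>
      juxt_end G z = juxt_end G x \<or> juxt_end G z = juxt_end G y"
    unfolding bij(1)[symmetric] by blast
  show "\<exists>y\<in>ends ?J. y \<noteq> x \<and> edge_of ?J y = edge_of ?J x \<and>
      (\<forall>z\<in>ends ?J. edge_of ?J z = edge_of ?J x \<longrightarrow> z = x \<or> z = y)"
    unfolding edge_of_graph_juxt using x y inj_onD[OF bij(2)] by metis
qed

lemma oriented_juxt:
  assumes "oriented G d" "oriented F d'"
  shows "oriented (graph_juxt G F) (\<lambda>x. case_sum d d' (juxt_end G x))"
  unfolding oriented_def
proof (intro ballI impI, elim conjE)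
  fix x y assume xy: "x \<in> ends (graph_juxt G F)" "y \<in> ends (graph_juxt G F)" "x \<noteq> y"
    "edge_of (graph_juxt G F) x = edge_of (graph_juxt G F) y"
  have "juxt_end G x \<noteq> juxt_end G y" "juxt_end G x \<in> ends G <+> ends F" "juxt_end G y \<in> ends G <+> ends F"
    using xy bij_betw_juxt_end[of G F] by (auto simp: bij_betw_def dest: inj_onD)
  moreover have "map_sum (edge_of G) (edge_of F) (juxt_end G x) = map_sum (edge_of G) (edge_of F) (juxt_end G y)"
    using xy(4) by (simp add: edge_of_graph_juxt)
  ultimately show "case_sum d d' (juxt_end G x) \<noteq> case_sum d d' (juxt_end G y)"
    using assms unfolding oriented_def by (cases "juxt_end G x"; cases "juxt_end G y") auto
qed

lemma prod_lessThan_add: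
  "(\<Prod>i<m + n. g i) = (\<Prod>i<m. g i) * (\<Prod>i<n. g (m + i :: nat) :: 'k::comm_monoid_mult)"
  by (induction n) (simp_all add: mult_ac)

text \<open>A labelling of a disjoint union of edges is a pair of labellings.\<close>

lemma sum_PiE_Plus:
  fixes A :: "'a set" and C :: "'b set" and B :: "'c set"
  shows
  "(\<Sum>l\<in>(A <+> C) \<rightarrow>\<^sub>E B. g l) = (\<Sum>l\<in>A \<rightarrow>\<^sub>E B. \<Sum>l'\<in>C \<rightarrow>\<^sub>E B. g (case_sum l l'))"
proof -
  have *: "case_sum (a \<circ> Inl) (a \<circ> Inr) = a" for a :: "'a + 'b \<Rightarrow> 'c"
    by (auto simp: fun_eq_iff split: sum.splits)
  have "(\<Sum>l\<in>(A <+> C) \<rightarrow>\<^sub>E B. g l) = (\<Sum>(l, l')\<in>(A \<rightarrow>\<^sub>E B) \<times> (C \<rightarrow>\<^sub>E B). g (case_sum l l'))"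
  proof (rule sum.reindex_bij_witness[where i = "\<lambda>(l, l'). case_sum l l'"
        and j = "\<lambda>l. (l \<circ> Inl, l \<circ> Inr)"])
    fix l assume l: "l \<in> (A <+> C) \<rightarrow>\<^sub>E B"
    then show "(l \<circ> Inl, l \<circ> Inr) \<in> (A \<rightarrow>\<^sub>E B) \<times> (C \<rightarrow>\<^sub>E B)"
      by (auto simp: PiE_def extensional_def)
  next
    fix p assume p: "p \<in> (A \<rightarrow>\<^sub>E B) \<times> (C \<rightarrow>\<^sub>E B)"
    show "(case p of (l, l') \<Rightarrow> case_sum l l') \<in> (A <+> C) \<rightarrow>\<^sub>E B"
      using p by (auto simp: PiE_def extensional_def split: sum.splits)
  qed (auto simp: case_sum_o_inj *)
  then show ?thesis by (simp add: sum.cartesian_product)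
qed

context symmetric_algebra
begin

text \<open>Composition and juxtaposition both leave the vertices and the half-edges at them
  untouched.\<close>

lemma vertex_prod_Plus:
  assumes G: "is_graph G" and F: "is_graph F"
    and H: "verts H = verts G <+> verts F" "halves H = halves G <+> halves F" "vtx H = map_sum (vtx G) (vtx F)"
  shows "(\<Prod>v\<in>verts H. vertex_weight (halves_at H v) \<epsilon>) =
    (\<Prod>v\<in>verts G. vertex_weight (halves_at G v) (\<lambda>h. \<epsilon> (Inl h))) *
    (\<Prod>v\<in>verts F. vertex_weight (halves_at F v) (\<lambda>h. \<epsilon> (Inr h)))"
proof -
  have l: "halves_at H (Inl v) = Inl ` halves_at G v" for v by (auto simp: halves_at_def H)
  have r: "halves_at H (Inr v) = Inr ` halves_at F v" for v by (auto simp: halves_at_def H)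
  have fin: "finite (verts G)" "finite (verts F)" using G F by (auto simp: is_graph_def)
  show ?thesis
    unfolding H(1) prod.Plus[OF fin] comp_def l r
    by (intro arg_cong2[where f = "(*)"] prod.cong refl vertex_weight_image
        halves_at_finite halves_at_nonempty G F) (auto simp: inj_on_def)
qed

lemma graph_form_juxt:
  assumes G: "is_graph G" and F: "is_graph F" and xs: "length xs = n_in G"
  shows "graph_form (graph_juxt G F) f (xs @ ys) (\<lambda>x. case_sum \<epsilon> \<epsilon>' (juxt_end G x)) =
    graph_form G (\<lambda>us. graph_form F (\<lambda>vs. f (us @ vs)) ys \<epsilon>') xs \<epsilon>"
proof -
  let ?\<epsilon> = "\<lambda>x. case_sum \<epsilon> \<epsilon>' (juxt_end G x)"
  have "map (\<lambda>j. ?\<epsilon> (Out j)) [0..<n_out G + n_out F] =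
      map (\<lambda>j. \<epsilon> (Out j)) [0..<n_out G] @ map (\<lambda>j. \<epsilon>' (Out j)) [0..<n_out F]"
    by (rule nth_equalityI) (auto simp: nth_append)
  moreover have "(\<Prod>i<n_in G. pairing ((xs @ ys) ! i) (?\<epsilon> (In i))) = (\<Prod>i<n_in G. pairing (xs ! i) (\<epsilon> (In i)))"
    by (intro prod.cong refl) (simp add: nth_append xs)
  moreover have "(\<Prod>i<n_in F. pairing ((xs @ ys) ! (n_in G + i)) (?\<epsilon> (In (n_in G + i)))) =
      (\<Prod>i<n_in F. pairing (ys ! i) (\<epsilon>' (In i)))"
    by (intro prod.cong refl) (simp add: nth_append xs)
  moreover note vertex_prod_Plus[OF G F, of "graph_juxt G F" "\<lambda>h. ?\<epsilon> (Half h)"]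
  ultimately show ?thesis
    unfolding graph_form_def by (simp add: prod_lessThan_add mult_ac)
qed

lemma graph_eval_juxt_multilinear:
  assumes f: "mlin (m + n_out F) f"
  shows "mlin m (\<lambda>us. graph_eval F (\<lambda>vs. f (us @ vs)) ys)"
  unfolding multilinear_def
proof (intro allI impI)
  fix us :: "'v list" and i assume us: "length us = m" "i < m"
  have "lin (\<lambda>u. f (us[i := u] @ vs))" if "length vs = n_out F" for vs :: "'v list"
    using multilinearD[OF multilinear_append_left[OF f that] us] .
  then show "lin (\<lambda>u. graph_eval F (\<lambda>vs. f (us[i := u] @ vs)) ys)"
    unfolding graph_eval_def state_sum_def graph_form_def
    by (intro linear_sum vector_space_axioms lin_mult) simp
qed

text \<open>The contributions multiply, and the state sums do so by distributivity.\<close>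

lemma graph_eval_juxt:
  assumes G: "is_graph G" and F: "is_graph F" and xs: "length xs = n_in G"
    and f: "mlin (n_out G + n_out F) f"
  shows "graph_eval (graph_juxt G F) f (xs @ ys) =
    graph_eval G (\<lambda>us. graph_eval F (\<lambda>vs. f (us @ vs)) ys) xs"
proof -
  obtain d where d: "oriented G d" using ex_orientation[OF G] ..
  obtain d' where d': "oriented F d'" using ex_orientation[OF F] ..
  define \<epsilon> where "\<epsilon> l x = end_vec (d x) (l (edge_of G x))" for l x
  define \<epsilon>' where "\<epsilon>' l x = end_vec (d' x) (l (edge_of F x))" for l x
  let ?J = "graph_juxt G F"
  have "graph_eval ?J f (xs @ ys) = state_sum ?J (\<lambda>x. case_sum d d' (juxt_end G x)) f (xs @ ys)"
    by (rule graph_eval_eq) (use is_graph_juxt[OF G F] oriented_juxt[OF d d'] f in auto)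
  also have "\<dots> = (\<Sum>l\<in>edges G \<rightarrow>\<^sub>E Basis. \<Sum>l'\<in>edges F \<rightarrow>\<^sub>E Basis.
      graph_form ?J f (xs @ ys) (\<lambda>x. case_sum (\<epsilon> l) (\<epsilon>' l') (juxt_end G x)))"
    unfolding state_sum_def graph_juxt_simps sum_PiE_Plus
    by (intro sum.cong refl arg_cong[where f = "graph_form _ _ _"])
      (auto simp: fun_eq_iff edge_of_graph_juxt \<epsilon>_def \<epsilon>'_def split: sum.splits)
  also have "\<dots> = (\<Sum>l\<in>edges G \<rightarrow>\<^sub>E Basis.
      graph_form G (\<lambda>us. state_sum F d' (\<lambda>vs. f (us @ vs)) ys) xs (\<epsilon> l))"
    unfolding graph_form_juxt[OF G F xs] state_sum_def graph_form_sum \<epsilon>'_def ..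
  also have "\<dots> = (\<Sum>l\<in>edges G \<rightarrow>\<^sub>E Basis.
      graph_form G (\<lambda>us. graph_eval F (\<lambda>vs. f (us @ vs)) ys) xs (\<epsilon> l))"
    by (intro sum.cong refl graph_form_cong G graph_eval_eq[symmetric] F d' multilinear_append_right[OF f])
  also have "\<dots> = state_sum G d (\<lambda>us. graph_eval F (\<lambda>vs. f (us @ vs)) ys) xs"
    unfolding state_sum_def by (simp add: \<epsilon>_def[abs_def])
  also have "\<dots> = graph_eval G (\<lambda>us. graph_eval F (\<lambda>vs. f (us @ vs)) ys) xs"
    by (rule graph_eval_eq[OF G graph_eval_juxt_multilinear[OF f] d, symmetric])
  finally show ?thesis .
qed

text \<open>The outputs of the lower graph are the arguments of the upper one, which leaves one
  pairing for each glued point.\<close>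

lemma graph_form_comp:
  assumes G: "is_graph G" and F: "is_graph F" and n: "n_in G = n_out F"
  shows "graph_form F (\<lambda>ys. graph_form G f ys \<epsilon>) xs \<epsilon>' =
    (\<Prod>i<n_in G. pairing (\<epsilon>' (Out i)) (\<epsilon> (In i))) *
    graph_form (graph_comp G F) f xs (\<lambda>x. case_sum \<epsilon> \<epsilon>' (comp_end x))"
proof -
  have "(\<Prod>i<n_in G. pairing (map (\<lambda>j. \<epsilon>' (Out j)) [0..<n_out F] ! i) (\<epsilon> (In i))) =
      (\<Prod>i<n_in G. pairing (\<epsilon>' (Out i)) (\<epsilon> (In i)))"
    by (intro prod.cong refl) (simp add: n)
  moreover note vertex_prod_Plus[OF G F, of "graph_comp G F" "\<lambda>h. case_sum \<epsilon> \<epsilon>' (comp_end (Half h))"]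
  ultimately show ?thesis
    unfolding graph_form_def by (simp add: mult_ac)
qed

text \<open>With consistent directions along the chains of edges, the factors at the glued points
  are Kronecker deltas. So only those labellings contribute that are constant on each chain, and
  these are the labellings of the edges of the composite graph. In particular a circle contributes
  the number of elements of the basis.\<close>

lemma graph_eval_comp:
  assumes G: "is_graph G" and F: "is_graph F" and n: "n_in G = n_out F"
    and f: "mlin (n_out G) f"
  shows "graph_eval (graph_comp G F) f xs = graph_eval F (graph_eval G f) xs"
proof -
  obtain d where dG: "oriented G (\<lambda>x. d (Inl x))" and dF: "oriented F (\<lambda>x. d (Inr x))"
    and glue: "\<And>i. i < n_in G \<Longrightarrow> d (Inl (In i)) \<noteq> d (Inr (Out i))"
    and dC: "oriented (graph_comp G F) (\<lambda>x. d (comp_end x))" and C: "is_graph (graph_comp G F)"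
    using graph_comp_orientation[OF G F n] by blast
  let ?C = "graph_comp G F" and ?E = "edges G <+> edges F" and ?R = "glue_rel G F"
  let ?e = "map_sum (edge_of G) (edge_of F)"
  define compat where "compat l \<longleftrightarrow>
    (\<forall>i<n_in G. l (Inl (edge_of G (In i))) = l (Inr (edge_of F (Out i))))" for l :: "_ \<Rightarrow> 'v"
  define form where "form l = graph_form ?C f xs (\<lambda>x. end_vec (d (comp_end x)) (l (?e (comp_end x))))" for l
  define \<epsilon> where "\<epsilon> l x = end_vec (d (Inl x)) (l (edge_of G x))" for l x
  define \<epsilon>' where "\<epsilon>' l x = end_vec (d (Inr x)) (l (edge_of F x))" for l x
  have "graph_eval F (graph_eval G f) xs = state_sum F (\<lambda>x. d (Inr x)) (graph_eval G f) xs"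
    by (rule graph_eval_eq[OF F _ dF]) (simp add: graph_eval_multilinear flip: n)
  also have "\<dots> = state_sum F (\<lambda>x. d (Inr x)) (state_sum G (\<lambda>x. d (Inl x)) f) xs"
    by (rule arg_cong[where f = "\<lambda>g. state_sum F _ g xs"]) (simp add: fun_eq_iff graph_eval_eq[OF G f dG])
  also have "\<dots> = (\<Sum>l\<in>edges G \<rightarrow>\<^sub>E Basis. \<Sum>l'\<in>edges F \<rightarrow>\<^sub>E Basis.
      graph_form F (\<lambda>ys. graph_form G f ys (\<epsilon> l)) xs (\<epsilon>' l'))"
    unfolding state_sum_def graph_form_sum \<epsilon>_def \<epsilon>'_def by (rule sum.swap)
  also have "\<dots> = (\<Sum>l\<in>edges G \<rightarrow>\<^sub>E Basis. \<Sum>l'\<in>edges F \<rightarrow>\<^sub>E Basis.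
      if compat (case_sum l l') then form (case_sum l l') else 0)"
  proof (intro sum.cong refl)
    fix l l' assume l: "l \<in> edges G \<rightarrow>\<^sub>E Basis" "l' \<in> edges F \<rightarrow>\<^sub>E Basis"
    have "pairing (\<epsilon>' l' (Out i)) (\<epsilon> l (In i)) =
        (if l (edge_of G (In i)) = l' (edge_of F (Out i)) then 1 else 0)" if i: "i < n_in G" for i
    proof -
      have "edge_of G (In i) \<in> edges G" "edge_of F (Out i) \<in> edges F"
        using i n by (auto intro: is_graph_edge_of G F)
      then have "l (edge_of G (In i)) \<in> Basis" "l' (edge_of F (Out i)) \<in> Basis" using l by auto
      then show ?thesis
        using pairing_end_vec[of "d (Inr (Out i))" "d (Inl (In i))" "l' (edge_of F (Out i))" "l (edge_of G (In i))"]
          glue[OF i] unfolding \<epsilon>_def \<epsilon>'_def by auto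
    qed
    then have "(\<Prod>i<n_in G. pairing (\<epsilon>' l' (Out i)) (\<epsilon> l (In i))) =
        (\<Prod>i<n_in G. if l (edge_of G (In i)) = l' (edge_of F (Out i)) then 1 else 0)"
      by (intro prod.cong) auto
    also have "\<dots> = (if compat (case_sum l l') then 1 else 0)"
      unfolding compat_def by (auto simp: prod_zero_iff)
    finally have delta: "(\<Prod>i<n_in G. pairing (\<epsilon>' l' (Out i)) (\<epsilon> l (In i))) = (if compat (case_sum l l') then 1 else 0)" .
    have "case_sum (\<epsilon> l) (\<epsilon>' l') z = end_vec (d z) (case_sum l l' (?e z))" for z
      by (cases z) (auto simp: \<epsilon>_def \<epsilon>'_def)
    then show "graph_form F (\<lambda>ys. graph_form G f ys (\<epsilon> l)) xs (\<epsilon>' l') =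
        (if compat (case_sum l l') then form (case_sum l l') else 0)"
      unfolding graph_form_comp[OF G F n] delta form_def by simp
  qed
  also have "\<dots> = (\<Sum>l\<in>?E \<rightarrow>\<^sub>E Basis. if compat l then form l else 0)"
    by (rule sum_PiE_Plus[symmetric])
  also have "\<dots> = (\<Sum>l\<in>{l \<in> ?E \<rightarrow>\<^sub>E Basis. compat l}. form l)"
    by (rule sum.inter_filter[symmetric]) (use G F finite_Basis in \<open>auto simp: is_graph_def intro!: finite_PiE\<close>)
  \<comment> \<open>labellings of the chains correspond to labellings of the edges that are constant on chains\<close>
  also have "\<dots> = state_sum ?C (\<lambda>x. d (comp_end x)) f xs"
    unfolding state_sum_def
  proof (rule sum.reindex_bij_witness[where j = "\<lambda>l. \<lambda>c\<in>?E // ?R. l (SOME e. e \<in> c)"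
        and i = "\<lambda>m. \<lambda>e\<in>?E. m (?R `` {e})"])
    fix l assume "l \<in> {l \<in> ?E \<rightarrow>\<^sub>E Basis. compat l}"
    then have l: "l \<in> ?E \<rightarrow>\<^sub>E Basis" "compat l" by auto
    have some: "l (SOME e'. e' \<in> ?R `` {e}) = l e" for e
      using glue_rel_invariant[OF glue_class_some, where \<kappa> = l] l(2) unfolding compat_def by metis
    have cls: "?R `` {e} \<in> ?E // ?R" if "e \<in> ?E" for e using that by (rule quotientI)
    show "(\<lambda>e\<in>?E. (\<lambda>c\<in>?E // ?R. l (SOME e. e \<in> c)) (?R `` {e})) = l"
      using l(1) cls some by (auto simp: fun_eq_iff restrict_def PiE_def extensional_def)
    show "(\<lambda>c\<in>?E // ?R. l (SOME e. e \<in> c)) \<in> edges ?C \<rightarrow>\<^sub>E Basis"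
      unfolding graph_comp_simps
    proof (rule restrict_PiE_iff[THEN iffD2], rule ballI)
      fix c assume "c \<in> ?E // ?R"
      then obtain e where "e \<in> ?E" "c = ?R `` {e}" by (rule quotientE)
      then show "l (SOME e. e \<in> c) \<in> Basis" using l(1) some by auto
    qed
    show "graph_form ?C f xs (\<lambda>x. end_vec (d (comp_end x))
          ((\<lambda>c\<in>?E // ?R. l (SOME e. e \<in> c)) (edge_of ?C x))) = form l"
      unfolding form_def
    proof (intro graph_form_cong C refl)
      fix x assume "x \<in> ends ?C"
      then have "comp_end x \<in> ends G <+> ends F" using comp_end_image[OF n] by blast
      then have "?e (comp_end x) \<in> ?E" using G F by (auto simp: is_graph_edge_of)
      then show "end_vec (d (comp_end x)) ((\<lambda>c\<in>?E // ?R. l (SOME e. e \<in> c)) (edge_of ?C x)) =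
          end_vec (d (comp_end x)) (l (?e (comp_end x)))"
        using cls some by (simp add: edge_of_graph_comp)
    qed
  next
    fix m assume "m \<in> edges ?C \<rightarrow>\<^sub>E Basis"
    then have m: "m \<in> ?E // ?R \<rightarrow>\<^sub>E Basis" by simp
    have cls: "?R `` {e} \<in> ?E // ?R" if "e \<in> ?E" for e using that by (rule quotientI)
    have mem: "Inl (edge_of G (In i)) \<in> ?E" "Inr (edge_of F (Out i)) \<in> ?E" if "i < n_in G" for i
      using that n by (auto intro: is_graph_edge_of G F)
    let ?l = "\<lambda>e\<in>?E. m (?R `` {e})"
    have "compat ?l"
      unfolding compat_def
    proof (intro allI impI)
      fix i assume i: "i < n_in G"
      have "?R `` {Inl (edge_of G (In i))} = ?R `` {Inr (edge_of F (Out i))}"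
        using glue_rel_glue[OF i] by (simp only: glue_class_eq_iff)
      then show "?l (Inl (edge_of G (In i))) = ?l (Inr (edge_of F (Out i)))"
        by (simp only: restrict_apply mem[OF i] if_True)
    qed
    moreover have "?l \<in> ?E \<rightarrow>\<^sub>E Basis" using m cls by auto
    ultimately show "?l \<in> {l \<in> ?E \<rightarrow>\<^sub>E Basis. compat l}" by simp
    have "m c = (\<lambda>c\<in>?E // ?R. ?l (SOME e. e \<in> c)) c" for c
    proof (cases "c \<in> ?E // ?R")
      case True
      then obtain e where e: "e \<in> ?E" "c = ?R `` {e}" by (rule quotientE)
      have r: "(e, SOME e'. e' \<in> ?R `` {e}) \<in> ?R" by (rule glue_class_some)
      have "\<not> (e \<in> ?E \<longleftrightarrow> e' \<notin> ?E)" if "(e, e') \<in> ?R" for e e'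
        using glue_rel_invariant[of e e' G F "\<lambda>e. e \<in> ?E"] mem that by auto
      with r e(1) have "(SOME e'. e' \<in> ?R `` {e}) \<in> ?E" by blast
      then show ?thesis using True r unfolding e(2) by (simp flip: glue_class_eq_iff)
    next
      case False
      then show ?thesis using m by (auto simp: PiE_def extensional_def)
    qed
    then show "(\<lambda>c\<in>?E // ?R. ?l (SOME e. e \<in> c)) = m" by auto
  qed
  also have "\<dots> = graph_eval ?C f xs"
    by (rule graph_eval_eq[symmetric]) (use C dC f in auto)
  finally show ?thesis by simp
qed

end

section \<open>Generating graphs\<close>

lemma ends_identity: "ends (identity_graph p) = In ` {..<p} \<union> Out ` {..<p}"
  by (auto simp: ends_def identity_graph_def)

lemma ends_crossing: "ends crossing_graph = {In 0, In 1, Out 0, Out 1}"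
  by (auto simp: ends_def crossing_graph_def lessThan_Suc numeral_2_eq_2)

lemma ends_coupling: "ends coupling_graph = {In 0, In 1}"
  by (auto simp: ends_def coupling_graph_def lessThan_Suc numeral_2_eq_2)

lemma ends_star: "ends (star_graph r) = Half ` {..<r} \<union> In ` {..<r}"
  by (auto simp: ends_def star_graph_def)

lemma identity_graph_simps [simp]:
  "verts (identity_graph p) = {}" "halves (identity_graph p) = {}" "edges (identity_graph p) = {..<p}"
  "n_in (identity_graph p) = p" "n_out (identity_graph p) = p"
  "edge_of (identity_graph p) (In i) = i" "edge_of (identity_graph p) (Out i) = i"
  by (simp_all add: identity_graph_def)

lemma crossing_graph_simps [simp]:
  "verts crossing_graph = {}" "halves crossing_graph = {}" "edges crossing_graph = {0, 1}"
  "n_in crossing_graph = 2" "n_out crossing_graph = 2"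
  "edge_of crossing_graph (In i) = i" "edge_of crossing_graph (Out i) = 1 - i"
  by (simp_all add: crossing_graph_def)

lemma coupling_graph_simps [simp]:
  "verts coupling_graph = {}" "halves coupling_graph = {}" "edges coupling_graph = {0}"
  "n_in coupling_graph = 2" "n_out coupling_graph = 0" "edge_of coupling_graph x = 0"
  by (simp_all add: coupling_graph_def)

lemma star_graph_simps [simp]:
  "verts (star_graph r) = {0}" "halves (star_graph r) = {..<r}" "edges (star_graph r) = {..<r}"
  "n_in (star_graph r) = r" "n_out (star_graph r) = 0" "vtx (star_graph r) h = 0"
  "edge_of (star_graph r) (Half h) = h" "edge_of (star_graph r) (In h) = h"
  by (simp_all add: star_graph_def)

lemma is_graph_identity: "is_graph (identity_graph p)"
proof (rule is_graphI_partner)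
  fix x assume "x \<in> ends (identity_graph p)"
  then show "\<exists>y\<in>ends (identity_graph p). y \<noteq> x \<and> edge_of (identity_graph p) y = edge_of (identity_graph p) x \<and>
      (\<forall>z\<in>ends (identity_graph p). edge_of (identity_graph p) z = edge_of (identity_graph p) x \<longrightarrow> z = x \<or> z = y)"
    unfolding ends_identity by auto
qed (auto simp: ends_identity)

lemma is_graph_crossing: "is_graph crossing_graph"
proof (rule is_graphI_partner)
  fix x assume "x \<in> ends crossing_graph"
  then consider "x = In 0" | "x = In 1" | "x = Out 0" | "x = Out 1" unfolding ends_crossing by blast
  then show "\<exists>y\<in>ends crossing_graph. y \<noteq> x \<and> edge_of crossing_graph y = edge_of crossing_graph x \<and>
      (\<forall>z\<in>ends crossing_graph. edge_of crossing_graph z = edge_of crossing_graph x \<longrightarrow> z = x \<or> z = y)"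
    by cases (simp_all add: ends_crossing)
qed (simp_all add: ends_crossing)

lemma is_graph_coupling: "is_graph coupling_graph"
  by (rule is_graphI_partner) (simp_all add: ends_coupling, blast)

lemma is_graph_star:
  assumes "r \<ge> 1"
  shows "is_graph (star_graph r)"
proof (rule is_graphI_partner)
  fix x assume "x \<in> ends (star_graph r)"
  then show "\<exists>y\<in>ends (star_graph r). y \<noteq> x \<and> edge_of (star_graph r) y = edge_of (star_graph r) x \<and>
      (\<forall>z\<in>ends (star_graph r). edge_of (star_graph r) z = edge_of (star_graph r) x \<longrightarrow> z = x \<or> z = y)"
    unfolding ends_star by auto
qed (use assms in \<open>auto simp: ends_star image_constant_conv lessThan_empty_iff\<close>)

context symmetric_algebra
begin

text \<open>The edges are directed from the inputs, so that the state sum is the expansion of the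
  arguments in the basis. The same choice serves the crossing and the stars.\<close>

lemma graph_eval_identity:
  assumes f: "mlin p f" and xs: "length xs = p"
  shows "graph_eval (identity_graph p) f xs = f xs"
proof -
  define d :: "nat edge_end \<Rightarrow> bool" where "d x = (case x of In _ \<Rightarrow> False | _ \<Rightarrow> True)" for x
  have "oriented (identity_graph p) d"
    unfolding oriented_def ends_identity by (auto simp: d_def)
  then have "graph_eval (identity_graph p) f xs = state_sum (identity_graph p) d f xs"
    by (intro graph_eval_eq is_graph_identity) (simp_all add: f)
  also have "\<dots> = (\<Sum>l\<in>{..<p} \<rightarrow>\<^sub>E Basis. (\<Prod>i<p. pairing (xs ! i) (dual (l i))) * f (map l [0..<p]))"
    unfolding state_sum_def graph_form_def by (simp add: d_def end_vec_def)
  also have "\<dots> = f xs" by (rule multilinear_expansion[OF f xs])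
  finally show ?thesis .
qed

lemma graph_eval_crossing:
  assumes f: "mlin 2 f"
  shows "graph_eval crossing_graph f [x, y] = f [y, x]"
proof -
  define d :: "nat edge_end \<Rightarrow> bool" where "d x = (case x of In _ \<Rightarrow> False | _ \<Rightarrow> True)" for x
  have "oriented crossing_graph d"
    unfolding oriented_def ends_crossing by (auto simp: d_def)
  then have "graph_eval crossing_graph f [x, y] = state_sum crossing_graph d f [x, y]"
    by (intro graph_eval_eq is_graph_crossing) (simp_all add: f)
  also have "\<dots> = (\<Sum>l\<in>{..<2} \<rightarrow>\<^sub>E Basis. (\<Prod>i<2. pairing ([x, y] ! i) (dual (l i))) *
      (\<lambda>zs. f [zs ! 1, zs ! 0]) (map l [0..<2]))"
    unfolding state_sum_def graph_form_def
    by (simp add: d_def end_vec_def lessThan_Suc numeral_2_eq_2 insert_commute)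
  also have "\<dots> = (\<lambda>zs. f [zs ! 1, zs ! 0]) [x, y]"
  proof (rule multilinear_expansion)
    show "mlin 2 (\<lambda>zs. f [zs ! 1, zs ! 0])"
      unfolding multilinear_def
    proof (intro allI impI)
      fix zs :: "'v list" and i :: nat assume "length zs = 2" "i < 2"
      then show "lin (\<lambda>u. f [zs[i := u] ! 1, zs[i := u] ! 0])"
        using multilinearD[OF f, of "[zs ! 1, zs ! 0]" "1 - i"]
        by (cases i) (auto simp: nth_list_update)
    qed
  qed simp
  finally show ?thesis by simp
qed

lemma graph_eval_coupling: "graph_eval coupling_graph f [x, y] = pairing x y * f []"
proof -
  define d :: "nat edge_end \<Rightarrow> bool" where "d x \<longleftrightarrow> x = In 1" for x
  have "oriented coupling_graph d"
    unfolding oriented_def ends_coupling by (auto simp: d_def)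
  then have "graph_eval coupling_graph f [x, y] = state_sum coupling_graph d f [x, y]"
    by (intro graph_eval_eq is_graph_coupling) (simp_all add: multilinear_0)
  also have "\<dots> = (\<Sum>l\<in>insert (0::nat) {} \<rightarrow>\<^sub>E Basis. pairing x (dual (l 0)) * (pairing y (l 0) * f []))"
    unfolding state_sum_def graph_form_def
    by (simp add: d_def end_vec_def lessThan_Suc numeral_2_eq_2 mult_ac)
  also have "\<dots> = (\<Sum>k\<in>Basis. pairing x (dual k) * (pairing y k * f []))"
    by (subst sum_PiE_insert) (simp_all add: PiE_empty_domain)
  also have "\<dots> = pairing y x * f []"
    by (rule lin_expansion[symmetric]) (intro lin_mult lin_pairing)
  finally show ?thesis by (simp add: pairing_sym)
qed

lemma graph_eval_star:
  assumes r: "r \<ge> 1" and xs: "length xs = r"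
  shows "graph_eval (star_graph r) f xs = S r (pure xs) * f []"
proof -
  define d :: "nat edge_end \<Rightarrow> bool" where "d x = (case x of In _ \<Rightarrow> False | _ \<Rightarrow> True)" for x
  have "oriented (star_graph r) d"
    unfolding oriented_def ends_star by (auto simp: d_def)
  then have "graph_eval (star_graph r) f xs = state_sum (star_graph r) d f xs"
    by (intro graph_eval_eq is_graph_star r) (simp_all add: multilinear_0)
  also have "\<dots> = (\<Sum>l\<in>{..<r} \<rightarrow>\<^sub>E Basis. (\<Prod>i<r. pairing (xs ! i) (dual (l i))) *
      S r (pure (map l [0..<r]))) * f []"
  proof -
    have "vertex_weight (halves_at (star_graph r) 0) l = S r (pure (map l [0..<r]))" for l
    proof -
      have "halves_at (star_graph r) 0 = set [0..<r]" by (auto simp: halves_at_def)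
      then show ?thesis using vertex_weight_eq[of "[0..<r]" l] r by simp
    qed
    then show ?thesis
      unfolding state_sum_def graph_form_def sum_distrib_right
      by (intro sum.cong) (simp_all add: d_def end_vec_def mult_ac)
  qed
  also have "\<dots> = S r (pure xs) * f []"
    by (subst multilinear_expansion[OF S_multilinear[OF r] xs]) (rule refl)
  finally show ?thesis .
qed

end

section \<open>Linear combinations of graphs\<close>

lemma graph_prop_iff: "X \<in> graph_prop p q \<longleftrightarrow> (\<forall>A. A \<notin> graph_classes p q \<longrightarrow> Poly_Mapping.lookup X A = 0)"
  by (auto simp: graph_prop_def in_keys_iff)

lemma graph_prop_add: "X \<in> graph_prop p q \<Longrightarrow> Y \<in> graph_prop p q \<Longrightarrow> X + Y \<in> graph_prop p q"
  by (simp add: graph_prop_iff lookup_add)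

lemma graph_prop_sum: "(\<And>a. a \<in> A \<Longrightarrow> W a \<in> graph_prop p q) \<Longrightarrow> (\<Sum>a\<in>A. W a) \<in> graph_prop p q"
  by (induction A rule: infinite_finite_induct) (auto simp: graph_prop_iff lookup_add)

lemma graph_prop_single: "A \<in> graph_classes p q \<Longrightarrow> Poly_Mapping.single A c \<in> graph_prop p q"
  by (auto simp: graph_prop_iff lookup_single when_def)

lemma lookup_gscale: "Poly_Mapping.lookup (gscale c X) A = c * Poly_Mapping.lookup X A"
  by (simp add: gscale_def Poly_Mapping.map.rep_eq when_def)

lemma graph_prop_gscale: "X \<in> graph_prop p q \<Longrightarrow> gscale c X \<in> graph_prop p q"
  by (simp add: graph_prop_iff lookup_gscale)

lemma graph_elem_in_prop: "is_graph G \<Longrightarrow> graph_elem G \<in> graph_prop (n_in G) (n_out G)"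
  unfolding graph_elem_def by (intro graph_prop_single iso_class_in_graph_classes)

lemma graph_classesE:
  assumes "A \<in> graph_classes p q"
  obtains G :: nat_graph where "A = iso_class G" "is_graph G" "n_in G = p" "n_out G = q"
  using assms unfolding graph_classes_def by blast

lemma class_comp_in_graph_classes:
  assumes "A \<in> graph_classes q r" "B \<in> graph_classes p q"
  shows "class_comp A B \<in> graph_classes p r"
proof -
  obtain G F :: nat_graph where G: "A = iso_class G" "is_graph G" "n_in G = q" "n_out G = r"
    and F: "B = iso_class F" "is_graph F" "n_in F = p" "n_out F = q"
    using assms by (metis graph_classesE)
  have "is_graph (graph_comp G F)"
    using graph_comp_orientation[OF G(2) F(2)] G(3) F(4) by metis
  from iso_class_in_graph_classes[OF this] show ?thesis
    using G F class_comp_iso_class[OF G(2) F(2)] by simp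
qed

lemma class_juxt_in_graph_classes:
  assumes "A \<in> graph_classes p q" "B \<in> graph_classes p' q'"
  shows "class_juxt A B \<in> graph_classes (p + p') (q + q')"
proof -
  obtain G F :: nat_graph where G: "A = iso_class G" "is_graph G" "n_in G = p" "n_out G = q"
    and F: "B = iso_class F" "is_graph F" "n_in F = p'" "n_out F = q'"
    using assms by (metis graph_classesE)
  from iso_class_in_graph_classes[OF is_graph_juxt[OF G(2) F(2)]] show ?thesis
    using G F class_juxt_iso_class[OF G(2) F(2)] by simp
qed

lemma bilinear_ext_in_prop:
  assumes "X \<in> graph_prop p q" "Y \<in> graph_prop p' q'"
    and "\<And>A B. A \<in> graph_classes p q \<Longrightarrow> B \<in> graph_classes p' q' \<Longrightarrow> op A B \<in> graph_classes p'' q''"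
  shows "bilinear_ext op X Y \<in> graph_prop p'' q''"
  unfolding bilinear_ext_def
  using assms by (intro graph_prop_sum graph_prop_single) (auto simp: graph_prop_def)

lemma prop_comp_in_prop: "X \<in> graph_prop q r \<Longrightarrow> Y \<in> graph_prop p q \<Longrightarrow> prop_comp X Y \<in> graph_prop p r"
  unfolding prop_comp_def by (rule bilinear_ext_in_prop) (auto intro: class_comp_in_graph_classes)

lemma prop_tensor_in_prop:
  "X \<in> graph_prop p q \<Longrightarrow> Y \<in> graph_prop p' q' \<Longrightarrow> prop_tensor X Y \<in> graph_prop (p + p') (q + q')"
  unfolding prop_tensor_def by (rule bilinear_ext_in_prop) (auto intro: class_juxt_in_graph_classes)

lemma prop_comp_graph_elem:
  "is_graph G \<Longrightarrow> is_graph F \<Longrightarrow> n_in G = n_out F \<Longrightarrow>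
    prop_comp (graph_elem G) (graph_elem F) = (graph_elem (graph_comp G F) :: 'k::field graph_comb)"
  by (simp add: prop_comp_def bilinear_ext_def graph_elem_def class_comp_iso_class)

lemma prop_tensor_graph_elem:
  "is_graph G \<Longrightarrow> is_graph F \<Longrightarrow>
    prop_tensor (graph_elem G) (graph_elem F) = (graph_elem (graph_juxt G F) :: 'k::field graph_comb)"
  by (simp add: prop_tensor_def bilinear_ext_def graph_elem_def class_juxt_iso_class)

text \<open>Brings the sums for two elements and for their sum to a common range.\<close>

lemma sum_keys_superset:
  fixes X :: "'k::field graph_comb"
  assumes "finite T" "Poly_Mapping.keys X \<subseteq> T"
  shows "(\<Sum>A\<in>Poly_Mapping.keys X. Poly_Mapping.lookup X A * g A) = (\<Sum>A\<in>T. Poly_Mapping.lookup X A * g A)"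
  by (rule sum.mono_neutral_left) (use assms in \<open>auto simp: in_keys_iff\<close>)

lemma sum_fun_apply: "(\<Sum>a\<in>A. g a) x = (\<Sum>a\<in>A. g a x)"
  for g :: "'a \<Rightarrow> 'b \<Rightarrow> 'c::comm_monoid_add"
  by (induction A rule: infinite_finite_induct) auto

section \<open>The action defined by a symmetric algebra structure\<close>

lemma tensor_mult_linear_on_left:
  "linear_on_set tscale tscale U (\<lambda>t. tensor_mult s m n t u)"
  unfolding linear_on_set_def by (auto simp: tensor_mult_linear_left)

lemma tensor_mult_linear_on_right:
  assumes "vector_space s" "t \<in> tensor_power s m"
  shows "linear_on_set tscale tscale (tensor_power s n) (tensor_mult s m n t)"
  unfolding linear_on_set_def using assms tensor_mult_linear_right by metis

lemma tensor_mult_in_tensor_power: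
  assumes s: "vector_space s" and t: "t \<in> tensor_power s m" and u: "u \<in> tensor_power s n"
  shows "tensor_mult s m n t u \<in> tensor_power s (m + n)"
  using t
proof (induction rule: tensor_power_induct)
  case zero
  have "tensor_mult s m n 0 u = 0"
    by (rule linear_on_set_zero[OF vector_space_tscale tensor_mult_linear_on_left])
  then show ?case using tensor_power_zero by metis
next
  case (step c xs t)
  have "tensor_mult s m n (pure_tensor s xs) u \<in> tensor_power s (m + n)"
    using u
  proof (induction rule: tensor_power_induct)
    case zero
    have "tensor_mult s m n (pure_tensor s xs) 0 = 0"
      by (rule linear_on_set_zero[OF vector_space_tscale tensor_mult_linear_on_right[OF s]])
        (rule pure_in_tensor_power[OF step(1)])
    then show ?case using tensor_power_zero by metis
  next
    case (step d ys u)
    have "tensor_mult s m n (pure_tensor s xs) (tscale d (pure_tensor s ys) + u) =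
        tscale d (pure_tensor s (xs @ ys)) + tensor_mult s m n (pure_tensor s xs) u"
      using tensor_mult_linear_right[OF s pure_in_tensor_power[OF \<open>length xs = m\<close>]]
        tensor_power_scale[OF pure_in_tensor_power[OF step(1)]] pure_in_tensor_power[OF step(1)] step(2)
        tensor_mult_pure[of s xs ys] step(1) \<open>length xs = m\<close> by metis
    moreover have "pure_tensor s (xs @ ys) \<in> tensor_power s (m + n)"
      using step(1) \<open>length xs = m\<close> by (simp add: pure_in_tensor_power)
    ultimately show ?case using step.IH by (metis tensor_power_add tensor_power_scale)
  qed
  then show ?case
    unfolding tensor_mult_linear_left using step.IH by (intro tensor_power_add tensor_power_scale)
qed

lemma linear_on_set_compose:
  "linear_on_set s s' U L \<Longrightarrow> (\<And>x. x \<in> U \<Longrightarrow> L x \<in> W) \<Longrightarrow> linear_on_set s' s'' W M \<Longrightarrow>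
    linear_on_set s s'' U (\<lambda>x. M (L x))"
  by (simp add: linear_on_set_def)

lemma linear_on_set_sum:
  assumes "vector_space s'" and L: "linear_on_set tscale s' (tensor_power s n) L"
    and "\<And>a. a \<in> A \<Longrightarrow> g a \<in> tensor_power s n"
  shows "L (\<Sum>a\<in>A. tscale (c a) (g a)) = (\<Sum>a\<in>A. s' (c a) (L (g a)))"
  using assms(3)
proof (induction A rule: infinite_finite_induct)
  case (insert a A)
  have mem: "(\<Sum>a\<in>A. tscale (c a) (g a)) \<in> tensor_power s n" "g a \<in> tensor_power s n"
    using insert by (auto intro: tensor_power_sum tensor_power_scale)
  have "L (tscale (c a) (g a) + (\<Sum>a\<in>A. tscale (c a) (g a))) =
      L (tscale (c a) (g a)) + L (\<Sum>a\<in>A. tscale (c a) (g a))"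
    using L mem(1) tensor_power_scale[OF mem(2)] unfolding linear_on_set_def by blast
  also have "L (tscale (c a) (g a)) = s' (c a) (L (g a))"
    using L mem(2) unfolding linear_on_set_def by blast
  also have "L (\<Sum>a\<in>A. tscale (c a) (g a)) = (\<Sum>a\<in>A. s' (c a) (L (g a)))"
    using insert by blast
  finally show ?case unfolding sum.insert[OF insert.hyps] .
qed (simp_all only: sum.infinite sum.empty linear_on_set_zero[OF assms(1,2)] not_False_eq_True)

context symmetric_algebra
begin

text \<open>A tensor is a functional on multilinear functions, so the linear map given by a graph
  may be defined as the transpose of \<open>graph_eval\<close>. Composition of graphs then becomes
  composition of functions.\<close>

definition graph_map :: "('a, 'h, 'e) pregraph \<Rightarrow> ('v, 'k) tensor \<Rightarrow> ('v, 'k) tensor" where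
  "graph_map G t = (\<lambda>f. if mlin (n_out G) f then t (graph_eval G f) else 0)"

lemma graph_map_add: "graph_map G (t + u) = graph_map G t + graph_map G u"
  and graph_map_scale: "graph_map G (tscale c t) = tscale c (graph_map G t)"
  by (auto simp: graph_map_def tscale_def fun_eq_iff)

lemma graph_map_linear: "linear_on_set tscale tscale U (graph_map G)"
  by (simp only: linear_on_set_def graph_map_add graph_map_scale) simp

lemma graph_map_pure:
  assumes "length xs = n_in G" "mlin (n_out G) f"
  shows "graph_map G (pure xs) f = graph_eval G f xs"
  using assms graph_eval_multilinear[of G f] by (simp add: graph_map_def pure_tensor_def)

text \<open>On a pure tensor the state sum, read without the test function, is a linear
  combination of pure tensors formed by the vectors at the outputs.\<close>

lemma graph_map_in_tensor_power:
  assumes "t \<in> tpow (n_in G)"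
  shows "graph_map G t \<in> tpow (n_out G)"
  using assms
proof (induction rule: tensor_power_induct)
  case zero
  have "graph_map G 0 = 0"
    by (rule linear_on_set_zero[OF vector_space_tscale graph_map_linear])
  then show ?case using tensor_power_zero by metis
next
  case (step c xs t)
  define \<epsilon> where "\<epsilon> l x = end_vec ((SOME d. oriented G d) x) (l (edge_of G x))" for l x
  define w where "w l = (\<Prod>v\<in>verts G. vertex_weight (halves_at G v) (\<lambda>h. \<epsilon> l (Half h))) *
     (\<Prod>i<n_in G. pairing (xs ! i) (\<epsilon> l (In i)))" for l
  have "graph_map G (pure xs) = (\<Sum>l\<in>edges G \<rightarrow>\<^sub>E Basis.
      tscale (w l) (pure (map (\<lambda>j. \<epsilon> l (Out j)) [0..<n_out G])))" (is "_ = ?rhs")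
  proof
    fix f
    show "graph_map G (pure xs) f = ?rhs f"
    proof (cases "mlin (n_out G) f")
      case True
      then show ?thesis
        unfolding graph_map_pure[OF step(1) True] sum_fun_apply graph_eval_def state_sum_def graph_form_def
        by (intro sum.cong refl) (simp add: tscale_def pure_tensor_def w_def \<epsilon>_def)
    next
      case False
      then show ?thesis
        unfolding sum_fun_apply by (simp add: graph_map_def tscale_def pure_tensor_def)
    qed
  qed
  moreover have "?rhs \<in> tpow (n_out G)"
    by (intro tensor_power_sum tensor_power_scale pure_in_tensor_power) simp
  ultimately have "graph_map G (pure xs) \<in> tpow (n_out G)" by simp
  then show ?case
    unfolding graph_map_add graph_map_scale using step.IH by (intro tensor_power_add tensor_power_scale)
qed

lemma graph_map_iso:
  assumes "graph_iso G H" "is_graph G" "is_graph H"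
  shows "graph_map G t = graph_map H t"
proof
  fix f
  have "n_out G = n_out H" using assms(1) by (simp add: graph_iso_def)
  moreover have "graph_eval G f = graph_eval H f" if "mlin (n_out H) f"
    using graph_eval_iso[OF assms that] by blast
  ultimately show "graph_map G t f = graph_map H t f" by (simp add: graph_map_def)
qed

lemma graph_map_comp:
  assumes "is_graph G" "is_graph F" "n_in G = n_out F"
  shows "graph_map (graph_comp G F) t = graph_map G (graph_map F t)"
proof
  fix f
  have "graph_eval (graph_comp G F) f = graph_eval F (graph_eval G f)"
    if "mlin (n_out G) f" using graph_eval_comp[OF assms that] by blast
  moreover have "mlin (n_out F) (graph_eval G f)"
    using graph_eval_multilinear[of G f] assms(3) by simp
  ultimately show "graph_map (graph_comp G F) t f = graph_map G (graph_map F t) f"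
    by (simp add: graph_map_def)
qed

text \<open>Both sides are bilinear, which reduces the claim to pure tensors, where it is
  \<open>graph_eval_juxt\<close>.\<close>

lemma graph_map_juxt:
  assumes G: "is_graph G" and F: "is_graph F" and t: "t \<in> tpow (n_in G)" and u: "u \<in> tpow (n_in F)"
  shows "graph_map (graph_juxt G F) (tensor_mult scale (n_in G) (n_in F) t u) =
    tensor_mult scale (n_out G) (n_out F) (graph_map G t) (graph_map F u)"
proof (rule linear_on_tensor_power_eqI[OF vector_space_tscale _ _ _ t])
  show "linear_on_set tscale tscale (tpow (n_in G))
      (\<lambda>t. graph_map (graph_juxt G F) (tensor_mult scale (n_in G) (n_in F) t u))"
    "linear_on_set tscale tscale (tpow (n_in G))
      (\<lambda>t. tensor_mult scale (n_out G) (n_out F) (graph_map G t) (graph_map F u))"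
    unfolding linear_on_set_def by (simp_all only: graph_map_add graph_map_scale tensor_mult_linear_left) simp_all
  fix xs :: "'v list" assume xs: "length xs = n_in G"
  then have pxs: "pure xs \<in> tpow (n_in G)" by (rule pure_in_tensor_power)
  show "graph_map (graph_juxt G F) (tensor_mult scale (n_in G) (n_in F) (pure xs) u) =
    tensor_mult scale (n_out G) (n_out F) (graph_map G (pure xs)) (graph_map F u)"
  proof (rule linear_on_tensor_power_eqI[OF vector_space_tscale _ _ _ u])
    show "linear_on_set tscale tscale (tpow (n_in F))
        (\<lambda>u. graph_map (graph_juxt G F) (tensor_mult scale (n_in G) (n_in F) (pure xs) u))"
      by (rule linear_on_set_compose[OF tensor_mult_linear_on_right[OF vector_space_axioms pxs] UNIV_I
            graph_map_linear])
    show "linear_on_set tscale tscale (tpow (n_in F))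
        (\<lambda>u. tensor_mult scale (n_out G) (n_out F) (graph_map G (pure xs)) (graph_map F u))"
      by (rule linear_on_set_compose[OF graph_map_linear graph_map_in_tensor_power
            tensor_mult_linear_on_right[OF vector_space_axioms graph_map_in_tensor_power[OF pxs]]])
    fix ys :: "'v list" assume ys: "length ys = n_in F"
    show "graph_map (graph_juxt G F)
          (tensor_mult scale (n_in G) (n_in F) (pure xs) (pure ys)) =
        tensor_mult scale (n_out G) (n_out F) (graph_map G (pure xs)) (graph_map F (pure ys))"
    proof
      fix f
      have mult: "tensor_mult scale (n_in G) (n_in F) (pure xs) (pure ys) =
          pure (xs @ ys)"
        using tensor_mult_pure[of scale xs ys] xs ys by simp
      show "graph_map (graph_juxt G F)
            (tensor_mult scale (n_in G) (n_in F) (pure xs) (pure ys)) f =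
          tensor_mult scale (n_out G) (n_out F) (graph_map G (pure xs)) (graph_map F (pure ys)) f"
      proof (cases "mlin (n_out G + n_out F) f")
        case f: True
        let ?h = "\<lambda>us. graph_eval F (\<lambda>vs. f (us @ vs)) ys"
        have h: "graph_map F (pure ys) (\<lambda>vs. f (us @ vs)) = ?h us" if "length us = n_out G" for us
          using graph_map_pure[OF ys multilinear_append_right[OF f that]] .
        have ml: "mlin (n_out G) ?h"
          by (rule graph_eval_juxt_multilinear[OF f])
        have "graph_map (graph_juxt G F) (pure (xs @ ys)) f = graph_eval G ?h xs"
          using graph_eval_juxt[OF G F xs f, of ys] graph_map_pure[of "xs @ ys" "graph_juxt G F" f] f xs ys by simp
        also have "\<dots> = graph_map G (pure xs) ?h" using graph_map_pure[OF xs ml] by simp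
        also have "\<dots> = graph_map G (pure xs)
            (\<lambda>us. graph_map F (pure ys) (\<lambda>vs. f (us @ vs)))"
          by (rule tensor_power_cong[OF vector_space_axioms graph_map_in_tensor_power[OF pxs] ml h, symmetric])
        finally show ?thesis using f unfolding mult by (simp add: tensor_mult_def)
      next
        case False
        then show ?thesis by (simp add: graph_map_def tensor_mult_def)
      qed
    qed
  qed
qed

text \<open>Any representative may be chosen, by \<open>graph_map_iso\<close>.\<close>

definition class_map :: "graph_class \<Rightarrow> ('v, 'k) tensor \<Rightarrow> ('v, 'k) tensor" where
  "class_map A = graph_map (SOME N. N \<in> A)"

lemma class_map_iso_class:
  fixes G :: "('a, 'h, 'e) pregraph"
  assumes G: "is_graph G"
  shows "class_map (iso_class G) t = graph_map G t"
proof -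
  have "\<exists>N. N \<in> iso_class G" using ex_nat_graph[OF G] by (auto simp: iso_class_def)
  then have "(SOME N. N \<in> iso_class G) \<in> iso_class G" by (rule someI_ex)
  then have "is_graph (SOME N. N \<in> iso_class G)" "graph_iso (SOME N. N \<in> iso_class G) G"
    by (simp_all add: iso_class_def)
  then show ?thesis unfolding class_map_def by (intro graph_map_iso G)
qed

lemma class_map_in_tensor_power:
  assumes "A \<in> graph_classes p q" "t \<in> tpow p"
  shows "class_map A t \<in> tpow q"
proof -
  obtain G :: nat_graph where "A = iso_class G" "is_graph G" "n_in G = p" "n_out G = q"
    using assms(1) by (rule graph_classesE)
  then show ?thesis using graph_map_in_tensor_power[of t G] assms(2) by (simp add: class_map_iso_class)
qed

lemma class_map_linear: "linear_on_set tscale tscale U (class_map A)"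
  unfolding class_map_def by (rule graph_map_linear)

lemma class_map_comp:
  assumes "A \<in> graph_classes q r" "B \<in> graph_classes p q"
  shows "class_map (class_comp A B) t = class_map A (class_map B t)"
proof -
  obtain G :: nat_graph where G: "A = iso_class G" "is_graph G" "n_in G = q" "n_out G = r"
    using assms(1) by (rule graph_classesE)
  obtain F :: nat_graph where F: "B = iso_class F" "is_graph F" "n_in F = p" "n_out F = q"
    using assms(2) by (rule graph_classesE)
  have n: "n_in G = n_out F" using G F by simp
  have "is_graph (graph_comp G F)"
    using graph_comp_orientation[OF G(2) F(2) n] by metis
  then show ?thesis
    using G F graph_map_comp[OF G(2) F(2) n] class_comp_iso_class[OF G(2) F(2) n]
    by (simp add: class_map_iso_class)
qed

lemma class_map_juxt:
  assumes "A \<in> graph_classes p q" "B \<in> graph_classes p' q'" "t \<in> tpow p" "u \<in> tpow p'"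
  shows "class_map (class_juxt A B) (tensor_mult scale p p' t u) =
    tensor_mult scale q q' (class_map A t) (class_map B u)"
proof -
  obtain G :: nat_graph where G: "A = iso_class G" "is_graph G" "n_in G = p" "n_out G = q"
    using assms(1) by (rule graph_classesE)
  obtain F :: nat_graph where F: "B = iso_class F" "is_graph F" "n_in F = p'" "n_out F = q'"
    using assms(2) by (rule graph_classesE)
  show ?thesis
    using G F graph_map_juxt[OF G(2) F(2)] class_juxt_iso_class[OF G(2) F(2)] is_graph_juxt[OF G(2) F(2)] assms(3,4)
    by (simp add: class_map_iso_class)
qed

definition prop_map :: "'k graph_comb \<Rightarrow> ('v, 'k) tensor \<Rightarrow> ('v, 'k) tensor" where
  "prop_map X t = (\<Sum>A\<in>Poly_Mapping.keys X. tscale (Poly_Mapping.lookup X A) (class_map A t))"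

lemma prop_map_apply:
  "prop_map X t f = (\<Sum>A\<in>Poly_Mapping.keys X. Poly_Mapping.lookup X A * class_map A t f)"
  unfolding prop_map_def sum_fun_apply by (simp add: tscale_def)

lemma prop_map_add: "prop_map (X + Y) t = prop_map X t + prop_map Y t"
proof
  fix f
  let ?T = "Poly_Mapping.keys X \<union> Poly_Mapping.keys Y"
  have "prop_map W t f = (\<Sum>A\<in>?T. Poly_Mapping.lookup W A * class_map A t f)"
    if "Poly_Mapping.keys W \<subseteq> ?T" for W
    unfolding prop_map_apply by (rule sum_keys_superset) (use that in auto)
  then show "prop_map (X + Y) t f = (prop_map X t + prop_map Y t) f"
    using keys_add[of X Y] by (simp add: lookup_add distrib_right sum.distrib)
qed

lemma prop_map_gscale: "prop_map (gscale c X) t = tscale c (prop_map X t)"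
proof
  fix f
  have "Poly_Mapping.keys (gscale c X) \<subseteq> Poly_Mapping.keys X"
    by (auto simp: in_keys_iff lookup_gscale)
  then have "prop_map (gscale c X) t f = (\<Sum>A\<in>Poly_Mapping.keys X. Poly_Mapping.lookup (gscale c X) A * class_map A t f)"
    unfolding prop_map_apply by (intro sum_keys_superset) auto
  then show "prop_map (gscale c X) t f = tscale c (prop_map X t) f"
    by (simp add: lookup_gscale tscale_def prop_map_apply sum_distrib_left mult.assoc)
qed

lemma prop_map_sum: "prop_map (\<Sum>a\<in>A. W a) t = (\<Sum>a\<in>A. prop_map (W a) t)"
proof (induction A rule: infinite_finite_induct)
  case (insert a A)
  then show ?case unfolding sum.insert[OF insert.hyps] prop_map_add by (simp only:)
qed (simp_all add: prop_map_def)

lemma prop_map_single: "prop_map (Poly_Mapping.single A c) t = tscale c (class_map A t)"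
  by (cases "c = 0") (auto simp: prop_map_def tscale_def fun_eq_iff)

lemma prop_map_graph_elem: "is_graph G \<Longrightarrow> prop_map (graph_elem G) t = graph_map G t"
  by (simp add: graph_elem_def prop_map_single class_map_iso_class tscale_def)

lemma prop_map_bilinear_ext:
  "prop_map (bilinear_ext op X Y) t = (\<Sum>A\<in>Poly_Mapping.keys X. \<Sum>B\<in>Poly_Mapping.keys Y.
     tscale (Poly_Mapping.lookup X A * Poly_Mapping.lookup Y B) (class_map (op A B) t))"
  unfolding bilinear_ext_def prop_map_sum prop_map_single ..

lemma prop_map_in_tensor_power:
  "X \<in> graph_prop p q \<Longrightarrow> t \<in> tpow p \<Longrightarrow> prop_map X t \<in> tpow q"
  unfolding prop_map_def
  by (intro tensor_power_sum tensor_power_scale class_map_in_tensor_power) (auto simp: graph_prop_def)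

lemma prop_map_linear: "linear_on_set tscale tscale U (prop_map X)"
proof -
  have "class_map A (x + y) f = class_map A x f + class_map A y f"
    "class_map A (tscale c x) f = c * class_map A x f" for A c x y f
    unfolding class_map_def graph_map_add graph_map_scale by (simp_all add: tscale_def)
  then show ?thesis
    by (simp add: linear_on_set_def fun_eq_iff prop_map_apply tscale_def
        sum_distrib_left sum.distrib algebra_simps)
qed

lemma tscale_tscale: "tscale c (tscale c' t) = tscale (c * c') t" for t :: "('v, 'k) tensor"
  by (simp add: tscale_def fun_eq_iff)

lemma tscale_sum: "tscale a (\<Sum>x\<in>A. g x) = (\<Sum>x\<in>A. tscale a (g x))" for g :: "'a \<Rightarrow> ('v, 'k) tensor"
proof
  fix f
  show "tscale a (\<Sum>x\<in>A. g x) f = (\<Sum>x\<in>A. tscale a (g x)) f"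
    unfolding sum_fun_apply by (simp add: tscale_def sum_fun_apply sum_distrib_left)
qed

lemma prop_map_comp:
  assumes X: "X \<in> graph_prop q r" and Y: "Y \<in> graph_prop p q" and t: "t \<in> tpow p"
  shows "prop_map (prop_comp X Y) t = prop_map X (prop_map Y t)"
proof -
  have keys: "Poly_Mapping.keys X \<subseteq> graph_classes q r" "Poly_Mapping.keys Y \<subseteq> graph_classes p q"
    using X Y by (auto simp: graph_prop_def)
  have "class_map A (prop_map Y t) = (\<Sum>B\<in>Poly_Mapping.keys Y. tscale (Poly_Mapping.lookup Y B) (class_map (class_comp A B) t))"
    if "A \<in> Poly_Mapping.keys X" for A
  proof -
    have "class_map A (prop_map Y t) =
        (\<Sum>B\<in>Poly_Mapping.keys Y. tscale (Poly_Mapping.lookup Y B) (class_map A (class_map B t)))"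
      unfolding prop_map_def
      by (rule linear_on_set_sum[OF vector_space_tscale class_map_linear, where s = scale and n = q])
        (use keys t class_map_in_tensor_power in blast)
    also have "\<dots> = (\<Sum>B\<in>Poly_Mapping.keys Y. tscale (Poly_Mapping.lookup Y B) (class_map (class_comp A B) t))"
    proof (intro sum.cong refl)
      fix B assume "B \<in> Poly_Mapping.keys Y"
      then have "class_map (class_comp A B) t = class_map A (class_map B t)"
        using that keys by (intro class_map_comp) auto
      then show "tscale (Poly_Mapping.lookup Y B) (class_map A (class_map B t)) =
          tscale (Poly_Mapping.lookup Y B) (class_map (class_comp A B) t)" by simp
    qed
    finally show ?thesis .
  qed
  then show ?thesis
    unfolding prop_comp_def prop_map_bilinear_ext prop_map_def[of X]
    by (simp add: tscale_sum tscale_tscale)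
qed

lemma prop_map_tensor:
  assumes X: "X \<in> graph_prop p q" and Y: "Y \<in> graph_prop p' q'" and t: "t \<in> tpow p" and u: "u \<in> tpow p'"
  shows "prop_map (prop_tensor X Y) (tensor_mult scale p p' t u) =
    tensor_mult scale q q' (prop_map X t) (prop_map Y u)"
proof -
  have keys: "Poly_Mapping.keys X \<subseteq> graph_classes p q" "Poly_Mapping.keys Y \<subseteq> graph_classes p' q'"
    using X Y by (auto simp: graph_prop_def)
  have "tensor_mult scale q q' (prop_map X t) (prop_map Y u) =
      (\<Sum>A\<in>Poly_Mapping.keys X. tscale (Poly_Mapping.lookup X A) (tensor_mult scale q q' (class_map A t) (prop_map Y u)))"
    unfolding prop_map_def[of X]
    by (rule linear_on_set_sum[OF vector_space_tscale tensor_mult_linear_on_left, where s = scale and n = q])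
      (use keys t class_map_in_tensor_power in blast)
  also have "\<dots> = (\<Sum>A\<in>Poly_Mapping.keys X. tscale (Poly_Mapping.lookup X A) (\<Sum>B\<in>Poly_Mapping.keys Y.
      tscale (Poly_Mapping.lookup Y B) (class_map (class_juxt A B) (tensor_mult scale p p' t u))))"
  proof (intro sum.cong refl arg_cong[where f = "tscale _"])
    fix A assume A: "A \<in> Poly_Mapping.keys X"
    have "tensor_mult scale q q' (class_map A t) (prop_map Y u) =
        (\<Sum>B\<in>Poly_Mapping.keys Y. tscale (Poly_Mapping.lookup Y B) (tensor_mult scale q q' (class_map A t) (class_map B u)))"
      unfolding prop_map_def
      by (rule linear_on_set_sum[OF vector_space_tscale tensor_mult_linear_on_right[OF vector_space_axioms]])
        (use A keys t u class_map_in_tensor_power in blast)+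
    also have "\<dots> = (\<Sum>B\<in>Poly_Mapping.keys Y.
      tscale (Poly_Mapping.lookup Y B) (class_map (class_juxt A B) (tensor_mult scale p p' t u)))"
    proof (intro sum.cong refl arg_cong[where f = "tscale _"])
      fix B assume "B \<in> Poly_Mapping.keys Y"
      then show "tensor_mult scale q q' (class_map A t) (class_map B u) =
          class_map (class_juxt A B) (tensor_mult scale p p' t u)"
        using A keys t u by (intro class_map_juxt[symmetric]) auto
    qed
    finally show "tensor_mult scale q q' (class_map A t) (prop_map Y u) =
      (\<Sum>B\<in>Poly_Mapping.keys Y.
        tscale (Poly_Mapping.lookup Y B) (class_map (class_juxt A B) (tensor_mult scale p p' t u)))" .
  qed
  finally show ?thesis
    unfolding prop_tensor_def prop_map_bilinear_ext by (simp add: tscale_sum tscale_tscale)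
qed

definition action :: "nat \<Rightarrow> nat \<Rightarrow> 'k graph_comb \<Rightarrow> ('v, 'k) tensor \<Rightarrow> ('v, 'k) tensor" where
  "action p q = (\<lambda>X\<in>graph_prop p q. \<lambda>t\<in>tpow p. prop_map X t)"

lemma action_eq: "X \<in> graph_prop p q \<Longrightarrow> t \<in> tpow p \<Longrightarrow> action p q X t = prop_map X t"
  by (simp add: action_def)

lemma action_graph_elem:
  "is_graph G \<Longrightarrow> n_in G = p \<Longrightarrow> n_out G = q \<Longrightarrow> t \<in> tpow p \<Longrightarrow> action p q (graph_elem G) t = graph_map G t"
  using action_eq[OF graph_elem_in_prop, of G t] prop_map_graph_elem[of G t] by auto

lemma action_in_graph_actions: "action \<in> graph_actions scale"
  unfolding graph_actions_def
proof (intro CollectI conjI allI ballI)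
  fix p q
  show "action p q \<in> graph_prop p q \<rightarrow>\<^sub>E tensor_hom scale p q"
  proof (rule PiE_I)
    fix X :: "'k graph_comb" assume X: "X \<in> graph_prop p q"
    have "linear_on_set tscale tscale (tpow p) (\<lambda>t\<in>tpow p. prop_map X t)"
      using prop_map_linear[of "tpow p" X] tensor_power_add[of _ scale p] tensor_power_scale[of _ scale p]
      unfolding linear_on_set_def by simp
    then show "action p q X \<in> tensor_hom scale p q"
      using X prop_map_in_tensor_power[OF X] by (auto simp: action_def tensor_hom_def)
  qed (simp add: action_def)
  show "linear_on_set gscale tscale (graph_prop p q) (\<lambda>X. action p q X t)" if "t \<in> tpow p" for t
    using that unfolding linear_on_set_def
    by (auto simp: action_eq graph_prop_add graph_prop_gscale prop_map_add prop_map_gscale)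
next
  fix p q r and X Y :: "'k graph_comb" and t
  assume "X \<in> graph_prop q r" "Y \<in> graph_prop p q" "t \<in> tpow p"
  then show "action p r (prop_comp X Y) t = action q r X (action p q Y t)"
    using prop_comp_in_prop[of X q r Y p] prop_map_in_tensor_power[of Y p q t]
    by (simp add: action_eq prop_map_comp)
next
  fix p q p' q' and X Y :: "'k graph_comb" and t u
  assume "X \<in> graph_prop p q" "Y \<in> graph_prop p' q'" "t \<in> tpow p" "u \<in> tpow p'"
  then show "action (p + p') (q + q') (prop_tensor X Y) (tensor_mult scale p p' t u) =
      tensor_mult scale q q' (action p q X t) (action p' q' Y u)"
    using prop_tensor_in_prop[of X p q Y p' q'] tensor_mult_in_tensor_power[OF vector_space_axioms, of t p u p']
    by (simp add: action_eq prop_map_tensor)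
next
  fix p t assume t: "t \<in> tpow p"
  have "graph_map (identity_graph p) t = t"
  proof (rule linear_on_tensor_power_eqI[OF vector_space_tscale graph_map_linear, where M = "\<lambda>t. t", OF _ _ t])
    fix xs :: "'v list" assume "length xs = p"
    then show "graph_map (identity_graph p) (pure xs) = pure xs"
      using graph_map_pure[of xs "identity_graph p"]
      by (auto simp: fun_eq_iff graph_eval_identity graph_map_def pure_tensor_def)
  qed (simp add: linear_on_set_def)
  then show "action p p (graph_elem (identity_graph p)) t = t"
    using t by (simp add: action_graph_elem is_graph_identity)
next
  fix x y
  have "graph_map crossing_graph (pure [x, y]) = pure [y, x]"
  proof
    fix f show "graph_map crossing_graph (pure [x, y]) f = pure [y, x] f"
      using graph_map_pure[of "[x, y]" crossing_graph f] graph_eval_crossing[of f x y]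
      by (cases "mlin 2 f") (auto simp: graph_map_def pure_tensor_def numeral_2_eq_2)
  qed
  then show "action 2 2 (graph_elem crossing_graph) (pure [x, y]) = pure [y, x]"
    by (simp add: action_graph_elem is_graph_crossing pure_in_tensor_power)
qed

text \<open>For graphs without outputs, scalars are read off with the test function
  \<open>1\<close>.\<close>

lemma tensor_form_eqI:
  assumes \<phi>: "\<phi> \<in> tensor_form scale p" and G: "is_graph G" "n_in G = p" "n_out G = 0"
    and eq: "\<And>xs. length xs = p \<Longrightarrow> graph_eval G (\<lambda>_. 1) xs = \<phi> (pure xs)"
  shows "(\<lambda>t\<in>tpow p. to_scalar scale (action p 0 (graph_elem G) t)) = \<phi>"
proof (rule extensionalityI)
  show "\<phi> \<in> extensional (tpow p)" using \<phi> by (simp add: tensor_form_def)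
  fix t assume t: "t \<in> tpow p"
  have "to_scalar scale (action p 0 (graph_elem G) t) = graph_map G t (\<lambda>_. 1)"
    using to_scalar_apply[of "graph_map G t" scale] graph_map_in_tensor_power[of t G] G t
    by (simp add: action_graph_elem)
  also have "\<dots> = \<phi> t"
  proof (rule linear_on_tensor_power_eqI[OF vector_space_field _ _ _ t])
    show "linear_on_set tscale (*) (tpow p) (\<lambda>t. graph_map G t (\<lambda>_. 1))"
      unfolding linear_on_set_def graph_map_add graph_map_scale by (simp add: tscale_def)
    show "linear_on_set tscale (*) (tpow p) \<phi>" using \<phi> by (simp add: tensor_form_def)
    show "graph_map G (pure xs) (\<lambda>_. 1) = \<phi> (pure xs)" if "length xs = p" for xs
      using graph_map_pure[of xs G "\<lambda>_. 1"] that G eq[OF that] by (simp add: multilinear_0)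
  qed
  finally show "(\<lambda>t\<in>tpow p. to_scalar scale (action p 0 (graph_elem G) t)) t = \<phi> t" using t by simp
qed simp

lemma action_coupling_action: "action_coupling scale action = b"
  unfolding action_coupling_def
proof (rule tensor_form_eqI[OF b_form is_graph_coupling])
  fix xs :: "'v list" assume "length xs = 2"
  then obtain x y where "xs = [x, y]" by (auto simp: numeral_2_eq_2 length_Suc_conv)
  then show "graph_eval coupling_graph (\<lambda>_. 1) xs = b (pure xs)"
    by (simp add: graph_eval_coupling pairing_def)
qed simp_all

lemma action_stars_action: "action_stars scale action = S"
proof (rule extensionalityI[of _ "{1..}"])
  show "action_stars scale action \<in> extensional {1..}" by (simp add: action_stars_def)
  fix r :: nat assume r: "r \<in> {1..}"
  then have "(\<lambda>t\<in>tpow r. to_scalar scale (action r 0 (graph_elem (star_graph r)) t)) = S r"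
    by (intro tensor_form_eqI[OF S_form is_graph_star]) (simp_all add: graph_eval_star)
  then show "action_stars scale action r = S r" using r by (simp add: action_stars_def)
qed (rule S_extensional)

end

section \<open>Decomposition of graphs\<close>

lemma ends_edges: "is_graph G \<Longrightarrow> {x \<in> ends G. edge_of G x \<in> edges G} = ends G"
  using is_graph_edge_of by blast

lemma Plus_empty [simp]: "{} <+> {} = {}"
  by (simp add: Plus_def)

lemma case_sum_image_Plus: "case_sum f g ` (A <+> B) = f ` A \<union> g ` B"
  by (simp add: Plus_def image_Un image_image)

lemma inj_on_case_sum:
  "inj_on (case_sum f g) (A <+> B) \<longleftrightarrow> inj_on f A \<and> inj_on g B \<and> f ` A \<inter> g ` B = {}"
  by (simp add: inj_on_def Plus_def ball_Un) blast

lemmas Plus_bij_simps = bij_betw_def inj_on_case_sum case_sum_image_Plus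

text \<open>The graph with the first input bent around to become the first output.\<close>

definition bend_graph :: "('v, 'h, 'e) pregraph \<Rightarrow> ('v, 'h, 'e) pregraph" where
  "bend_graph G = G\<lparr>n_in := n_in G - 1, n_out := Suc (n_out G),
     edge_of := (\<lambda>x. case x of Half h \<Rightarrow> edge_of G (Half h) | In i \<Rightarrow> edge_of G (In (Suc i))
       | Out j \<Rightarrow> (case j of 0 \<Rightarrow> edge_of G (In 0) | Suc j \<Rightarrow> edge_of G (Out j)))\<rparr>"

lemma bend_graph_simps [simp]:
  "verts (bend_graph G) = verts G" "halves (bend_graph G) = halves G" "edges (bend_graph G) = edges G"
  "n_in (bend_graph G) = n_in G - 1" "n_out (bend_graph G) = Suc (n_out G)" "vtx (bend_graph G) = vtx G"
  "edge_of (bend_graph G) (Half h) = edge_of G (Half h)"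
  "edge_of (bend_graph G) (In i) = edge_of G (In (Suc i))"
  "edge_of (bend_graph G) (Out 0) = edge_of G (In 0)"
  "edge_of (bend_graph G) (Out (Suc j)) = edge_of G (Out j)"
  by (simp_all add: bend_graph_def)

lemma is_graph_bend:
  assumes G: "is_graph G" and p: "n_in G = Suc p"
  shows "is_graph (bend_graph G)"
proof (rule is_graph_rename_ends[OF G])
  let ?\<phi> = "\<lambda>x. case x of Half h \<Rightarrow> Half h | In i \<Rightarrow> In (Suc i)
    | Out j \<Rightarrow> (case j of 0 \<Rightarrow> In 0 | Suc j \<Rightarrow> Out j)"
  show "bij_betw id (edges G) (edges (bend_graph G))" "edges G \<subseteq> edges G" by simp_all
  show "bij_betw ?\<phi> (ends (bend_graph G)) {x \<in> ends G. edge_of G x \<in> edges G}"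
    unfolding ends_edges[OF G]
  proof (rule bij_betwI[where g = "\<lambda>x. case x of Half h \<Rightarrow> Half h
        | In i \<Rightarrow> (case i of 0 \<Rightarrow> Out 0 | Suc i \<Rightarrow> In i) | Out j \<Rightarrow> Out (Suc j)"])
  qed (auto split: edge_end.splits nat.splits simp: p)
  show "edge_of (bend_graph G) x = id (edge_of G (?\<phi> x))" if "x \<in> ends (bend_graph G)" for x
    by (auto split: edge_end.splits nat.splits)
qed (use G in \<open>auto simp: is_graph_def\<close>)

text \<open>Bending the output back with a coupling straightens the strand. In the composite, the
  strand of the new identity edge, the coupling and the bent end all belong to the edge at the
  first input of \<open>G\<close>.\<close>

lemma bend_iso:
  assumes G: "is_graph G" and p: "n_in G = Suc p"
  shows "graph_iso (graph_comp (graph_juxt coupling_graph (identity_graph (n_out G)))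
    (graph_juxt (identity_graph 1) (bend_graph G))) G" (is "graph_iso (graph_comp ?U ?L) G")
proof -
  let ?\<alpha> = "case_sum undefined (case_sum undefined id)" and ?\<beta> = "case_sum undefined (case_sum undefined id)"
  let ?\<kappa> = "case_sum (case_sum (\<lambda>_. edge_of G (In 0)) (\<lambda>j. edge_of G (Out j))) (case_sum (\<lambda>_. edge_of G (In 0)) id)"
  let ?\<rho> = "\<lambda>e. Inr (Inr e)"
  have glue: "(Inl (edge_of ?U (In i)), Inr (edge_of ?L (Out i))) \<in> glue_rel ?U ?L" if "i < 2 + n_out G" for i
    using that by (intro glue_rel_glue) simp
  have g0: "(Inl (Inl 0), Inr (Inl 0)) \<in> glue_rel ?U ?L" using glue[of 0] by simp
  have g1: "(Inl (Inl 0), Inr (Inr (edge_of G (In 0)))) \<in> glue_rel ?U ?L" using glue[of 1] by simp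
  have g2: "(Inl (Inr j), Inr (Inr (edge_of G (Out j)))) \<in> glue_rel ?U ?L" if "j < n_out G" for j
    using glue[of "Suc (Suc j)"] that by simp
  have e0: "edge_of G (In 0) \<in> edges G" using p by (intro is_graph_edge_of[OF G]) simp
  have eo: "edge_of G (Out j) \<in> edges G" if "j < n_out G" for j using that by (intro is_graph_edge_of[OF G]) simp
  show ?thesis
  proof (rule graph_comp_isoI[where \<alpha> = ?\<alpha> and \<beta> = ?\<beta> and \<kappa> = ?\<kappa> and \<rho> = ?\<rho>])
    show "bij_betw ?\<alpha> (verts ?U <+> verts ?L) (verts G)"
      by (auto simp: Plus_bij_simps)
    show "bij_betw ?\<beta> (halves ?U <+> halves ?L) (halves G)"
      by (auto simp: Plus_bij_simps)
    show "?\<kappa> ` (edges ?U <+> edges ?L) = edges G"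
      using e0 eo by (auto simp: case_sum_image_Plus)
    show "?\<kappa> (Inl (edge_of ?U (In i))) = ?\<kappa> (Inr (edge_of ?L (Out i)))" if "i < n_in ?U" for i
    proof -
      consider "i = 0" | "i = 1" | j where "i = Suc (Suc j)" by (metis One_nat_def not0_implies_Suc)
      then show ?thesis using that by cases simp_all
    qed
    show "(e, ?\<rho> (?\<kappa> e)) \<in> glue_rel ?U ?L" if "e \<in> edges ?U <+> edges ?L" for e
      using that g1 g2 glue_rel_trans[OF glue_rel_sym[OF g0] g1] glue_rel_refl by auto
    show "edge_of G (In i) = ?\<kappa> (Inr (edge_of ?L (In i)))" if "i < n_in ?L" for i
      by (cases i) simp_all
  qed (use p in auto)
qed

text \<open>The single edge with two outputs is the bent identity, so that bending it back is the
  snake identity.\<close>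

definition copairing_graph :: nat_graph where
  "copairing_graph = bend_graph (identity_graph 1)"

lemma copairing_graph_simps [simp]:
  "verts copairing_graph = {}" "halves copairing_graph = {}" "edges copairing_graph = {0}"
  "n_in copairing_graph = 0" "n_out copairing_graph = 2"
  "edge_of copairing_graph (Out 0) = 0" "edge_of copairing_graph (Out (Suc 0)) = 0"
  by (auto simp: copairing_graph_def)

lemma is_graph_copairing: "is_graph copairing_graph"
  unfolding copairing_graph_def by (rule is_graph_bend[OF is_graph_identity, of _ 0]) simp

lemma snake_iso:
  "graph_iso (graph_comp (graph_juxt coupling_graph (identity_graph 1))
    (graph_juxt (identity_graph 1) copairing_graph)) (identity_graph 1)"
  using bend_iso[OF is_graph_identity, of 1 0] by (simp add: copairing_graph_def)

definition circle_graph :: nat_graph where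
  "circle_graph = \<lparr>verts = {}, halves = {}, edges = {0}, n_in = 0, n_out = 0, vtx = \<lambda>_. 0, edge_of = \<lambda>_. 0\<rparr>"

lemma circle_graph_simps [simp]:
  "verts circle_graph = {}" "halves circle_graph = {}" "edges circle_graph = {0}"
  "n_in circle_graph = 0" "n_out circle_graph = 0"
  by (simp_all add: circle_graph_def)

lemma is_graph_circle: "is_graph circle_graph"
  by (auto simp: is_graph_def ends_def)

lemma circle_iso: "graph_iso (graph_comp coupling_graph copairing_graph) circle_graph"
proof (rule graph_comp_isoI[where \<alpha> = undefined and \<beta> = undefined and \<kappa> = "\<lambda>_. 0" and \<rho> = "\<lambda>_. Inr 0"])
  have "(Inl 0, Inr 0) \<in> glue_rel coupling_graph copairing_graph"
    using glue_rel_glue[of 0 coupling_graph copairing_graph] by simp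
  then show "(e, Inr 0) \<in> glue_rel coupling_graph copairing_graph"
    if "e \<in> edges coupling_graph <+> edges copairing_graph" for e
    using that glue_rel_refl by auto
qed (auto simp: bij_betw_def)

lemma is_graph_remove_circle:
  assumes G: "is_graph G" and e: "\<And>x. x \<in> ends G \<Longrightarrow> edge_of G x \<noteq> e"
  shows "is_graph (G\<lparr>edges := edges G - {e}\<rparr>)" (is "is_graph ?G'")
proof (rule is_graph_rename_ends[OF G])
  show "bij_betw id (edges G - {e}) (edges ?G')" "edges G - {e} \<subseteq> edges G" by auto
  have "{x \<in> ends G. edge_of G x \<in> edges G - {e}} = ends ?G'"
    using e is_graph_edge_of[OF G] by (auto simp: ends_def)
  then show "bij_betw id (ends ?G') {x \<in> ends G. edge_of G x \<in> edges G - {e}}" by simp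
qed (use G in \<open>auto simp: is_graph_def\<close>)

lemma remove_circle_iso:
  assumes "e \<in> edges G"
  shows "graph_iso (graph_juxt circle_graph (G\<lparr>edges := edges G - {e}\<rparr>)) G"
  by (rule graph_isoI[of _ _ "case_sum undefined id" "case_sum undefined id" "case_sum (\<lambda>_. e) id"])
    (use assms in \<open>auto simp: Plus_bij_simps\<close>)

text \<open>The graph with the vertex \<open>v\<close> removed, its half-edges \<open>g 0,
  \<dots>, g (r - 1)\<close> becoming the first outputs.\<close>

definition cut_vertex :: "('v, 'h, 'e) pregraph \<Rightarrow> 'v \<Rightarrow> nat \<Rightarrow> (nat \<Rightarrow> 'h) \<Rightarrow> ('v, 'h, 'e) pregraph" where
  "cut_vertex G v r g = G\<lparr>verts := verts G - {v}, halves := halves G - halves_at G v, n_out := r + n_out G,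
     edge_of := (\<lambda>x. case x of Half h \<Rightarrow> edge_of G (Half h) | In i \<Rightarrow> edge_of G (In i)
       | Out j \<Rightarrow> if j < r then edge_of G (Half (g j)) else edge_of G (Out (j - r)))\<rparr>"

lemma cut_vertex_simps [simp]:
  "verts (cut_vertex G v r g) = verts G - {v}" "halves (cut_vertex G v r g) = halves G - halves_at G v"
  "edges (cut_vertex G v r g) = edges G"
  "n_in (cut_vertex G v r g) = n_in G" "n_out (cut_vertex G v r g) = r + n_out G"
  "vtx (cut_vertex G v r g) = vtx G"
  "edge_of (cut_vertex G v r g) (Half h) = edge_of G (Half h)"
  "edge_of (cut_vertex G v r g) (In i) = edge_of G (In i)"
  "edge_of (cut_vertex G v r g) (Out j) = (if j < r then edge_of G (Half (g j)) else edge_of G (Out (j - r)))"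
  by (simp_all add: cut_vertex_def)

lemma is_graph_cut_vertex:
  assumes G: "is_graph G" and g: "bij_betw g {..<r} (halves_at G v)"
  shows "is_graph (cut_vertex G v r g)"
proof (rule is_graph_rename_ends[OF G])
  let ?C = "cut_vertex G v r g"
  have g_at: "g j \<in> halves G" "vtx G (g j) = v" if "j < r" for j
    using g that by (auto simp: halves_at_def dest: bij_betwE)
  let ?\<phi> = "\<lambda>x. case x of Half h \<Rightarrow> Half h | In i \<Rightarrow> In i | Out j \<Rightarrow> if j < r then Half (g j) else Out (j - r)"
  show "bij_betw id (edges G) (edges ?C)" "edges G \<subseteq> edges G" by simp_all
  show "bij_betw ?\<phi> (ends ?C) {x \<in> ends G. edge_of G x \<in> edges G}"
    unfolding ends_edges[OF G]
  proof (rule bij_betwI[where g = "\<lambda>x. case x of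
        Half h \<Rightarrow> if vtx G h = v then Out (inv_into {..<r} g h) else Half h | In i \<Rightarrow> In i | Out j \<Rightarrow> Out (r + j)"])
    have inv: "inv_into {..<r} g h < r" "g (inv_into {..<r} g h) = h" if "h \<in> halves G" "vtx G h = v" for h
    proof -
      have "h \<in> g ` {..<r}" using g that by (simp add: bij_betw_def halves_at_def)
      then show "inv_into {..<r} g h < r" "g (inv_into {..<r} g h) = h"
        using inv_into_into[of h g "{..<r}"] by (auto simp: f_inv_into_f)
    qed
    have inv': "inv_into {..<r} g (g j) = j" if "j < r" for j
      using g that by (auto simp: bij_betw_def)
    show "?\<phi> \<in> ends ?C \<rightarrow> ends G"
      by (auto split: edge_end.splits simp: g_at)
    show "(\<lambda>x. case x of Half h \<Rightarrow> if vtx G h = v then Out (inv_into {..<r} g h) else Half h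
        | In i \<Rightarrow> In i | Out j \<Rightarrow> Out (r + j)) \<in> ends G \<rightarrow> ends ?C"
      by (auto split: edge_end.splits simp: halves_at_def trans_less_add1 inv)
    show "(case ?\<phi> x of Half h \<Rightarrow> if vtx G h = v then Out (inv_into {..<r} g h) else Half h
        | In i \<Rightarrow> In i | Out j \<Rightarrow> Out (r + j)) = x" if "x \<in> ends ?C" for x
      using that by (cases x) (auto simp: g_at inv' halves_at_def)
    show "?\<phi> (case x of Half h \<Rightarrow> if vtx G h = v then Out (inv_into {..<r} g h) else Half h
        | In i \<Rightarrow> In i | Out j \<Rightarrow> Out (r + j)) = x" if "x \<in> ends G" for x
      using that by (cases x) (auto simp: inv)
  qed
  show "edge_of ?C x = id (edge_of G (?\<phi> x))" if "x \<in> ends ?C" for x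
    by (cases x) auto
  show "vtx ?C ` halves ?C = verts ?C"
    using G by (auto simp: is_graph_def halves_at_def)
qed (use G in \<open>auto simp: is_graph_def\<close>)

text \<open>Every vertex is a star whose inputs are glued to the ends that were cut.\<close>

lemma cut_vertex_iso:
  assumes G: "is_graph G" and v: "v \<in> verts G" and g: "bij_betw g {..<r} (halves_at G v)"
  shows "graph_iso (graph_comp (graph_juxt (star_graph r) (identity_graph (n_out G))) (cut_vertex G v r g)) G"
    (is "graph_iso (graph_comp ?U ?L) G")
proof -
  let ?\<alpha> = "case_sum (\<lambda>_. v) id" and ?\<beta> = "case_sum (case_sum g undefined) id"
  let ?\<kappa> = "case_sum (case_sum (\<lambda>j. edge_of G (Half (g j))) (\<lambda>j. edge_of G (Out j))) id"
  have g_at: "g j \<in> halves G" "vtx G (g j) = v" if "j < r" for j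
    using g that by (auto simp: halves_at_def dest: bij_betwE)
  have eh: "edge_of G (Half (g j)) \<in> edges G" if "j < r" for j
    using g_at[OF that] by (intro is_graph_edge_of[OF G]) simp
  have eo: "edge_of G (Out j) \<in> edges G" if "j < n_out G" for j using that by (intro is_graph_edge_of[OF G]) simp
  have glue: "(Inl (edge_of ?U (In i)), Inr (edge_of ?L (Out i))) \<in> glue_rel ?U ?L" if "i < r + n_out G" for i
    using that by (intro glue_rel_glue) simp
  have g1: "(Inl (Inl j), Inr (edge_of G (Half (g j)))) \<in> glue_rel ?U ?L" if "j < r" for j
    using glue[of j] that by simp
  have g2: "(Inl (Inr j), Inr (edge_of G (Out j))) \<in> glue_rel ?U ?L" if "j < n_out G" for j
    using glue[of "r + j"] that by simp
  show ?thesis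
  proof (rule graph_comp_isoI[where \<alpha> = ?\<alpha> and \<beta> = ?\<beta> and \<kappa> = ?\<kappa> and \<rho> = Inr])
    show "bij_betw ?\<alpha> (verts ?U <+> verts ?L) (verts G)"
      using v by (auto simp: Plus_bij_simps intro!: inj_onI)
    show "bij_betw ?\<beta> (halves ?U <+> halves ?L) (halves G)"
    proof (rule bij_betw_imageI)
      have "inj_on g {..<r}" using g by (simp add: bij_betw_def)
      then show "inj_on ?\<beta> (halves ?U <+> halves ?L)"
        using g_at by (intro inj_onI) (auto simp: halves_at_def dest: inj_onD)
      have "?\<beta> ` (halves ?U <+> halves ?L) = g ` {..<r} \<union> (halves G - halves_at G v)"
        by (simp add: case_sum_image_Plus)
      also have "g ` {..<r} = halves_at G v" using g by (simp add: bij_betw_def)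
      finally show "?\<beta> ` (halves ?U <+> halves ?L) = halves G" by (auto simp: halves_at_def)
    qed
    show "?\<kappa> ` (edges ?U <+> edges ?L) = edges G"
      using eh eo by (auto simp: case_sum_image_Plus)
    show "(e, Inr (?\<kappa> e)) \<in> glue_rel ?U ?L" if "e \<in> edges ?U <+> edges ?L" for e
      using that g1 g2 glue_rel_refl by auto
  qed (auto simp: g_at)
qed

text \<open>For a graph whose first two outputs are joined by an edge: the graph without this
  edge.\<close>

definition remove_cap :: "('v, 'h, 'e) pregraph \<Rightarrow> ('v, 'h, 'e) pregraph" where
  "remove_cap G = G\<lparr>edges := edges G - {edge_of G (Out 0)}, n_out := n_out G - 2,
     edge_of := (\<lambda>x. case x of Half h \<Rightarrow> edge_of G (Half h) | In i \<Rightarrow> edge_of G (In i)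
       | Out j \<Rightarrow> edge_of G (Out (j + 2)))\<rparr>"

lemma remove_cap_simps [simp]:
  "verts (remove_cap G) = verts G" "halves (remove_cap G) = halves G"
  "edges (remove_cap G) = edges G - {edge_of G (Out 0)}"
  "n_in (remove_cap G) = n_in G" "n_out (remove_cap G) = n_out G - 2"
  "vtx (remove_cap G) = vtx G"
  "edge_of (remove_cap G) (Half h) = edge_of G (Half h)"
  "edge_of (remove_cap G) (In i) = edge_of G (In i)"
  "edge_of (remove_cap G) (Out j) = edge_of G (Out (j + 2))"
  by (simp_all add: remove_cap_def)

lemma cap_ends:
  assumes G: "is_graph G" and n: "1 < n_out G" and cap: "edge_of G (Out 1) = edge_of G (Out 0)"
    and x: "x \<in> ends G" "edge_of G x = edge_of G (Out 0)"
  shows "x = Out 0 \<or> x = Out 1"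
proof -
  have "Out 0 \<in> ends G" "Out 1 \<in> ends G" using n by auto
  moreover obtain y where "\<And>z. z \<in> ends G \<Longrightarrow> edge_of G z = edge_of G (Out 0) \<Longrightarrow> z = Out 0 \<or> z = y"
    using is_graph_partner[OF G \<open>Out 0 \<in> ends G\<close>] by metis
  ultimately show ?thesis using cap x by (metis One_nat_def edge_end.inject(3) n_not_Suc_n)
qed

text \<open>The removed edge has no ends but the first two outputs.\<close>

lemma is_graph_remove_cap:
  assumes G: "is_graph G" and n: "1 < n_out G" and cap: "edge_of G (Out 1) = edge_of G (Out 0)"
  shows "is_graph (remove_cap G)"
proof (rule is_graph_rename_ends[OF G])
  let ?E = "edges G - {edge_of G (Out 0)}"
  let ?\<phi> = "\<lambda>x. case x of Half h \<Rightarrow> Half h | In i \<Rightarrow> In i | Out j \<Rightarrow> Out (j + 2)"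
  show "bij_betw id ?E (edges (remove_cap G))" "?E \<subseteq> edges G" by auto
  have *: "x \<in> ends G \<and> edge_of G x \<in> ?E \<longleftrightarrow> x \<in> ends G \<and> x \<noteq> Out 0 \<and> x \<noteq> Out 1" for x
    using cap_ends[OF G n cap, of x] is_graph_edge_of[OF G, of x] cap by auto
  show "bij_betw ?\<phi> (ends (remove_cap G)) {x \<in> ends G. edge_of G x \<in> ?E}"
    unfolding *
  proof (rule bij_betwI[where g = "\<lambda>x. case x of Half h \<Rightarrow> Half h | In i \<Rightarrow> In i | Out j \<Rightarrow> Out (j - 2)"])
    fix y assume "y \<in> {x \<in> ends G. x \<noteq> Out 0 \<and> x \<noteq> Out 1}"
    then show "?\<phi> (case y of Half h \<Rightarrow> Half h | In i \<Rightarrow> In i | Out j \<Rightarrow> Out (j - 2)) = y"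
      by (cases y) auto
  qed (auto split: edge_end.splits)
  show "edge_of (remove_cap G) x = id (edge_of G (?\<phi> x))" if "x \<in> ends (remove_cap G)" for x
    by (cases x) auto
qed (use G in \<open>auto simp: is_graph_def\<close>)

lemma remove_cap_iso:
  assumes G: "is_graph G" and n: "1 < n_out G" and cap: "edge_of G (Out 1) = edge_of G (Out 0)"
  shows "graph_iso (graph_juxt copairing_graph (remove_cap G)) G"
proof (rule graph_isoI[of _ _ "case_sum undefined id" "case_sum undefined id"
      "case_sum (\<lambda>_. edge_of G (Out 0)) id"])
  have "edge_of G (Out 0) \<in> edges G" using n by (intro is_graph_edge_of[OF G]) simp
  then show "bij_betw (case_sum (\<lambda>_. edge_of G (Out 0)) id) (edges (graph_juxt copairing_graph (remove_cap G))) (edges G)"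
    by (auto simp: Plus_bij_simps)
  fix j assume "j < n_out (graph_juxt copairing_graph (remove_cap G))"
  consider "j = 0" | "j = 1" | j' where "j = Suc (Suc j')" by (metis One_nat_def not0_implies_Suc)
  then show "edge_of G (Out j) =
      case_sum (\<lambda>_. edge_of G (Out 0)) id (edge_of (graph_juxt copairing_graph (remove_cap G)) (Out j))"
    by cases (use cap in simp_all)
qed (use n in \<open>auto simp: Plus_bij_simps\<close>)

text \<open>The crossing of the \<open>k\<close>-th and the next one of \<open>k + 2 + m\<close>
  strands.\<close>

definition swap_graph :: "nat \<Rightarrow> nat \<Rightarrow> (nat + nat + nat, nat + nat + nat, nat + nat + nat) pregraph" where
  "swap_graph k m = graph_juxt (identity_graph k) (graph_juxt crossing_graph (identity_graph m))"

lemma is_graph_swap: "is_graph (swap_graph k m)"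
  unfolding swap_graph_def by (intro is_graph_juxt is_graph_identity is_graph_crossing)

lemma swap_graph_simps [simp]:
  "verts (swap_graph k m) = {}" "halves (swap_graph k m) = {}"
  "edges (swap_graph k m) = {..<k} <+> ({0, 1} <+> {..<m})"
  "n_in (swap_graph k m) = k + 2 + m" "n_out (swap_graph k m) = k + 2 + m"
  by (simp_all add: swap_graph_def)

text \<open>The edge of the \<open>i\<close>-th input of \<open>swap_graph k m\<close>.\<close>

definition swap_edge :: "nat \<Rightarrow> nat \<Rightarrow> nat + nat + nat" where
  "swap_edge k i = (if i < k then Inl i else if i < k + 2 then Inr (Inl (i - k)) else Inr (Inr (i - k - 2)))"

lemma edge_of_swap_graph:
  "edge_of (swap_graph k m) (In i) = swap_edge k i"
  "edge_of (swap_graph k m) (Out i) = swap_edge k (transpose k (Suc k) i)"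
proof -
  show "edge_of (swap_graph k m) (In i) = swap_edge k i"
    by (auto simp: swap_graph_def swap_edge_def)
  consider "i < k" | "i = k" | "i = Suc k" | j where "i = k + 2 + j"
    by (metis add_2_eq_Suc' less_eqE not_less_less_Suc_eq not_less add_Suc_right Suc_leI le_neq_implies_less)
  then show "edge_of (swap_graph k m) (Out i) = swap_edge k (transpose k (Suc k) i)"
    by cases (auto simp: swap_graph_def swap_edge_def transpose_def)
qed

lemma bij_betw_swap_edge: "bij_betw (swap_edge k) {..<k + 2 + m} (edges (swap_graph k m))"
  by (rule bij_betwI[where g = "case_sum id (case_sum (\<lambda>c. k + c) (\<lambda>j. k + 2 + j))"])
    (auto simp: swap_edge_def split: sum.splits)

definition swap_outputs :: "nat \<Rightarrow> ('v, 'h, 'e) pregraph \<Rightarrow> ('v, 'h, 'e) pregraph" where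
  "swap_outputs k G = G\<lparr>edge_of := (\<lambda>x. case x of Half h \<Rightarrow> edge_of G (Half h) | In i \<Rightarrow> edge_of G (In i)
       | Out j \<Rightarrow> edge_of G (Out (transpose k (Suc k) j)))\<rparr>"

lemma swap_outputs_simps [simp]:
  "verts (swap_outputs k G) = verts G" "halves (swap_outputs k G) = halves G"
  "edges (swap_outputs k G) = edges G"
  "n_in (swap_outputs k G) = n_in G" "n_out (swap_outputs k G) = n_out G"
  "vtx (swap_outputs k G) = vtx G"
  "edge_of (swap_outputs k G) (Half h) = edge_of G (Half h)"
  "edge_of (swap_outputs k G) (In i) = edge_of G (In i)"
  "edge_of (swap_outputs k G) (Out j) = edge_of G (Out (transpose k (Suc k) j))"
  by (simp_all add: swap_outputs_def)

lemma transpose_less: "Suc k < n \<Longrightarrow> j < n \<Longrightarrow> transpose k (Suc k) j < n"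
  by (auto simp: transpose_def)

lemma is_graph_swap_outputs:
  assumes G: "is_graph G" and k: "Suc k < n_out G"
  shows "is_graph (swap_outputs k G)"
proof (rule is_graph_rename_ends[OF G])
  let ?\<phi> = "\<lambda>x. case x of Half h \<Rightarrow> Half h | In i \<Rightarrow> In i | Out j \<Rightarrow> Out (transpose k (Suc k) j)"
  show "bij_betw id (edges G) (edges (swap_outputs k G))" "edges G \<subseteq> edges G" by simp_all
  show "bij_betw ?\<phi> (ends (swap_outputs k G)) {x \<in> ends G. edge_of G x \<in> edges G}"
    unfolding ends_edges[OF G]
    by (rule bij_betwI[where g = ?\<phi>]) (auto split: edge_end.splits simp: transpose_less[OF k])
  show "edge_of (swap_outputs k G) x = id (edge_of G (?\<phi> x))" if "x \<in> ends (swap_outputs k G)" for x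
    by (cases x) auto
qed (use G in \<open>auto simp: is_graph_def\<close>)

text \<open>Swapping two neighbouring outputs twice restores the graph; the second swap is a
  composition with a crossing.\<close>

lemma swap_outputs_iso:
  assumes G: "is_graph G" and n: "n_out G = k + 2 + m"
  shows "graph_iso (graph_comp (swap_graph k m) (swap_outputs k G)) G" (is "graph_iso (graph_comp ?U ?L) G")
proof -
  let ?\<tau> = "transpose k (Suc k)"
  let ?inv = "inv_into {..<k + 2 + m} (swap_edge k)"
  have inv: "?inv (swap_edge k i) = i" if "i < k + 2 + m" for i
    using bij_betw_swap_edge[of k m] that by (auto simp: bij_betw_def)
  have lt: "?\<tau> i < k + 2 + m" if "i < k + 2 + m" for i using that by (intro transpose_less) auto
  let ?\<kappa> = "case_sum (\<lambda>c. edge_of G (Out (?\<tau> (?inv c)))) id"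
  have surj: "\<exists>i<k + 2 + m. c = swap_edge k i" if "c \<in> edges (swap_graph k m)" for c
    using bij_betw_swap_edge[of k m] that unfolding bij_betw_def by (metis imageE lessThan_iff)
  have eo: "edge_of G (Out j) \<in> edges G" if "j < k + 2 + m" for j
    using that n by (intro is_graph_edge_of[OF G]) simp
  show ?thesis
  proof (rule graph_comp_isoI[where \<alpha> = "case_sum undefined id" and \<beta> = "case_sum undefined id"
        and \<kappa> = ?\<kappa> and \<rho> = Inr])
    have "(\<lambda>c. edge_of G (Out (?\<tau> (?inv c)))) ` edges ?U \<subseteq> edges G"
    proof safe
      fix c assume "c \<in> edges ?U"
      then obtain i where "i < k + 2 + m" "c = swap_edge k i" using surj by blast
      then show "edge_of G (Out (?\<tau> (?inv c))) \<in> edges G" using inv eo lt by simp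
    qed
    then show "?\<kappa> ` (edges ?U <+> edges ?L) = edges G"
      unfolding case_sum_image_Plus by (auto simp del: swap_graph_simps(3))
    show "?\<kappa> (Inl (edge_of ?U (In i))) = ?\<kappa> (Inr (edge_of ?L (Out i)))" if "i < n_in ?U" for i
      using that inv by (simp add: edge_of_swap_graph)
    show "(e, Inr (?\<kappa> e)) \<in> glue_rel ?U ?L" if e: "e \<in> edges ?U <+> edges ?L" for e
    proof (cases e)
      case (Inl c)
      then have "c \<in> edges (swap_graph k m)" using e by (auto simp del: swap_graph_simps(3))
      then obtain i where "i < k + 2 + m" "c = swap_edge k i" using surj by blast
      then show ?thesis
        using Inl glue_rel_glue[of i ?U ?L] inv by (simp add: edge_of_swap_graph)
    qed (simp add: glue_rel_refl)
    show "edge_of G (Out j) = ?\<kappa> (Inl (edge_of ?U (Out j)))" if "j < n_out ?U" for j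
      using that inv[OF lt[of j]] by (simp add: edge_of_swap_graph)
  qed (use n in \<open>auto simp: Plus_bij_simps\<close>)
qed

lemma coupling_crossing_iso: "graph_iso (graph_comp coupling_graph crossing_graph) coupling_graph"
proof (rule graph_comp_isoI[where \<alpha> = undefined and \<beta> = undefined and \<kappa> = "\<lambda>_. 0" and \<rho> = "\<lambda>_. Inl 0"])
  have "(Inl 0, Inr 1) \<in> glue_rel coupling_graph crossing_graph" "(Inl 0, Inr 0) \<in> glue_rel coupling_graph crossing_graph"
    using glue_rel_glue[of 0 coupling_graph crossing_graph] glue_rel_glue[of 1 coupling_graph crossing_graph] by simp_all
  then show "(e, Inl 0) \<in> glue_rel coupling_graph crossing_graph"
    if "e \<in> edges coupling_graph <+> edges crossing_graph" for e
    using that glue_rel_refl by (auto intro: glue_rel_sym)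
qed (auto simp: bij_betw_def)

text \<open>Swapping two inputs of a star amounts to renaming its half-edges.\<close>

lemma star_swap_iso:
  "graph_iso (graph_comp (star_graph (k + 2 + m)) (swap_graph k m)) (star_graph (k + 2 + m))"
  (is "graph_iso (graph_comp ?U ?L) _")
proof -
  let ?\<tau> = "transpose k (Suc k)" and ?r = "k + 2 + m"
  let ?inv = "inv_into {..<k + 2 + m} (swap_edge k)"
  have inv: "?inv (swap_edge k i) = i" if "i < ?r" for i
    using bij_betw_swap_edge[of k m] that by (auto simp: bij_betw_def)
  have lt: "?\<tau> i < ?r" if "i < ?r" for i using that by (intro transpose_less) auto
  have surj: "\<exists>i<?r. c = swap_edge k i" if "c \<in> edges (swap_graph k m)" for c
    using bij_betw_swap_edge[of k m] that unfolding bij_betw_def by (metis imageE lessThan_iff)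
  have \<tau>: "bij_betw ?\<tau> {..<?r} {..<?r}"
    by (rule bij_betwI[where g = ?\<tau>]) (use lt in auto)
  let ?\<kappa> = "case_sum ?\<tau> ?inv"
  show ?thesis
  proof (rule graph_comp_isoI[where \<alpha> = "\<lambda>_. 0" and \<beta> = "case_sum ?\<tau> undefined"
        and \<kappa> = ?\<kappa> and \<rho> = "\<lambda>i. Inl (?\<tau> i)"])
    show "bij_betw (case_sum ?\<tau> undefined) (halves ?U <+> halves ?L) (halves ?U)"
      using \<tau> by (simp add: Plus_bij_simps)
    have "?inv ` edges ?L = {..<?r}"
      using bij_betw_inv_into[OF bij_betw_swap_edge[of k m]] by (simp only: bij_betw_def)
    then show "?\<kappa> ` (edges ?U <+> edges ?L) = edges ?U"
      using \<tau> unfolding case_sum_image_Plus by (simp add: bij_betw_def del: swap_graph_simps(3))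
    show "?\<kappa> (Inl (edge_of ?U (In i))) = ?\<kappa> (Inr (edge_of ?L (Out i)))" if "i < n_in ?U" for i
      using that inv[OF lt[of i]] by (simp add: edge_of_swap_graph)
    show "(e, Inl (?\<tau> (?\<kappa> e))) \<in> glue_rel ?U ?L" if e: "e \<in> edges ?U <+> edges ?L" for e
    proof (cases e)
      case (Inr c)
      then have "c \<in> edges (swap_graph k m)" using e by (auto simp del: swap_graph_simps(3))
      then obtain i where i: "i < ?r" "c = swap_edge k i" using surj by blast
      then have "(Inl (?\<tau> i), Inr (swap_edge k i)) \<in> glue_rel ?U ?L"
        using glue_rel_glue[of "?\<tau> i" ?U ?L] lt by (simp add: edge_of_swap_graph)
      then show ?thesis using Inr i inv by (auto intro: glue_rel_sym)
    qed (simp add: glue_rel_refl)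
    show "edge_of ?U (In i) = ?\<kappa> (Inr (edge_of ?L (In i)))" if "i < n_in ?L" for i
      using that inv by (simp add: edge_of_swap_graph)
  qed (auto simp: bij_betw_def inj_on_def)
qed

section \<open>Contraction of tensors\<close>

lemma tensor_power_apply_add:
  assumes s: "vector_space s" and t: "t \<in> tensor_power s n"
    and f: "multilinear s (*) n f" and g: "multilinear s (*) n g"
  shows "t (\<lambda>xs. c * f xs + g xs) = c * t f + t g"
  using tensor_power_form_linear[OF s t, of "\<lambda>xs. c * f xs + g xs" c f 1 g] f g by simp

lemma tensor_power_apply_zero:
  assumes s: "vector_space s" and t: "t \<in> tensor_power s n" and h: "\<And>xs. length xs = n \<Longrightarrow> h xs = 0"
  shows "t h = 0"
proof -
  have "multilinear s (*) n (\<lambda>_. 0)"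
    unfolding multilinear_def using s by (auto simp: linear_form_iff)
  then show ?thesis using tensor_power_form_linear[OF s t, of h 0 "\<lambda>_. 0" 0 "\<lambda>_. 0"] h by simp
qed

lemma multilinear_contract:
  assumes s: "vector_space s" and t: "t \<in> tensor_power s n"
    and h: "\<And>ys. length ys = n \<Longrightarrow> multilinear s (*) m (\<lambda>xs. h xs ys)"
      "\<And>xs. length xs = m \<Longrightarrow> multilinear s (*) n (h xs)"
  shows "multilinear s (*) m (\<lambda>xs. t (h xs))"
  using t
proof (induction rule: tensor_power_induct)
  case zero
  show ?case unfolding multilinear_def using s by (auto simp: linear_form_iff)
next
  case (step c ys t)
  have eq: "(tscale c (pure_tensor s ys) + t) (h xs) = c * h xs ys + t (h xs)" if "length xs = m" for xs
    using h(2)[OF that] step(1) by (simp add: tscale_def pure_tensor_apply)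
  show ?case
    unfolding multilinear_def
  proof (intro allI impI)
    fix xs :: "'b list" and i assume xs: "length xs = m" "i < m"
    have "Vector_Spaces.linear s (*) (\<lambda>u. c * h (xs[i := u]) ys + t (h (xs[i := u])))"
      using multilinearD[OF h(1)[OF step(1)] xs] multilinearD[OF step.IH xs]
      by (auto simp: linear_form_iff[OF s] algebra_simps)
    then show "Vector_Spaces.linear s (*) (\<lambda>u. (tscale c (pure_tensor s ys) + t) (h (xs[i := u])))"
      using eq xs(1) by simp
  qed
qed

text \<open>An interchange of two finite sums: by linearity in \<open>u\<close> it suffices to
  consider pure tensors.\<close>

lemma contract_commute:
  assumes s: "vector_space s" and t: "t \<in> tensor_power s m" and u: "u \<in> tensor_power s n"
    and h: "\<And>ys. length ys = n \<Longrightarrow> multilinear s (*) m (\<lambda>xs. h xs ys)"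
      "\<And>xs. length xs = m \<Longrightarrow> multilinear s (*) n (h xs)"
  shows "t (\<lambda>xs. u (h xs)) = u (\<lambda>ys. t (\<lambda>xs. h xs ys))"
  using u
proof (induction rule: tensor_power_induct)
  case zero
  show ?case using tensor_power_apply_zero[OF s t, of "\<lambda>_. 0"] by simp
next
  case (step c ys u)
  have "multilinear s (*) n (\<lambda>ys. t (\<lambda>xs. h xs ys))"
    by (rule multilinear_contract[OF s t]) (use h in auto)
  then have r: "(tscale c (pure_tensor s ys) + u) (\<lambda>ys. t (\<lambda>xs. h xs ys)) =
      c * t (\<lambda>xs. h xs ys) + u (\<lambda>ys. t (\<lambda>xs. h xs ys))"
    using step(1) by (simp add: tscale_def pure_tensor_apply)
  have ml: "multilinear s (*) m (\<lambda>xs. u (h xs))" by (rule multilinear_contract[OF s step(2) h])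
  have ml': "multilinear s (*) m (\<lambda>xs. c * h xs ys + u (h xs))"
    unfolding multilinear_def
  proof (intro allI impI)
    fix xs :: "'b list" and i assume xs: "length xs = m" "i < m"
    show "Vector_Spaces.linear s (*) (\<lambda>v. c * h (xs[i := v]) ys + u (h (xs[i := v])))"
      using multilinearD[OF h(1)[OF step(1)] xs] multilinearD[OF ml xs]
      by (auto simp: linear_form_iff[OF s] algebra_simps)
  qed
  have "t (\<lambda>xs. (tscale c (pure_tensor s ys) + u) (h xs)) = t (\<lambda>xs. c * h xs ys + u (h xs))"
    by (rule tensor_power_cong[OF s t ml']) (use h(2) step(1) in \<open>simp add: tscale_def pure_tensor_apply\<close>)
  also have "\<dots> = c * t (\<lambda>xs. h xs ys) + t (\<lambda>xs. u (h xs))"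
    by (rule tensor_power_apply_add[OF s t h(1)[OF step(1)] ml])
  finally show ?case using r step.IH by simp
qed

lemma multilinear_1:
  assumes "Vector_Spaces.linear s (*) \<phi>"
  shows "multilinear s (*) 1 (\<lambda>xs. \<phi> (xs ! 0))"
  using assms unfolding multilinear_def by simp

lemma multilinear_2I:
  fixes F :: "'v::ab_group_add \<Rightarrow> 'v \<Rightarrow> 'k::field"
  assumes "\<And>y. Vector_Spaces.linear s (*) (\<lambda>x. F x y)" "\<And>x. Vector_Spaces.linear s (*) (F x)"
  shows "multilinear s (*) 2 (\<lambda>xs. F (xs ! 0) (xs ! 1))"
  unfolding multilinear_def
proof (intro allI impI)
  fix xs :: "'v list" and i :: nat assume "length xs = 2" "i < 2"
  then show "Vector_Spaces.linear s (*) (\<lambda>u. F (xs[i := u] ! 0) (xs[i := u] ! 1))"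
    using assms by (cases i) auto
qed

lemma multilinear_2D:
  assumes "multilinear s (*) 2 f"
  shows "Vector_Spaces.linear s (*) (\<lambda>x. f [x, y])" "Vector_Spaces.linear s (*) (\<lambda>y. f [x, y])"
  using multilinearD[OF assms, of "[x, y]" 0] multilinearD[OF assms, of "[x, y]" 1] by simp_all

lemma length_2E: "length xs = 2 \<Longrightarrow> (\<And>x y. xs = [x, y] \<Longrightarrow> P) \<Longrightarrow> P"
  by (auto simp: numeral_2_eq_2 length_Suc_conv)

section \<open>Actions of the PROP of graphs\<close>

locale graph_action =
  vector_space scale
  for scale :: "'k::field \<Rightarrow> 'v::ab_group_add \<Rightarrow> 'v" +
  fixes Z :: "nat \<Rightarrow> nat \<Rightarrow> 'k graph_comb \<Rightarrow> ('v, 'k) tensor \<Rightarrow> ('v, 'k) tensor"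
  assumes Z: "Z \<in> graph_actions scale"
begin

abbreviation lin :: "('v \<Rightarrow> 'k) \<Rightarrow> bool" where "lin \<equiv> Vector_Spaces.linear scale (*)"
abbreviation mlin :: "nat \<Rightarrow> ('v list \<Rightarrow> 'k) \<Rightarrow> bool" where "mlin \<equiv> multilinear scale (*)"
abbreviation pure :: "'v list \<Rightarrow> ('v, 'k) tensor" where "pure \<equiv> pure_tensor scale"
abbreviation tpow :: "nat \<Rightarrow> ('v, 'k) tensor set" where "tpow \<equiv> tensor_power scale"

lemmas Z_axioms = Z[unfolded graph_actions_def mem_Collect_eq]
lemmas Z_PiE = Z_axioms[THEN conjunct1, rule_format]
lemmas Z_prop_linear = Z_axioms[THEN conjunct2, THEN conjunct1, rule_format]
lemmas Z_comp = Z_axioms[THEN conjunct2, THEN conjunct2, THEN conjunct1, rule_format]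
lemmas Z_tensor = Z_axioms[THEN conjunct2, THEN conjunct2, THEN conjunct2, THEN conjunct1, rule_format]
lemmas Z_identity = Z_axioms[THEN conjunct2, THEN conjunct2, THEN conjunct2, THEN conjunct2, THEN conjunct1, rule_format]
lemmas Z_crossing = Z_axioms[THEN conjunct2, THEN conjunct2, THEN conjunct2, THEN conjunct2, THEN conjunct2, rule_format]

lemma Z_hom: "X \<in> graph_prop p q \<Longrightarrow> Z p q X \<in> tensor_hom scale p q"
  by (rule PiE_mem[OF Z_PiE])

lemma Z_in: "X \<in> graph_prop p q \<Longrightarrow> t \<in> tpow p \<Longrightarrow> Z p q X t \<in> tpow q"
  and Z_linear: "X \<in> graph_prop p q \<Longrightarrow> linear_on_set tscale tscale (tpow p) (Z p q X)"
  and Z_extensional: "X \<in> graph_prop p q \<Longrightarrow> Z p q X \<in> extensional (tpow p)"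
  using Z_hom[of X p q] by (auto simp: tensor_hom_def PiE_def)

lemma Z_prop_extensional: "Z p q \<in> extensional (graph_prop p q)"
  using Z_PiE[of p q] by (simp add: PiE_def)

text \<open>A graph determines the indices at which \<open>Z\<close> is to be taken.\<close>

definition op :: "('a, 'h, 'e) pregraph \<Rightarrow> ('v, 'k) tensor \<Rightarrow> ('v, 'k) tensor" where
  "op G = Z (n_in G) (n_out G) (graph_elem G)"

lemma op_in: "is_graph G \<Longrightarrow> t \<in> tpow (n_in G) \<Longrightarrow> op G t \<in> tpow (n_out G)"
  unfolding op_def by (rule Z_in[OF graph_elem_in_prop])

lemma op_linear: "is_graph G \<Longrightarrow> linear_on_set tscale tscale (tpow (n_in G)) (op G)"
  unfolding op_def by (rule Z_linear[OF graph_elem_in_prop])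

lemma op_comp:
  assumes "is_graph G" "is_graph F" "n_in G = n_out F" "t \<in> tpow (n_in F)"
  shows "op (graph_comp G F) t = op G (op F t)"
proof -
  have "graph_elem G \<in> (graph_prop (n_out F) (n_out G) :: 'k graph_comb set)"
    using graph_elem_in_prop[OF assms(1)] assms(3) by metis
  moreover have "graph_elem F \<in> (graph_prop (n_in F) (n_out F) :: 'k graph_comb set)"
    by (rule graph_elem_in_prop[OF assms(2)])
  ultimately have "Z (n_in F) (n_out G) (prop_comp (graph_elem G) (graph_elem F)) t =
      Z (n_out F) (n_out G) (graph_elem G) (Z (n_in F) (n_out F) (graph_elem F) t)"
    using assms(4) by (rule Z_comp)
  then show ?thesis
    unfolding op_def using assms(3) by (simp add: prop_comp_graph_elem[OF assms(1-3)])
qed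

lemma op_juxt:
  assumes "is_graph G" "is_graph F" "t \<in> tpow (n_in G)" "u \<in> tpow (n_in F)"
  shows "op (graph_juxt G F) (tensor_mult scale (n_in G) (n_in F) t u) =
    tensor_mult scale (n_out G) (n_out F) (op G t) (op F u)"
proof -
  have "graph_elem G \<in> (graph_prop (n_in G) (n_out G) :: 'k graph_comb set)"
    by (rule graph_elem_in_prop[OF assms(1)])
  moreover have "graph_elem F \<in> (graph_prop (n_in F) (n_out F) :: 'k graph_comb set)"
    by (rule graph_elem_in_prop[OF assms(2)])
  ultimately have "Z (n_in G + n_in F) (n_out G + n_out F) (prop_tensor (graph_elem G) (graph_elem F))
      (tensor_mult scale (n_in G) (n_in F) t u) =
      tensor_mult scale (n_out G) (n_out F) (Z (n_in G) (n_out G) (graph_elem G) t) (Z (n_in F) (n_out F) (graph_elem F) u)"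
    using assms(3,4) by (rule Z_tensor)
  then show ?thesis
    unfolding op_def by (simp add: prop_tensor_graph_elem[OF assms(1,2)])
qed

lemma op_juxt_pure:
  assumes "is_graph G" "is_graph F" "length xs = n_in G" "length ys = n_in F"
  shows "op (graph_juxt G F) (pure (xs @ ys)) =
    tensor_mult scale (n_out G) (n_out F) (op G (pure xs)) (op F (pure ys))"
  using op_juxt[OF assms(1,2) pure_in_tensor_power[OF assms(3)] pure_in_tensor_power[OF assms(4)]]
    tensor_mult_pure[of scale xs ys] assms(3,4) by simp

lemma op_iso:
  assumes "graph_iso G H" "is_graph G"
  shows "op G = op H"
  using assms iso_class_eq[OF assms] by (simp add: op_def graph_elem_def graph_iso_def)

lemma op_identity: "t \<in> tpow p \<Longrightarrow> op (identity_graph p) t = t"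
  by (simp add: op_def Z_identity)

lemma op_crossing: "op crossing_graph (pure [x, y]) = pure [y, x]"
  by (simp add: op_def Z_crossing)

lemma op_identity_pure: "length xs = p \<Longrightarrow> op (identity_graph p) (pure xs) = pure xs"
  by (intro op_identity pure_in_tensor_power)

lemma op_scalar:
  assumes "is_graph G" "n_out G = 0" "t \<in> tpow (n_in G)"
  shows "op G t = tscale (to_scalar scale (op G t)) (pure [])"
  using tensor_power_0 op_in[OF assms(1,3)] assms(2) by metis

text \<open>The multilinear form given by a graph without outputs.\<close>

definition form :: "('a, 'h, 'e) pregraph \<Rightarrow> 'v list \<Rightarrow> 'k" where
  "form G xs = to_scalar scale (op G (pure xs))"

lemma op_form:
  "is_graph G \<Longrightarrow> n_out G = 0 \<Longrightarrow> length xs = n_in G \<Longrightarrow>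
    op G (pure xs) = tscale (form G xs) (pure [])"
  unfolding form_def by (intro op_scalar pure_in_tensor_power)

lemma to_scalar_op_tensor_form:
  assumes G: "is_graph G" "n_in G = p" "n_out G = 0"
  shows "(\<lambda>t\<in>tpow p. to_scalar scale (Z p 0 (graph_elem G) t)) \<in> tensor_form scale p"
proof -
  have "linear_on_set tscale (*) (tpow p) (\<lambda>t. to_scalar scale (op G t))"
    unfolding linear_on_set_def
  proof (intro conjI ballI allI)
    fix t u c assume tu: "t \<in> tpow p" "u \<in> tpow p"
    have in0: "op G v \<in> tpow 0" if "v \<in> tpow p" for v
      using op_in[OF G(1), of v] that G by simp
    show "to_scalar scale (op G (t + u)) = to_scalar scale (op G t) + to_scalar scale (op G u)"
      unfolding to_scalar_apply[OF in0[OF tensor_power_add[OF tu]]] to_scalar_apply[OF in0[OF tu(1)]]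
        to_scalar_apply[OF in0[OF tu(2)]]
      using op_linear[OF G(1)] tu G(2) unfolding linear_on_set_def by simp
    show "to_scalar scale (op G (tscale c t)) = c * to_scalar scale (op G t)"
      unfolding to_scalar_apply[OF in0[OF tensor_power_scale[OF tu(1)]]] to_scalar_apply[OF in0[OF tu(1)]]
      using op_linear[OF G(1)] tu G(2) unfolding linear_on_set_def by (simp add: tscale_def)
  qed
  then show ?thesis
    using G tensor_power_add[of _ scale p] tensor_power_scale[of _ scale p]
    by (simp add: tensor_form_def op_def linear_on_set_def)
qed

lemma form_multilinear:
  assumes G: "is_graph G" "n_out G = 0"
  shows "mlin (n_in G) (form G)"
proof -
  have "mlin (n_in G)
      (\<lambda>xs. (\<lambda>t\<in>tpow (n_in G). to_scalar scale (Z (n_in G) 0 (graph_elem G) t)) (pure xs))"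
    using to_scalar_op_tensor_form[OF G(1) refl G(2)]
    by (intro multilinear_linear_on_pure vector_space_axioms vector_space_field) (simp only: tensor_form_def mem_Collect_eq)
  then show ?thesis
    by (rule multilinear_cong[THEN iffD1, rotated])
      (simp add: form_def op_def G(2) pure_in_tensor_power)
qed

abbreviation pairing :: "'v \<Rightarrow> 'v \<Rightarrow> 'k" where "pairing x y \<equiv> form coupling_graph [x, y]"

lemma lin_pairing: "lin (\<lambda>x. pairing x y)"
    "lin (pairing x)"
  using multilinear_2D[of scale "form coupling_graph"] form_multilinear[of coupling_graph]
  by (simp_all add: is_graph_coupling)

lemma tensor_mult_scalar_left: "tensor_mult s 0 n (tscale c (pure_tensor s [])) (pure_tensor s xs) = tscale c (pure_tensor s xs)"
  if "length xs = n" for s :: "'k \<Rightarrow> 'v \<Rightarrow> 'v"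
  using tensor_mult_pure[of s "[]" xs] that by (simp add: tensor_mult_linear_left)

definition copairing :: "('v, 'k) tensor" where
  "copairing = op copairing_graph (pure [])"

lemma copairing_in: "copairing \<in> tpow 2"
  unfolding copairing_def using op_in[OF is_graph_copairing, of "pure []"]
  by (simp add: pure_in_tensor_power)

text \<open>The snake identity, read as an identity between linear forms: contracting
  \<open>x\<close> with the first leg of the copairing by means of the pairing gives back
  \<open>x\<close> in the second leg.\<close>

lemma copairing_contract_left:
  assumes \<phi>: "lin \<phi>"
  shows "copairing (\<lambda>as. pairing x (as ! 0) * \<phi> (as ! 1)) = \<phi> x"
proof -
  let ?G = "graph_juxt coupling_graph (identity_graph 1)"
  have G: "is_graph ?G" by (intro is_graph_juxt is_graph_coupling is_graph_identity)
  have x: "pure [x] \<in> tpow 1" by (rule pure_in_tensor_power) simp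
  have \<phi>1: "mlin 1 (\<lambda>xs. \<phi> (xs ! 0))" by (rule multilinear_1[OF \<phi>])
  have ml: "mlin 2 (\<lambda>as. pairing x (as ! 0) * \<phi> (as ! 1))"
    by (rule multilinear_2I) (use lin_pairing(2)[of x] \<phi> in \<open>auto simp: linear_form_iff[OF vector_space_axioms] algebra_simps\<close>)
  \<comment> \<open>the linear form \<open>\<phi>\<close> extracts scalars, and by linearity \<open>w\<close> may be taken pure\<close>
  have contract: "op ?G (tensor_mult scale 1 2 (pure [x]) w) (\<lambda>xs. \<phi> (xs ! 0)) =
      w (\<lambda>as. pairing x (as ! 0) * \<phi> (as ! 1))" if "w \<in> tpow 2" for w
  proof (rule linear_on_tensor_power_eqI[OF vector_space_field _ _ _ that])
    have "linear_on_set tscale tscale (tpow 2) (\<lambda>w. op ?G (tensor_mult scale 1 2 (pure [x]) w))"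
    proof (rule linear_on_set_compose[OF tensor_mult_linear_on_right[OF vector_space_axioms x]])
      show "linear_on_set tscale tscale (tpow 3) (op ?G)"
        using op_linear[OF G] by (simp add: numeral_3_eq_3)
      show "tensor_mult scale 1 2 (pure [x]) w \<in> tpow 3"
        if "w \<in> tpow 2" for w
        using tensor_mult_in_tensor_power[OF vector_space_axioms x that] by (simp add: numeral_3_eq_3)
    qed
    then show "linear_on_set tscale (*) (tpow 2)
        (\<lambda>w. op ?G (tensor_mult scale 1 2 (pure [x]) w) (\<lambda>xs. \<phi> (xs ! 0)))"
      unfolding linear_on_set_def by (simp add: tscale_def)
    show "linear_on_set tscale (*) (tpow 2) (\<lambda>w. w (\<lambda>as. pairing x (as ! 0) * \<phi> (as ! 1)))"
      unfolding linear_on_set_def by (simp add: tscale_def)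
    fix as :: "'v list" assume "length as = 2"
    then obtain a c where as: "as = [a, c]" by (rule length_2E)
    have "op ?G (tensor_mult scale 1 2 (pure [x]) (pure as)) =
        op ?G (pure ([x, a] @ [c]))"
      using tensor_mult_pure[of scale "[x]" as] by (simp add: as numeral_2_eq_2)
    also have "\<dots> = tscale (pairing x a) (pure [c])"
      using op_juxt_pure[OF is_graph_coupling is_graph_identity, of "[x, a]" "[c]" 1]
      by (simp add: op_form is_graph_coupling op_identity_pure tensor_mult_scalar_left)
    finally show "op ?G (tensor_mult scale 1 2 (pure [x]) (pure as)) (\<lambda>xs. \<phi> (xs ! 0)) =
        pure as (\<lambda>as. pairing x (as ! 0) * \<phi> (as ! 1))"
      using ml \<phi>1 by (simp add: tscale_def pure_tensor_apply as numeral_2_eq_2 mult.commute)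
  qed
  let ?F = "graph_juxt (identity_graph 1) copairing_graph"
  have F: "is_graph ?F" by (intro is_graph_juxt is_graph_identity is_graph_copairing)
  have "op ?F (pure ([x] @ [])) = tensor_mult scale 1 2 (pure [x]) copairing"
    using op_juxt_pure[OF is_graph_identity is_graph_copairing, of "[x]" 1 "[]"]
    by (simp add: op_identity_pure copairing_def)
  then have "op (graph_comp ?G ?F) (pure [x]) =
      op ?G (tensor_mult scale 1 2 (pure [x]) copairing)"
    using op_comp[OF G F, of "pure [x]"] x by simp
  moreover have "is_graph (graph_comp ?G ?F)"
    by (rule graph_comp_orientation[OF G F]) simp_all
  ultimately have "op ?G (tensor_mult scale 1 2 (pure [x]) copairing) = pure [x]"
    using op_iso[OF snake_iso] by (simp add: op_identity_pure)
  then show ?thesis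
    using contract[OF copairing_in] \<phi>1 by (simp add: pure_tensor_apply)
qed

lemma pairing_sym: "pairing x y = pairing y x"
proof -
  have "is_graph (graph_comp coupling_graph crossing_graph)"
    by (rule graph_comp_orientation[OF is_graph_coupling is_graph_crossing]) simp_all
  from op_iso[OF coupling_crossing_iso this]
  have "op coupling_graph (pure [x, y]) = op coupling_graph (op crossing_graph (pure [x, y]))"
    using op_comp[OF is_graph_coupling is_graph_crossing, of "pure [x, y]"]
    by (simp add: pure_in_tensor_power)
  then show ?thesis by (simp add: form_def op_crossing)
qed

text \<open>The other snake identity follows from the first one and the symmetry of the pairing:
  contract two copairings with each other, with \<open>\<phi>\<close> and with \<open>x\<close>,
  in the two possible orders.\<close>

lemma copairing_contract_right:
  assumes \<phi>: "lin \<phi>"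
  shows "copairing (\<lambda>as. \<phi> (as ! 0) * pairing (as ! 1) x) = \<phi> x"
proof -
  note lin_iff = linear_form_iff[OF vector_space_axioms]
  define h where "h cs as = pairing (cs ! 0) (as ! 0) * (\<phi> (as ! 1) * pairing (cs ! 1) x)" for cs as
  have l: "lin (\<lambda>u. \<phi> u * c)" "lin (\<lambda>u. c * pairing u x)" for c
    using linear_mult_const[OF vector_space_axioms \<phi>, of c]
      linear_mult_const[OF vector_space_axioms lin_pairing(1)[of x], of c] by simp_all
  have "copairing (h cs) = \<phi> (cs ! 0) * pairing (cs ! 1) x" for cs
    unfolding h_def[abs_def] by (rule copairing_contract_left[OF l(1)])
  moreover have "copairing (\<lambda>cs. h cs as) = \<phi> (as ! 1) * pairing (as ! 0) x" for as
    unfolding h_def pairing_sym[of "_ ! 0" "as ! 0"] by (rule copairing_contract_left[OF l(2)])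
  moreover have "copairing (\<lambda>cs. copairing (h cs)) = copairing (\<lambda>as. copairing (\<lambda>cs. h cs as))"
  proof (rule contract_commute[OF vector_space_axioms copairing_in copairing_in])
    show "mlin 2 (\<lambda>cs. h cs as)" for as
      unfolding h_def
      by (rule multilinear_2I) (use \<phi> lin_pairing in \<open>auto simp: lin_iff algebra_simps\<close>)
    show "mlin 2 (h cs)" for cs
      unfolding h_def[abs_def]
      by (rule multilinear_2I[where F = "\<lambda>u v. pairing (cs ! 0) u * (\<phi> v * pairing (cs ! 1) x)"])
        (use \<phi> lin_pairing in \<open>auto simp: lin_iff algebra_simps\<close>)
  qed
  ultimately show ?thesis
    using copairing_contract_left[OF \<phi>, of x] by (simp add: pairing_sym[of _ x] mult.commute)
qed

text \<open>If \<open>x\<close> is orthogonal to everything then the snake identity shows that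
  every linear form vanishes on \<open>x\<close>.\<close>

lemma pairing_nondegenerate:
  assumes "\<And>y. pairing x y = 0"
  shows "x = 0"
proof (rule vector_space_separates[OF vector_space_axioms])
  fix \<phi> assume \<phi>: "lin \<phi>"
  have "copairing (\<lambda>as. pairing x (as ! 0) * \<phi> (as ! 1)) = 0"
    by (rule tensor_power_apply_zero[OF vector_space_axioms copairing_in]) (simp add: assms)
  then have "\<phi> x = 0" using copairing_contract_left[OF \<phi>] by simp
  moreover have "\<phi> 0 = 0" using \<phi> module_hom.zero by (metis module_hom_iff_linear)
  ultimately show "\<phi> x = \<phi> 0" by simp
qed

lemma op_swap:
  assumes "length xs = k" "length ys = m"
  shows "op (swap_graph k m) (pure (xs @ x # y # ys)) = pure (xs @ y # x # ys)"
proof -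
  let ?F = "graph_juxt crossing_graph (identity_graph m)"
  have F: "is_graph ?F" by (intro is_graph_juxt is_graph_crossing is_graph_identity)
  have "op ?F (pure ([x, y] @ ys)) = pure ([y, x] @ ys)"
    using op_juxt_pure[OF is_graph_crossing is_graph_identity, of "[x, y]" ys m] assms
      tensor_mult_pure[of scale "[y, x]" ys]
    by (simp add: op_crossing op_identity_pure numeral_2_eq_2)
  then show ?thesis
    unfolding swap_graph_def
    using op_juxt_pure[OF is_graph_identity F, of xs k "[x, y] @ ys"] assms
      tensor_mult_pure[of scale xs "[y, x] @ ys"]
    by (simp add: op_identity_pure)
qed

lemma form_star_swap: "form (star_graph (length (xs @ x # y # ys))) (xs @ x # y # ys) =
    form (star_graph (length (xs @ x # y # ys))) (xs @ y # x # ys)"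
proof -
  define k m where "k = length xs" and "m = length ys"
  let ?G = "star_graph (k + 2 + m)" and ?F = "swap_graph k m"
  have G: "is_graph ?G" by (rule is_graph_star) simp
  have "is_graph (graph_comp ?G ?F)"
    by (rule graph_comp_orientation[OF G is_graph_swap]) simp_all
  from op_iso[OF star_swap_iso this]
  have "op ?G (pure (xs @ x # y # ys)) = op ?G (op ?F (pure (xs @ x # y # ys)))"
    using op_comp[OF G is_graph_swap, of k m "pure (xs @ x # y # ys)"]
    by (simp add: pure_in_tensor_power k_def m_def)
  then have "form ?G (xs @ x # y # ys) = form ?G (xs @ y # x # ys)"
    by (simp add: form_def op_swap k_def m_def)
  moreover have "length (xs @ x # y # ys) = k + 2 + m" by (simp add: k_def m_def)
  ultimately show ?thesis by (simp only:)
qed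

end

text \<open>The first entry of \<open>xs\<close> is moved to the front of \<open>ys\<close> by
  adjacent swaps; then it joins the common prefix \<open>zs\<close>.\<close>

lemma adjacent_swaps_invariant:
  assumes swap: "\<And>xs x y ys. length (xs @ x # y # ys) = r \<Longrightarrow> f (xs @ x # y # ys) = f (xs @ y # x # ys)"
    and "mset xs = mset ys" "length (zs @ xs) = r"
  shows "f (zs @ xs) = f (zs @ ys)"
  using assms(2,3)
proof (induction xs arbitrary: ys zs)
  case Nil
  then show ?case by simp
next
  case (Cons x xs)
  then have "x \<in> set ys" by (metis list.set_intros(1) mset_eq_setD)
  then obtain us vs where ys: "ys = us @ x # vs" by (metis split_list)
  have move: "f (zs @ us' @ x # vs') = f (zs @ x # us' @ vs')"
    if "length (zs @ us' @ x # vs') = r" for us' vs'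
    using that
  proof (induction us' arbitrary: vs' rule: rev_induct)
    case (snoc u us')
    have "f (zs @ (us' @ [u]) @ x # vs') = f ((zs @ us') @ u # x # vs')" by simp
    also have "\<dots> = f ((zs @ us') @ x # u # vs')" by (rule swap) (use snoc.prems in simp)
    also have "\<dots> = f (zs @ us' @ x # (u # vs'))" by simp
    also have "\<dots> = f (zs @ x # us' @ (u # vs'))" by (rule snoc.IH) (use snoc.prems in simp)
    finally show ?case by simp
  qed simp
  have "mset xs = mset (us @ vs)" using Cons.prems(1) ys by simp
  then have "f ((zs @ [x]) @ xs) = f ((zs @ [x]) @ us @ vs)"
    using Cons.prems(2) by (intro Cons.IH) simp_all
  also have "\<dots> = f (zs @ ys)"
  proof -
    have "length (x # xs) = length ys" using Cons.prems(1) by (metis size_mset)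
    then show ?thesis using move[of us vs] Cons.prems(2) by (simp add: ys)
  qed
  finally show ?case by simp
qed

context graph_action
begin

lemma action_structure: "(action_coupling scale Z, action_stars scale Z) \<in> symmetric_algebra_structures scale"
  unfolding symmetric_algebra_structures_def
proof (intro CollectI case_prodI conjI allI impI)
  have coupling: "action_coupling scale Z (pure [x, y]) = pairing x y" for x y
    by (simp add: action_coupling_def form_def op_def pure_in_tensor_power)
  show "action_coupling scale Z \<in> tensor_form scale 2"
    unfolding action_coupling_def by (rule to_scalar_op_tensor_form[OF is_graph_coupling]) simp_all
  show "action_coupling scale Z (pure [x, y]) = action_coupling scale Z (pure [y, x])" for x y
    unfolding coupling by (rule pairing_sym)
  show "x = 0" if "\<forall>y. action_coupling scale Z (pure [x, y]) = 0" for x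
    using that unfolding coupling by (intro pairing_nondegenerate) blast
  show "action_stars scale Z \<in> extensional {1..}" by (simp add: action_stars_def)
  fix r :: nat assume r: "r \<ge> 1"
  show "action_stars scale Z r \<in> tensor_form scale r"
    using to_scalar_op_tensor_form[OF is_graph_star[OF r]] r by (simp add: action_stars_def)
  fix xs :: "'v list" and \<sigma> assume *: "length xs = r \<and> \<sigma> permutes {..<r}"
  have star: "action_stars scale Z r (pure xs) = form (star_graph r) xs" if "length xs = r" for xs
    using r that by (simp add: action_stars_def form_def op_def pure_in_tensor_power)
  have "form (star_graph r) ([] @ xs) = form (star_graph r) ([] @ permute_list \<sigma> xs)"
  proof (rule adjacent_swaps_invariant)
    show "form (star_graph r) (us @ x # y # vs) = form (star_graph r) (us @ y # x # vs)"
      if "length (us @ x # y # vs) = r" for us x y vs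
      using form_star_swap[of us x y vs] unfolding that .
  qed (use * mset_permute_list[of \<sigma> xs] in auto)
  then show "action_stars scale Z r (pure xs) =
      action_stars scale Z r (pure (permute_list \<sigma> xs))"
    using star * by simp
qed

end

section \<open>Uniqueness of the action\<close>

lemma tensor_power_apply_not_multilinear:
  assumes "t \<in> tensor_power s n" "\<not> multilinear s (*) n f"
  shows "t f = 0"
  using assms(1) by (induction rule: tensor_power_induct) (use assms(2) in \<open>auto simp: tscale_def pure_tensor_def\<close>)

locale two_graph_actions =
  A: graph_action scale Z + A': graph_action scale Z'
  for scale :: "'k::field \<Rightarrow> 'v::ab_group_add \<Rightarrow> 'v" and Z Z' +
  assumes same_coupling: "action_coupling scale Z = action_coupling scale Z'"
    and same_stars: "action_stars scale Z = action_stars scale Z'"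
begin

text \<open>The graphs on which the two actions coincide. They are closed under composition,
  juxtaposition and isomorphism, and contain the coupling and the stars by assumption.\<close>

definition agree :: "('a, 'h, 'e) pregraph \<Rightarrow> bool" where
  "agree G \<longleftrightarrow> (\<forall>t\<in>tensor_power scale (n_in G). A.op G t = A'.op G t)"

lemma agreeI_pure:
  assumes "is_graph G" "\<And>xs. length xs = n_in G \<Longrightarrow> A.op G (pure_tensor scale xs) = A'.op G (pure_tensor scale xs)"
  shows "agree G"
  unfolding agree_def
  using linear_on_tensor_power_eqI[OF vector_space_tscale A.op_linear A'.op_linear] assms by blast

lemma agree_pure: "agree G \<Longrightarrow> length xs = n_in G \<Longrightarrow> A.op G (pure_tensor scale xs) = A'.op G (pure_tensor scale xs)"
  by (simp add: agree_def pure_in_tensor_power)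

lemma agree_comp:
  assumes "is_graph G" "is_graph F" "n_in G = n_out F" "agree G" "agree F"
  shows "agree (graph_comp G F)"
  unfolding agree_def
proof
  fix t assume "t \<in> tensor_power scale (n_in (graph_comp G F))"
  then have t: "t \<in> tensor_power scale (n_in F)" by simp
  have "A.op F t \<in> tensor_power scale (n_in G)" using A.op_in[OF assms(2) t] assms(3) by simp
  with t assms(4,5) show "A.op (graph_comp G F) t = A'.op (graph_comp G F) t"
    by (simp add: agree_def A.op_comp[OF assms(1-3)] A'.op_comp[OF assms(1-3)])
qed

lemma agree_juxt:
  assumes "is_graph G" "is_graph F" "agree G" "agree F"
  shows "agree (graph_juxt G F)"
proof (rule agreeI_pure[OF is_graph_juxt[OF assms(1,2)]])
  fix xs :: "'v list" assume xs: "length xs = n_in (graph_juxt G F)"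
  define us vs where "us = take (n_in G) xs" and "vs = drop (n_in G) xs"
  have l: "xs = us @ vs" "length us = n_in G" "length vs = n_in F" using xs by (simp_all add: us_def vs_def)
  show "A.op (graph_juxt G F) (pure_tensor scale xs) = A'.op (graph_juxt G F) (pure_tensor scale xs)"
    unfolding l(1) A.op_juxt_pure[OF assms(1,2) l(2,3)] A'.op_juxt_pure[OF assms(1,2) l(2,3)]
    using agree_pure[OF assms(3) l(2)] agree_pure[OF assms(4) l(3)] by simp
qed

lemma agree_iso:
  assumes "graph_iso G H" "is_graph G" "agree G"
  shows "agree H"
proof -
  have "n_in G = n_in H" using assms(1) by (simp add: graph_iso_def)
  then show ?thesis
    using assms(3) A.op_iso[OF assms(1,2)] A'.op_iso[OF assms(1,2)] by (simp add: agree_def)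
qed

text \<open>The form in which the decompositions of graphs are used.\<close>

lemma agree_comp_iso:
  assumes "graph_iso (graph_comp G F) H" "is_graph G" "is_graph F" "n_in G = n_out F" "agree G" "agree F"
  shows "agree H"
proof -
  have "is_graph (graph_comp G F)" using graph_comp_orientation[OF assms(2-4)] by metis
  then show ?thesis using agree_iso[OF assms(1)] agree_comp[OF assms(2-6)] by blast
qed

lemma agree_identity: "agree (identity_graph p)"
  by (simp add: agree_def A.op_identity A'.op_identity)

lemma agree_crossing: "agree crossing_graph"
proof (rule agreeI_pure[OF is_graph_crossing])
  fix xs :: "'v list" assume "length xs = n_in crossing_graph"
  then obtain x y where "xs = [x, y]" using length_2E[of xs] by auto
  then show "A.op crossing_graph (pure_tensor scale xs) = A'.op crossing_graph (pure_tensor scale xs)"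
    by (simp add: A.op_crossing A'.op_crossing)
qed

lemma same_pairing: "A.form coupling_graph xs = A'.form coupling_graph xs" if "length xs = 2"
  using fun_cong[OF same_coupling, of "pure_tensor scale xs"] that
  by (simp add: action_coupling_def A.form_def A'.form_def A.op_def A'.op_def pure_in_tensor_power)

lemma agree_coupling: "agree coupling_graph"
  by (rule agreeI_pure[OF is_graph_coupling])
    (simp add: A.op_form A'.op_form is_graph_coupling same_pairing)

lemma agree_star:
  assumes r: "r \<ge> 1"
  shows "agree (star_graph r)"
proof (rule agreeI_pure[OF is_graph_star[OF r]])
  fix xs :: "'v list" assume xs: "length xs = n_in (star_graph r)"
  have "A.form (star_graph r) xs = A'.form (star_graph r) xs"
    using fun_cong[OF fun_cong[OF same_stars, of r], of "pure_tensor scale xs"] xs r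
    by (simp add: action_stars_def A.form_def A'.form_def A.op_def A'.op_def pure_in_tensor_power)
  then show "A.op (star_graph r) (pure_tensor scale xs) = A'.op (star_graph r) (pure_tensor scale xs)"
    using xs by (simp add: A.op_form[OF is_graph_star[OF r]] A'.op_form[OF is_graph_star[OF r]])
qed

text \<open>A copairing is determined by the pairing: contracting \<open>A.copairing\<close> with
  \<open>A'.copairing\<close> by the common pairing gives either of them, by the two snake
  identities.\<close>

lemma same_copairing: "A.copairing = A'.copairing"
proof
  fix f :: "'v list \<Rightarrow> 'k"
  let ?u = "A.copairing" and ?u' = "A'.copairing"
  note vs = A.vector_space_axioms
  show "?u f = ?u' f"
  proof (cases "multilinear scale (*) 2 f")
    case f: True
    define h where "h cs as = f [cs ! 0, as ! 1] * A.pairing (cs ! 1) (as ! 0)" for cs as :: "'v list"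
    have "?u (h cs) = f [cs ! 0, cs ! 1]" for cs
      using A.copairing_contract_left[OF multilinear_2D(2)[OF f], of "cs ! 1" "cs ! 0"]
      by (simp add: h_def[abs_def] mult.commute)
    then have "?u' (\<lambda>cs. ?u (h cs)) = ?u' f"
      by (intro tensor_power_cong[OF vs A'.copairing_in f]) (auto elim!: length_2E)
    moreover have "?u' (\<lambda>cs. h cs as) = f [as ! 0, as ! 1]" for as
      using A'.copairing_contract_right[OF multilinear_2D(1)[OF f], of "as ! 1" "as ! 0"]
      by (simp add: h_def same_pairing)
    then have "?u (\<lambda>as. ?u' (\<lambda>cs. h cs as)) = ?u f"
      by (intro tensor_power_cong[OF vs A.copairing_in f]) (auto elim!: length_2E)
    moreover have "?u' (\<lambda>cs. ?u (h cs)) = ?u (\<lambda>as. ?u' (\<lambda>cs. h cs as))"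
    proof (rule contract_commute[OF vs A'.copairing_in A.copairing_in])
      note lin = linear_form_iff[OF vs]
      show "multilinear scale (*) 2 (\<lambda>cs. h cs as)" for as
        unfolding h_def
        by (rule multilinear_2I) (use multilinear_2D[OF f] A.lin_pairing in \<open>auto simp: lin algebra_simps\<close>)
      show "multilinear scale (*) 2 (h cs)" for cs
        unfolding h_def[abs_def]
        by (rule multilinear_2I[where F = "\<lambda>x y. f [cs ! 0, y] * A.pairing (cs ! 1) x"])
          (use multilinear_2D[OF f] A.lin_pairing in \<open>auto simp: lin algebra_simps\<close>)
    qed
    ultimately show ?thesis by simp
  next
    case False
    then show ?thesis
      using tensor_power_apply_not_multilinear A.copairing_in A'.copairing_in by metis
  qed
qed

lemma agree_copairing: "agree copairing_graph"
  by (rule agreeI_pure[OF is_graph_copairing])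
    (use same_copairing in \<open>simp add: A.copairing_def A'.copairing_def\<close>)

lemma agree_circle: "agree circle_graph"
  by (rule agree_comp_iso[OF circle_iso is_graph_coupling is_graph_copairing _ agree_coupling agree_copairing]) simp

lemma agree_swap: "agree (swap_graph k m)"
  unfolding swap_graph_def
  by (intro agree_juxt is_graph_juxt is_graph_identity is_graph_crossing agree_identity agree_crossing)

text \<open>A graph without vertices and inputs is a pairing of the outputs together with some
  circles. The circles are split off first. Then the partner of the first output is moved next to
  it by swaps of neighbours, and the two are split off as a copairing.\<close>

lemma agree_without_vertices:
  fixes G :: nat_graph
  shows "is_graph G \<Longrightarrow> n_in G = 0 \<Longrightarrow> verts G = {} \<Longrightarrow> agree G"
proof (induction "card (edges G)" arbitrary: G rule: less_induct)
  case less
  have halves: "halves G = {}" using less.prems by (auto simp: is_graph_def)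
  have fin: "finite (edges G)" using less.prems by (simp add: is_graph_def)
  have ends: "ends G = Out ` {..<n_out G}" using halves less.prems by (auto simp: ends_def)
  consider (circle) e where "e \<in> edges G" "\<And>x. x \<in> ends G \<Longrightarrow> edge_of G x \<noteq> e"
    | (empty) "edges G = {}" | (cap) "n_out G > 0"
    unfolding ends by fastforce
  then show ?case
  proof cases
    case circle
    let ?G' = "G\<lparr>edges := edges G - {e}\<rparr>"
    have G': "is_graph ?G'" by (rule is_graph_remove_circle[OF less.prems(1) circle(2)])
    have "card (edges ?G') < card (edges G)" using circle(1) fin by (simp add: card_Diff1_less del: card_Diff_insert)
    then have "agree ?G'" using less.hyps[of ?G'] less.prems G' by simp
    then show ?thesis
      by (intro agree_iso[OF remove_circle_iso[OF circle(1)]] is_graph_juxt is_graph_circle G' agree_juxt agree_circle)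
  next
    case empty
    then have "ends G = {}" using is_graph_edge_of[OF less.prems(1)] by blast
    then have "n_out G = 0" by (auto simp: ends)
    then have "graph_iso (identity_graph 0) G"
      using empty less.prems halves by (intro graph_isoI[of _ _ id id id]) auto
    then show ?thesis by (rule agree_iso[OF _ is_graph_identity agree_identity])
  next
    case cap
    \<comment> \<open>the partner of \<open>Out 0\<close> is \<open>Out (Suc j)\<close>; swaps decrease \<open>j\<close> and keep the number of edges\<close>
    have claim: "agree H" if "is_graph H" "n_in H = 0" "verts H = {}" "edges H = edges G"
      "Suc j < n_out H" "edge_of H (Out (Suc j)) = edge_of H (Out 0)" for H :: nat_graph and j
      using that
    proof (induction j arbitrary: H)
      case 0
      then have cap: "1 < n_out H" "edge_of H (Out 1) = edge_of H (Out 0)" by simp_all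
      have H': "is_graph (remove_cap H)" by (rule is_graph_remove_cap[OF 0(1) cap])
      have "edge_of H (Out 0) \<in> edges G" using 0 is_graph_edge_of[OF 0(1), of "Out 0"] by simp
      then have "card (edges (remove_cap H)) < card (edges G)"
        using fin 0(4) by (simp add: card_Diff1_less del: card_Diff_insert)
      then have "agree (remove_cap H)" using less.hyps H' 0 by simp
      then show ?case
        by (intro agree_iso[OF remove_cap_iso[OF 0(1) cap]] is_graph_juxt is_graph_copairing H'
            agree_juxt agree_copairing)
    next
      case (Suc j)
      let ?H' = "swap_outputs (Suc j) H"
      define m where "m = n_out H - (j + 3)"
      then have m: "n_out H = Suc j + 2 + m" using Suc.prems(5) by simp
      have H': "is_graph ?H'" by (rule is_graph_swap_outputs[OF Suc.prems(1,5)])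
      have "agree ?H'"
        using Suc.prems H' by (intro Suc.IH) (simp_all add: transpose_def)
      then show ?case
        by (intro agree_comp_iso[OF swap_outputs_iso[OF Suc.prems(1) m] is_graph_swap H' _ agree_swap])
          (simp_all add: m)
    qed
    have "Out 0 \<in> ends G" using cap by simp
    then obtain y where y: "y \<in> ends G" "y \<noteq> Out 0" "edge_of G y = edge_of G (Out 0)"
      using is_graph_partner[OF less.prems(1)] by metis
    then obtain i where i: "y = Out i" "i < n_out G" unfolding ends by blast
    with y(2) obtain j where "i = Suc j" by (cases i) auto
    then have "y = Out (Suc j)" "Suc j < n_out G" using i by simp_all
    then show ?thesis using claim[of G j] less.prems y by simp
  qed
qed

text \<open>Induction on the number of vertices, which are cut off as stars one after the
  other.\<close>

lemma agree_without_inputs: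
  fixes G :: nat_graph
  shows "is_graph G \<Longrightarrow> n_in G = 0 \<Longrightarrow> agree G"
proof (induction "card (verts G)" arbitrary: G rule: less_induct)
  case less
  show ?case
  proof (cases "verts G = {}")
    case True
    then show ?thesis using agree_without_vertices less.prems by blast
  next
    case False
    then obtain v where v: "v \<in> verts G" by blast
    let ?r = "card (halves_at G v)"
    obtain g where g: "bij_betw g {..<?r} (halves_at G v)"
      using ex_bij_betw_nat_finite[OF halves_at_finite[OF less.prems(1)]] unfolding atLeast0LessThan by blast
    have r: "?r \<ge> 1"
      using halves_at_finite[OF less.prems(1), of v] halves_at_nonempty[OF less.prems(1) v]
      by (simp add: Suc_le_eq card_gt_0_iff)
    let ?C = "cut_vertex G v ?r g"
    have C: "is_graph ?C" by (rule is_graph_cut_vertex[OF less.prems(1) g])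
    have "card (verts ?C) < card (verts G)"
      using v less.prems(1) by (simp add: is_graph_def card_Diff1_less del: card_Diff_insert)
    then have "agree ?C" using less.hyps[of ?C] C less.prems(2) by simp
    then show ?thesis
      by (intro agree_comp_iso[OF cut_vertex_iso[OF less.prems(1) v g]] is_graph_juxt is_graph_star is_graph_identity
          C agree_juxt agree_star agree_identity r) (simp_all)
  qed
qed

text \<open>Induction on the number of inputs, which are bent to outputs one after the
  other.\<close>

lemma agree_all:
  fixes G :: nat_graph
  shows "is_graph G \<Longrightarrow> agree G"
proof (induction "n_in G" arbitrary: G)
  case 0
  then show ?case by (simp add: agree_without_inputs)
next
  case (Suc p)
  have p: "n_in G = Suc p" using Suc.hyps(2) by simp
  have B: "is_graph (bend_graph G)" by (rule is_graph_bend[OF Suc.prems p])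
  have "agree (bend_graph G)" using Suc.hyps(1)[of "bend_graph G"] B p by simp
  then show ?case
    by (intro agree_comp_iso[OF bend_iso[OF Suc.prems p]] is_graph_juxt is_graph_coupling is_graph_identity
        B agree_juxt agree_coupling agree_identity) simp_all
qed

text \<open>By linearity the actions coincide on linear combinations of graphs; outside their
  domains both are \<open>undefined\<close>.\<close>

lemma actions_equal: "Z = Z'"
proof -
  have eq: "Z p q X t = Z' p q X t" for p q :: nat and X :: "'k graph_comb" and t
  proof (cases "X \<in> graph_prop p q \<and> t \<in> tensor_power scale p")
    case True
    then have X: "X \<in> graph_prop p q" and t: "t \<in> tensor_power scale p" by auto
    have single: "Z p q (Poly_Mapping.single K 1) t = Z' p q (Poly_Mapping.single K 1) t"
      if K: "K \<in> graph_classes p q" for K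
    proof -
      obtain G :: nat_graph where "K = iso_class G" "is_graph G" "n_in G = p" "n_out G = q"
        using K by (rule graph_classesE)
      then show ?thesis using agree_all[of G] t by (simp add: agree_def A.op_def A'.op_def graph_elem_def)
    qed
    have sums: "(\<Sum>K\<in>T. Poly_Mapping.single K (Poly_Mapping.lookup X K)) \<in> graph_prop p q \<and>
        Z p q (\<Sum>K\<in>T. Poly_Mapping.single K (Poly_Mapping.lookup X K)) t =
        Z' p q (\<Sum>K\<in>T. Poly_Mapping.single K (Poly_Mapping.lookup X K)) t"
      if "finite T" "T \<subseteq> graph_classes p q" for T
      using that
    proof (induction T)
      case empty
      have "gscale 0 X = 0" by (rule poly_mapping_eqI) (simp add: lookup_gscale)
      then have "Z p q 0 t = tscale 0 (Z p q X t)" "Z' p q 0 t = tscale 0 (Z' p q X t)"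
        using A.Z_prop_linear[OF t, of q] A'.Z_prop_linear[OF t, of q] X
        unfolding linear_on_set_def by metis+
      then show ?case by (simp add: tscale_def graph_prop_iff)
    next
      case (insert K T)
      let ?W = "Poly_Mapping.single K (Poly_Mapping.lookup X K)"
      have 1: "Poly_Mapping.single K 1 \<in> (graph_prop p q :: 'k graph_comb set)"
        using insert.prems by (intro graph_prop_single) simp
      have W: "?W = gscale (Poly_Mapping.lookup X K) (Poly_Mapping.single K 1)"
        by (rule poly_mapping_eqI) (simp add: lookup_gscale lookup_single when_def)
      have "?W \<in> graph_prop p q" using insert.prems by (intro graph_prop_single) simp
      moreover have "Z p q ?W t = Z' p q ?W t"
        using A.Z_prop_linear[OF t, of q] A'.Z_prop_linear[OF t, of q] 1 single[of K] insert.prems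
        unfolding linear_on_set_def W by simp
      ultimately show ?case
        using insert A.Z_prop_linear[OF t, of q] A'.Z_prop_linear[OF t, of q]
        unfolding linear_on_set_def by (simp add: graph_prop_add)
    qed
    have "(\<Sum>K\<in>Poly_Mapping.keys X. Poly_Mapping.single K (Poly_Mapping.lookup X K)) = X"
      by (rule poly_mapping_eqI) (simp add: lookup_sum lookup_single when_def in_keys_iff)
    moreover have "Poly_Mapping.keys X \<subseteq> graph_classes p q" using X by (simp add: graph_prop_def)
    ultimately show ?thesis using sums[OF finite_keys[of X]] by (simp only:)
  next
    case False
    then consider "X \<notin> graph_prop p q" | "X \<in> graph_prop p q" "t \<notin> tensor_power scale p" by blast
    then show ?thesis
    proof cases
      case 1
      then show ?thesis
        using A.Z_prop_extensional[of p q] A'.Z_prop_extensional[of p q] by (simp add: extensional_def)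
    next
      case 2
      then show ?thesis
        using A.Z_extensional[of X p q] A'.Z_extensional[of X p q] by (simp add: extensional_def)
    qed
  qed
  show ?thesis by (intro ext) (simp only: eq)
qed

end

section \<open>The equivalence\<close>

theorem theorem2p3:
  fixes scale :: "'k::field \<Rightarrow> 'v::ab_group_add \<Rightarrow> 'v" and B :: "'v set"
  assumes "finite_dimensional_vector_space scale B"
  shows "bij_betw (\<lambda>Z. (action_coupling scale Z, action_stars scale Z))
           (graph_actions scale) (symmetric_algebra_structures scale)"
proof (rule bij_betwI')
  interpret finite_dimensional_vector_space scale B by fact
  have action: "graph_action scale Z" if "Z \<in> graph_actions scale" for Z
    using that by unfold_locales
  show "(action_coupling scale Z, action_stars scale Z) \<in> symmetric_algebra_structures scale"
    if "Z \<in> graph_actions scale" for Z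
    by (rule graph_action.action_structure[OF action[OF that]])
  show "((action_coupling scale Z, action_stars scale Z) = (action_coupling scale Z', action_stars scale Z')) =
      (Z = Z')" if "Z \<in> graph_actions scale" "Z' \<in> graph_actions scale" for Z Z'
  proof
    assume "(action_coupling scale Z, action_stars scale Z) = (action_coupling scale Z', action_stars scale Z')"
    then have "two_graph_actions scale Z Z'"
      using action[OF that(1)] action[OF that(2)]
      by (simp add: two_graph_actions_def two_graph_actions_axioms_def)
    then show "Z = Z'" by (rule two_graph_actions.actions_equal)
  qed simp
  fix bS assume "bS \<in> symmetric_algebra_structures scale"
  then obtain b S where bS: "bS = (b, S)" "(b, S) \<in> symmetric_algebra_structures scale" by (cases bS) auto
  interpret symmetric_algebra scale B b S by unfold_locales (rule bS)
  show "\<exists>Z\<in>graph_actions scale. bS = (action_coupling scale Z, action_stars scale Z)"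
    by (rule bexI[OF _ action_in_graph_actions])
      (simp only: bS(1) action_coupling_action action_stars_action)
qed

end
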